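(* Let $H\in(\frac13,\frac12]$, let $\boldsymbol{\omega}=(\omega^1,\omega^2)$ be the canonical lift of fractional Brownian motion with Hurst index $H$ and, for $\delta\in(0,1)$, let $\boldsymbol{\omega}_\delta=(W_\delta(\cdot,\omega^1),\mathbb{W}_\delta(\omega^1))$ be its smooth approximation. Then for any $T>0$ and $\beta\in(\frac13,H)$, $$\rho_{\beta,[-T,T]}(\boldsymbol{\omega},\boldsymbol{\omega}_\delta)\to0\quad\text{as }\delta\to0 .$$ Furthermore, the convergence takes place for all $\omega$ in a $\theta$-invariant set $\Omega'\subset\Omega$ of full $\mathbb{P}_H$-measure.
   Context: Fractional Brownian motion: $\omega^1=(\omega^{1,1},\dots,\omega^{1,d})$ is the canonical two-sided fractional Brownian motion in $\mathbb{R}^d$ with Hurst index $H$, i.e. the coordinate process on $\Omega$ under the Gaussian measure $\mathbb{P}_H$, with independent components, centered, with covariance $\frac12(|t|^{2H}+|s|^{2H}-|t-s|^{2H})\,\mathrm{Id}$. Here $\Omega\subset C_0(\mathbb{R},\mathbb{R}^d)$ is the $\theta$-invariant full-measure set of continuous paths vanishing at $0$ that are $\gamma$-Hölder on every $[-T,T]$ for every $\gamma<H$, and $\theta_t\omega(\cdot)=\omega(\cdot+t)-\omega(t)$ is the Wiener shift, which preserves $\mathbb{P}_H$. A set $B$ is $\theta$-invariant if $\theta_t^{-1}B=B$ for all $t\in\mathbb{R}$. For a path $X$ write $X_{s,t}=X_t-X_s$. Rough path: $\boldsymbol{\omega}=(\omega^1,\omega^2)$ where, for $s<t$, $\omega^{2,i,j}_{s,t}=\int_s^t\omega^{1,i}_{s,r}\,d\omega^{1,j}_r$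 for $i<j$ is the $L^2$-limit of the left-point Riemann sums $\sum_{[u,v]\in\mathcal{P}}\omega^{1,i}_{s,u}\omega^{1,j}_{u,v}$ as the mesh of the partition $\mathcal{P}$ of $[s,t]$ tends to $0$, $\omega^{2,i,i}_{s,t}=\frac12(\omega^{1,i}_{s,t})^2$, and $\omega^{2,j,i}_{s,t}=-\omega^{2,i,j}_{s,t}+\omega^{1,i}_{s,t}\omega^{1,j}_{s,t}$. This determines $\omega^2$ up to null sets, and the assertion is for a suitable (continuous) version of $\omega^2$. Approximation: $W_\delta(t,\omega^1)=\int_0^t\frac1\delta\left(\omega^1(r+\delta)-\omega^1(r)\right)dr$ for $t\in\mathbb{R}$, and $\mathbb{W}_\delta(\omega^1)_{s,t}=\int_s^tW_\delta(\cdot,\omega^1)_{s,r}\otimes dW_\delta(r,\omega^1)$ (Riemann–Stieltjes integral). Metric: $\rho_{\beta,I}(\mathbf{X},\mathbf{Y})=\sup_{s<t\in I}\frac{|X_{s,t}-Y_{s,t}|}{|t-s|^{\beta}}+\sup_{s<t\in I}\frac{|\mathbb{X}_{s,t}-\mathbb{Y}_{s,t}|}{|t-s|^{2\beta}}$ for $\mathbf{X}=(X,\mathbb{X})$, $\mathbf{Y}=(Y,\mathbb{Y})$. *)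

theory Defs
  imports "HOL-Probability.Probability"
begin

section \<open>Path space and fractional Brownian motion\<close>

definition holder_paths :: "real \<Rightarrow> (real \<Rightarrow> real ^ 'd) set" where
  "holder_paths H = {\<omega>. continuous_on UNIV \<omega> \<and> \<omega> 0 = 0 \<and>
     (\<forall>\<gamma> T. 0 < \<gamma> \<and> \<gamma> < H \<and> 0 < T \<longrightarrow>
       (\<exists>C. \<forall>s\<in>{-T..T}. \<forall>t\<in>{-T..T}. norm (\<omega> t - \<omega> s) \<le> C * \<bar>t - s\<bar> powr \<gamma>))}"

text \<open>The trace on \<^term>\<open>holder_paths H\<close> of the \<open>\<sigma>\<close>-algebra generated by the evaluations
  \<open>\<omega> \<mapsto> \<omega> t\<close>. On continuous paths this is the Borel \<open>\<sigma>\<close>-algebra of locally uniform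
  convergence.\<close>

definition path_space :: "real \<Rightarrow> (real \<Rightarrow> real ^ 'd) measure" where
  "path_space H = restrict_space (\<Pi>\<^sub>M t\<in>UNIV. borel) (holder_paths H)"

definition fbm_cov :: "real \<Rightarrow> real \<Rightarrow> real \<Rightarrow> real" where
  "fbm_cov H s t =
     (\<bar>t\<bar> powr (2 * H) + \<bar>s\<bar> powr (2 * H) - \<bar>t - s\<bar> powr (2 * H)) / 2"

text \<open>Point masses count as Gaussian; they need a separate case because they have no density.\<close>

definition gaussian_rv :: "'a measure \<Rightarrow> ('a \<Rightarrow> real) \<Rightarrow> bool" where
  "gaussian_rv M Y \<longleftrightarrow> Y \<in> borel_measurable M \<and>
     ((\<exists>\<mu> \<sigma>. 0 < \<sigma> \<and> distributed M lborel Y (normal_density \<mu> \<sigma>)) \<or>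
      (\<exists>\<mu>. AE x in M. Y x = \<mu>))"

locale canonical_fbm = prob_space P
  for H :: real and P :: "(real \<Rightarrow> real ^ 'd) measure" +
  assumes sets_P: "sets P = sets (path_space H)"
    and gaussian: "\<And>(J :: (real \<times> 'd) set) c. finite J \<Longrightarrow>
          gaussian_rv P (\<lambda>\<omega>. \<Sum>(t, i)\<in>J. c (t, i) * \<omega> t $ i)"
    and centered: "\<And>t i. expectation (\<lambda>\<omega>. \<omega> t $ i) = 0"
    and covariance: "\<And>s t i j. expectation (\<lambda>\<omega>. \<omega> s $ i * \<omega> t $ j) =
          (if i = j then fbm_cov H s t else 0)"
    and indep_components:
          "indep_vars (\<lambda>_. \<Pi>\<^sub>M t\<in>UNIV. borel) (\<lambda>i \<omega> t. \<omega> t $ i) UNIV"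

definition wiener_shift :: "real \<Rightarrow> (real \<Rightarrow> real ^ 'd) \<Rightarrow> real \<Rightarrow> real ^ 'd" where
  "wiener_shift t \<omega> = (\<lambda>r. \<omega> (r + t) - \<omega> t)"

text \<open>The preimage is taken in \<^term>\<open>holder_paths H\<close>: since the shift annihilates constants, a
  preimage in the full function type would also contain paths not starting at \<open>0\<close>.\<close>

definition shift_invariant :: "real \<Rightarrow> (real \<Rightarrow> real ^ 'd) set \<Rightarrow> bool" where
  "shift_invariant H B \<longleftrightarrow> (\<forall>t. wiener_shift t -` B \<inter> holder_paths H = B)"


section \<open>The canonical lift\<close>

text \<open>Partitions of \<open>[a, b]\<close> are \<open>division_of\<close>; a cell \<open>K = [u, v]\<close> has endpoints
  \<open>u = Inf K\<close> and \<open>v = Sup K\<close>. Degenerate cells are allowed but contribute nothing to the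
  sums below.\<close>

definition mesh_filter :: "real \<Rightarrow> real \<Rightarrow> real set set filter" where
  "mesh_filter a b = (INF \<eta>\<in>{0<..}.
     principal {D. D division_of {a..b} \<and> (\<forall>K\<in>D. Sup K - Inf K < \<eta>)})"

definition tagged_mesh_filter :: "real \<Rightarrow> real \<Rightarrow> (real \<times> real set) set filter" where
  "tagged_mesh_filter a b = (INF \<eta>\<in>{0<..}.
     principal {p. p tagged_division_of {a..b} \<and> (\<forall>(x, K)\<in>p. Sup K - Inf K < \<eta>)})"

definition left_riemann_sum :: "(real \<Rightarrow> real) \<Rightarrow> (real \<Rightarrow> real) \<Rightarrow> real set set \<Rightarrow> real" where
  "left_riemann_sum f g D = (\<Sum>K\<in>D. f (Inf K) * (g (Sup K) - g (Inf K)))"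

text \<open>\<open>om2 \<omega> s t\<close> is only meaningful for \<open>s \<le> t\<close>. The limit of the Riemann sums fixes it up to a
  null set for each pair \<open>s < t\<close>, so the predicate describes the continuous versions of the
  second-order process. The \<open>L\<^sup>2\<close>-distance is a nonnegative integral, so that no
  integrability side condition is hidden.\<close>

definition continuous_lift ::
    "(real \<Rightarrow> real ^ ('d :: {finite, linorder})) measure \<Rightarrow>
     ((real \<Rightarrow> real ^ ('d :: {finite, linorder})) \<Rightarrow> real \<Rightarrow> real \<Rightarrow>
       real ^ ('d :: {finite, linorder}) ^ ('d :: {finite, linorder})) \<Rightarrow> bool" where
  "continuous_lift P om2 \<longleftrightarrow>
     (\<forall>\<omega>\<in>space P. continuous_on {(s, t). s \<le> t} (\<lambda>(s, t). om2 \<omega> s t)) \<and>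
     (\<forall>s t i j. s < t \<and> i < j \<longrightarrow>
        (\<lambda>\<omega>. om2 \<omega> s t $ i $ j) \<in> borel_measurable P \<and>
        ((\<lambda>D. \<integral>\<^sup>+ \<omega>. ennreal
             ((left_riemann_sum (\<lambda>r. \<omega> r $ i - \<omega> s $ i) (\<lambda>r. \<omega> r $ j) D
               - om2 \<omega> s t $ i $ j)\<^sup>2) \<partial>P) \<longlongrightarrow> 0) (mesh_filter s t)) \<and>
     (\<forall>\<omega>\<in>space P. \<forall>s t i. s < t \<longrightarrow> om2 \<omega> s t $ i $ i = (\<omega> t $ i - \<omega> s $ i)\<^sup>2 / 2) \<and>
     (\<forall>\<omega>\<in>space P. \<forall>s t i j. s < t \<and> i < j \<longrightarrow>
        om2 \<omega> s t $ j $ i =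
          - om2 \<omega> s t $ i $ j + (\<omega> t $ i - \<omega> s $ i) * (\<omega> t $ j - \<omega> s $ j))"


section \<open>The smooth approximation\<close>

definition rs_integral :: "(real \<Rightarrow> real) \<Rightarrow> (real \<Rightarrow> real) \<Rightarrow> real \<Rightarrow> real \<Rightarrow> real" where
  "rs_integral f g a b =
     Lim (tagged_mesh_filter a b) (\<lambda>p. \<Sum>(x, K)\<in>p. f x * (g (Sup K) - g (Inf K)))"

definition smooth_path :: "real \<Rightarrow> (real \<Rightarrow> real ^ 'd) \<Rightarrow> real \<Rightarrow> real ^ 'd" where
  "smooth_path \<delta> \<omega> t = (LBINT r=ereal 0..ereal t. (1 / \<delta>) *\<^sub>R (\<omega> (r + \<delta>) - \<omega> r))"

definition smooth_area :: "real \<Rightarrow> (real \<Rightarrow> real ^ 'd) \<Rightarrow> real \<Rightarrow> real \<Rightarrow> real ^ 'd ^ 'd" where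
  "smooth_area \<delta> \<omega> s t = (\<chi> i j.
     rs_integral (\<lambda>r. smooth_path \<delta> \<omega> r $ i - smooth_path \<delta> \<omega> s $ i)
       (\<lambda>r. smooth_path \<delta> \<omega> r $ j) s t)"


section \<open>The rough path metric\<close>

text \<open>Values in \<^typ>\<open>ennreal\<close>, so that an infinite supremum is \<open>\<infinity>\<close> and not unspecified. The
  norm on matrices is the Euclidean (Hilbert--Schmidt) norm.\<close>

definition rough_dist ::
    "real \<Rightarrow> real set \<Rightarrow>
     (real \<Rightarrow> real ^ 'd) \<times> (real \<Rightarrow> real \<Rightarrow> real ^ 'd ^ 'd) \<Rightarrow>
     (real \<Rightarrow> real ^ 'd) \<times> (real \<Rightarrow> real \<Rightarrow> real ^ 'd ^ 'd) \<Rightarrow> ennreal" where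
  "rough_dist \<beta> I = (\<lambda>(X, XX) (Y, YY).
     (SUP (s, t)\<in>{(s, t). s \<in> I \<and> t \<in> I \<and> s < t}.
        ennreal (norm ((X t - X s) - (Y t - Y s)) / \<bar>t - s\<bar> powr \<beta>)) +
     (SUP (s, t)\<in>{(s, t). s \<in> I \<and> t \<in> I \<and> s < t}.
        ennreal (norm (XX s t - YY s t) / \<bar>t - s\<bar> powr (2 * \<beta>))))"

end

theory Submission
  imports Defs
begin

text \<open>Off the diagonal, the area of the mollified path is an average of left-point Riemann sums of
  pairs of shifted coordinates. Conditionally on coordinate \<open>i\<close> such a sum is Gaussian, and since
  disjoint increments of fractional Brownian motion with \<open>H \<le> 1/2\<close> are negatively correlated, its
  conditional variance is a combination of squares of Gaussian variables with nonnegative weights.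
  Jensen's inequality then bounds every even moment by a power of the second one, and the second
  moment of the difference of two areas is at most a constant times
  \<open>\<delta> powr (2 * H - 2 * \<beta>) * (t - s) powr (2 * \<beta> + 2 * H)\<close>.

  Because mollified areas are Hoelder continuous with a constant polynomial in \<open>1 / \<delta>\<close>, it is enough to control
  them for \<open>\<delta>\<close>, \<open>s\<close>, \<open>t\<close> in finite grids of polynomial size, where high moments give an almost
  sure geometric rate. The paths with such a rate form the invariant set, and the limit is the lift;
  by Chen's relation its distance to a Riemann sum is a sum of areas over the cells, which is small
  in \<open>L\<^sup>2\<close> by the same negative correlation.\<close>

text \<open>The nonnegative weights come from a positivity that holds for every grid: off-diagonal
  covariances are nonpositive, while row sums are covariances of an increment with the increment
  over the whole interval and hence nonnegative. This lets a plain Jensen inequality do the work of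
  hypercontractivity. The resulting double sums are bounded uniformly in the grid under the Young
  condition \<open>1 < 2 * \<alpha> + 2 * H\<close>, which \<open>\<alpha> = \<beta> > 1 / 3\<close>
  and \<open>H > 1 / 3\<close> satisfy.

  Riemann sums of the rough path are not known to converge at this stage. For each fixed grid they
  only serve as a common reference for two mollified sums, and Fatou's lemma refines the grid for
  the mollified areas alone.

  A single set of paths has to serve all \<open>T\<close> and \<open>\<beta>\<close>, to be
  measurable for a sigma-algebra generated by evaluations, and to be exactly invariant. It is
  therefore cut out by countably many exponents, windows and constants, in terms of mollified areas
  only: a shift merely enlarges the window, and continuity of areas reduces the real parameters to
  rational ones.\<close>

section \<open>Riemann--Stieltjes sums\<close>

text \<open>By the fundamental theorem of calculus the increment of \<open>G\<close> over a cell is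
  the integral of \<open>g\<close>. A cell thus contributes the error
  \<open>integral K (\<lambda>r. (f x - f r) * g r)\<close>, which uniform continuity of
  \<open>f\<close> and boundedness of \<open>g\<close> make small relative to the length of the
  cell.\<close>

lemma rs_sum_close:
  fixes f g G :: "real \<Rightarrow> real"
  assumes ab: "a \<le> b" and f: "continuous_on {a..b} f" and g: "continuous_on {a..b} g"
    and G: "\<And>x. x \<in> {a..b} \<Longrightarrow> (G has_real_derivative g x) (at x within {a..b})"
    and e: "e > 0"
  obtains \<eta> where "\<eta> > 0"
    "\<And>p. p tagged_division_of {a..b} \<Longrightarrow> (\<forall>(x, K)\<in>p. Sup K - Inf K < \<eta>) \<Longrightarrow>
      \<bar>(\<Sum>(x, K)\<in>p. f x * (G (Sup K) - G (Inf K))) - integral {a..b} (\<lambda>r. f r * g r)\<bar> \<le> e"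
proof -
  have "bounded (g ` {a..b})"
    using compact_continuous_image[OF g] by (simp add: compact_imp_bounded)
  then obtain M where M: "M > 0" "\<And>x. x \<in> {a..b} \<Longrightarrow> \<bar>g x\<bar> \<le> M"
    by (metis bounded_pos image_eqI real_norm_def)
  have uc: "uniformly_continuous_on {a..b} f"
    by (rule compact_uniformly_continuous[OF f]) simp
  \<comment> \<open>The summand \<open>1\<close> keeps the denominator positive when
    \<open>a = b\<close>.\<close>
  define e' where "e' = e / (M * (b - a + 1))"
  have e': "e' > 0" using e M ab by (auto simp: e'_def intro!: divide_pos_pos mult_pos_pos)
  obtain \<eta> where \<eta>: "\<eta> > 0" "\<And>x y. x \<in> {a..b} \<Longrightarrow> y \<in> {a..b} \<Longrightarrow> \<bar>y - x\<bar> < \<eta> \<Longrightarrow> \<bar>f y - f x\<bar> < e'"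
    using uc e' unfolding uniformly_continuous_on_def dist_real_def by meson
  have fg: "(\<lambda>r. f r * g r) integrable_on {a..b}"
    by (intro integrable_continuous_real continuous_intros f g)
  show ?thesis
  proof (rule that[OF \<eta>(1)])
    fix p assume p: "p tagged_division_of {a..b}" and mesh: "\<forall>(x, K)\<in>p. Sup K - Inf K < \<eta>"
    have cell: "\<bar>f x * (G (Sup K) - G (Inf K)) - integral K (\<lambda>r. f r * g r)\<bar> \<le> e' * M * measure lborel K"
      if xK: "(x, K) \<in> p" for x K
    proof -
      obtain u v where K: "K = {u..v}" using tagged_division_ofD(4)[OF p xK] by auto
      have x: "x \<in> K" and sub: "K \<subseteq> {a..b}" using tagged_division_ofD(2,3)[OF p xK] by auto
      have uv: "u \<le> v" using x K by auto
      have "Sup K - Inf K < \<eta>" using mesh xK by auto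
      then have small: "v - u < \<eta>" using K uv by simp
      have sub': "{u..v} \<subseteq> {a..b}" using sub K by simp
      have "(G has_real_derivative g x) (at x within {u..v})" if "x \<in> {u..v}" for x
        using that sub' by (intro DERIV_subset[OF G sub']) auto
      then have ig: "(g has_integral (G v - G u)) {u..v}"
        using uv by (intro fundamental_theorem_of_calculus)
          (auto simp: has_real_derivative_iff_has_vector_derivative[symmetric])
      have cf: "continuous_on {u..v} f" and cg: "continuous_on {u..v} g"
        using f g sub' continuous_on_subset by blast+
      have "((\<lambda>r. f x * g r - f r * g r) has_integral
          (f x * (G v - G u) - integral {u..v} (\<lambda>r. f r * g r))) {u..v}"
        by (intro has_integral_diff has_integral_mult_right ig integrable_integral
            integrable_continuous_real continuous_intros cf cg)
      moreover have "norm (f x * g r - f r * g r) \<le> e' * M" if r: "r \<in> {u..v}" for r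
      proof -
        have "\<bar>x - r\<bar> < \<eta>" using r x K small by auto
        then have "\<bar>f x - f r\<bar> < e'" using \<eta>(2)[of r x] r x K sub' by auto
        moreover have "\<bar>g r\<bar> \<le> M" using M r sub' by auto
        ultimately have "\<bar>f x - f r\<bar> * \<bar>g r\<bar> \<le> e' * M" using e' by (intro mult_mono) auto
        then show ?thesis by (simp add: left_diff_distrib[symmetric] abs_mult)
      qed
      ultimately have "norm (f x * (G v - G u) - integral {u..v} (\<lambda>r. f r * g r)) \<le> e' * M * measure lborel (cbox u v)"
        using e' M by (intro has_integral_bound[where f="\<lambda>r. f x * g r - f r * g r"]) auto
      then show ?thesis using K uv by simp
    qed
    have "integral {a..b} (\<lambda>r. f r * g r) = (\<Sum>(x, K)\<in>p. integral K (\<lambda>r. f r * g r))"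
      using integral_combine_tagged_division_topdown[of "\<lambda>r. f r * g r" a b p] fg p by simp
    then have "\<bar>(\<Sum>(x, K)\<in>p. f x * (G (Sup K) - G (Inf K))) - integral {a..b} (\<lambda>r. f r * g r)\<bar>
        = \<bar>\<Sum>(x, K)\<in>p. f x * (G (Sup K) - G (Inf K)) - integral K (\<lambda>r. f r * g r)\<bar>"
      by (simp add: sum_subtractf split_def)
    also have "\<dots> \<le> (\<Sum>(x, K)\<in>p. e' * M * measure lborel K)"
      unfolding split_def by (intro order_trans[OF sum_abs] sum_mono) (use cell in auto)
    also have "\<dots> = e' * M * (b - a)"
      using additive_content_tagged_division[of p a b] p ab
      by (simp add: split_def sum_distrib_left[symmetric])
    also have "\<dots> \<le> e"
    proof -
      have "e' * M * (b - a) \<le> e' * M * (b - a + 1)" using e' M by (intro mult_left_mono) auto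
      also have "\<dots> = e" using M ab by (simp add: e'_def)
      finally show ?thesis .
    qed
    finally show "\<bar>(\<Sum>(x, K)\<in>p. f x * (G (Sup K) - G (Inf K))) - integral {a..b} (\<lambda>r. f r * g r)\<bar> \<le> e" .
  qed
qed

lemma eventually_INF_principal_antimono:
  fixes A :: "real \<Rightarrow> 'a set"
  assumes "\<And>x y. x \<le> y \<Longrightarrow> A x \<subseteq> A y"
  shows "eventually Q (INF \<eta>\<in>{0<..}. principal (A \<eta>)) \<longleftrightarrow> (\<exists>\<eta>>0. \<forall>p\<in>A \<eta>. Q p)"
proof (subst eventually_INF_base, goal_cases)
  case (2 x y)
  have "A (min x y) \<subseteq> A x \<inter> A y" using assms[of "min x y" x] assms[of "min x y" y] by auto
  then show ?case using 2 by (intro bexI[of _ "min x y"]) auto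
qed (auto simp: eventually_principal)

lemma eventually_tagged_mesh_filter:
  "eventually Q (tagged_mesh_filter a b) \<longleftrightarrow>
    (\<exists>\<eta>>0. \<forall>p. p tagged_division_of {a..b} \<and> (\<forall>(x, K)\<in>p. Sup K - Inf K < \<eta>) \<longrightarrow> Q p)"
  unfolding tagged_mesh_filter_def
  by (subst eventually_INF_principal_antimono) (force simp: split_def)+

lemma eventually_mesh_filter:
  "eventually Q (mesh_filter a b) \<longleftrightarrow>
    (\<exists>\<eta>>0. \<forall>D. D division_of {a..b} \<and> (\<forall>K\<in>D. Sup K - Inf K < \<eta>) \<longrightarrow> Q D)"
  unfolding mesh_filter_def
  by (subst eventually_INF_principal_antimono) force+

text \<open>A limit along a filter is unique only if the filter is not trivial; Cousin's lemma
  supplies tagged divisions of arbitrarily small mesh.\<close>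

lemma tagged_mesh_filter_neq_bot: "tagged_mesh_filter a b \<noteq> bot"
proof -
  have "\<exists>p. p tagged_division_of {a..b} \<and> (\<forall>(x, K)\<in>p. Sup K - Inf K < \<eta>)" if "\<eta> > 0" for \<eta> :: real
  proof -
    \<comment> \<open>Both endpoints of a cell lie within \<open>\<eta> / 3\<close> of the tag, so
      its length is below \<open>2 * \<eta> / 3\<close>.\<close>
    obtain p where p: "p tagged_division_of (cbox a b)" "(\<lambda>x. ball x (\<eta> / 3)) fine p"
      using fine_division_exists[OF gauge_ball[of "\<eta> / 3"], of a b] \<open>\<eta> > 0\<close> by (metis divide_pos_pos zero_less_numeral)
    have "Sup K - Inf K < \<eta>" if xK: "(x, K) \<in> p" for x K
    proof -
      obtain u v where K: "K = {u..v}" using tagged_division_ofD(4)[OF p(1) xK] by auto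
      have "x \<in> K" using tagged_division_ofD(2)[OF p(1) xK] .
      moreover have "K \<subseteq> ball x (\<eta> / 3)" using p(2) xK by (auto simp: fine_def)
      moreover have "u \<in> K" "v \<in> K" using \<open>x \<in> K\<close> K by auto
      ultimately have "u \<in> ball x (\<eta> / 3)" "v \<in> ball x (\<eta> / 3)" by blast+
      moreover have "u \<le> v" using \<open>x \<in> K\<close> K by simp
      ultimately show ?thesis using K by (auto simp: dist_real_def abs_if split: if_splits)
    qed
    then show ?thesis using p(1) by auto
  qed
  then show ?thesis
    unfolding trivial_limit_def eventually_tagged_mesh_filter by blast
qed

lemma rs_integral_eq:
  fixes f g G :: "real \<Rightarrow> real"
  assumes "a \<le> b" "continuous_on {a..b} f" "continuous_on {a..b} g"
    "\<And>x. x \<in> {a..b} \<Longrightarrow> (G has_real_derivative g x) (at x within {a..b})"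
  shows "rs_integral f G a b = integral {a..b} (\<lambda>r. f r * g r)"
  unfolding rs_integral_def
proof (rule tendsto_Lim[OF tagged_mesh_filter_neq_bot], rule tendstoI)
  fix e :: real assume "e > 0"
  obtain \<eta> where "\<eta> > 0"
    "\<And>p. p tagged_division_of {a..b} \<Longrightarrow> (\<forall>(x, K)\<in>p. Sup K - Inf K < \<eta>) \<Longrightarrow>
      \<bar>(\<Sum>(x, K)\<in>p. f x * (G (Sup K) - G (Inf K))) - integral {a..b} (\<lambda>r. f r * g r)\<bar> \<le> e / 2"
    by (rule rs_sum_close[OF assms half_gt_zero[OF \<open>e > 0\<close>]]) blast+
  then show "\<forall>\<^sub>F p in tagged_mesh_filter a b.
      dist (\<Sum>(x, K)\<in>p. f x * (G (Sup K) - G (Inf K))) (integral {a..b} (\<lambda>r. f r * g r)) < e"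
    using \<open>e > 0\<close> unfolding eventually_tagged_mesh_filter dist_real_def
    by (intro exI[of _ \<eta>]) fastforce
qed

section \<open>Riemann sums on equidistant grids\<close>

definition grid :: "real \<Rightarrow> real \<Rightarrow> nat \<Rightarrow> nat \<Rightarrow> real" where
  "grid s t n k = s + real k * (t - s) / real n"

lemma grid_0 [simp]: "grid s t n 0 = s"
  by (simp add: grid_def)

lemma grid_n [simp]: "n > 0 \<Longrightarrow> grid s t n n = t"
  by (simp add: grid_def)

lemma grid_diff: "grid s t n k - grid s t n l = (real k - real l) * ((t - s) / real n)"
  by (simp add: grid_def diff_divide_distrib algebra_simps)

lemma grid_mono: "s \<le> t \<Longrightarrow> k \<le> l \<Longrightarrow> grid s t n k \<le> grid s t n l"
  by (auto simp: grid_def intro!: divide_right_mono mult_right_mono)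

lemma grid_ge: "s \<le> t \<Longrightarrow> s \<le> grid s t n k"
  using grid_mono[of s t 0 k n] by simp

lemma grid_le: "s \<le> t \<Longrightarrow> k \<le> n \<Longrightarrow> 0 < n \<Longrightarrow> grid s t n k \<le> t"
  using grid_mono[of s t k n n] by simp

lemma grid_strict_mono: "s < t \<Longrightarrow> k < l \<Longrightarrow> 0 < n \<Longrightarrow> grid s t n k < grid s t n l"
  by (auto simp: grid_def intro!: divide_strict_right_mono mult_strict_right_mono)

lemma tagged_division_of_chain:
  fixes u :: "nat \<Rightarrow> real"
  assumes "\<And>k. u k \<le> u (Suc k)"
  shows "(\<lambda>k. (u k, {u k..u (Suc k)})) ` {..<Suc n} tagged_division_of {u 0..u (Suc n)}"
proof (induction n)
  case 0
  then show ?case using tagged_division_of_self_real[of "u 0" "u 0" "u 1"] assms[of 0]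
    by (simp add: lessThan_Suc)
next
  case (Suc n)
  let ?n = "Suc n"
  have mono: "u 0 \<le> u ?n" using lift_Suc_mono_le[of u 0 ?n] assms by simp
  have "{(u ?n, {u ?n..u (Suc ?n)})} tagged_division_of {u ?n..u (Suc ?n)}"
    using tagged_division_of_self_real[of "u ?n" "u ?n" "u (Suc ?n)"] assms by simp
  then have "(\<lambda>k. (u k, {u k..u (Suc k)})) ` {..<?n} \<union> {(u ?n, {u ?n..u (Suc ?n)})}
      tagged_division_of {u 0..u ?n} \<union> {u ?n..u (Suc ?n)}"
    by (intro tagged_division_Un Suc) auto
  moreover have "{u 0..u ?n} \<union> {u ?n..u (Suc ?n)} = {u 0..u (Suc ?n)}" using mono assms[of ?n] by auto
  moreover have "(\<lambda>k. (u k, {u k..u (Suc k)})) ` {..<?n} \<union> {(u ?n, {u ?n..u (Suc ?n)})} =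
      (\<lambda>k. (u k, {u k..u (Suc k)})) ` {..<Suc ?n}" by (simp only: lessThan_Suc image_insert) blast
  ultimately show ?case by simp
qed

lemma grid_rs_sums:
  fixes f g G :: "real \<Rightarrow> real"
  assumes ab: "a < b" and f: "continuous_on {a..b} f" and g: "continuous_on {a..b} g"
    and G: "\<And>x. x \<in> {a..b} \<Longrightarrow> (G has_real_derivative g x) (at x within {a..b})"
  shows "(\<lambda>n. \<Sum>k<n. f (grid a b n k) * (G (grid a b n (Suc k)) - G (grid a b n k)))
    \<longlonglongrightarrow> integral {a..b} (\<lambda>r. f r * g r)"
proof (rule LIMSEQ_I)
  fix e :: real assume e: "e > 0"
  obtain \<eta> where \<eta>: "\<eta> > 0"
    "\<And>p. p tagged_division_of {a..b} \<Longrightarrow> (\<forall>(x, K)\<in>p. Sup K - Inf K < \<eta>) \<Longrightarrow>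
      \<bar>(\<Sum>(x, K)\<in>p. f x * (G (Sup K) - G (Inf K))) - integral {a..b} (\<lambda>r. f r * g r)\<bar> \<le> e / 2"
    by (rule rs_sum_close[OF less_imp_le[OF ab] f g G half_gt_zero[OF e]]) blast+
  obtain N where N: "real N > (b - a) / \<eta>" using reals_Archimedean2 by blast
  have N0: "N > 0" using N \<eta> ab by (cases N) (auto simp: field_simps)
  have "norm ((\<Sum>k<n. f (grid a b n k) * (G (grid a b n (Suc k)) - G (grid a b n k))) -
      integral {a..b} (\<lambda>r. f r * g r)) < e" if n: "n \<ge> N" for n
  proof -
    have n0: "n > 0" using n N0 by simp
    let ?u = "grid a b n"
    let ?p = "(\<lambda>k. (?u k, {?u k..?u (Suc k)})) ` {..<n}"
    have le: "?u k \<le> ?u (Suc k)" for k using ab by (intro grid_mono) auto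
    have p: "?p tagged_division_of {a..b}"
      using tagged_division_of_chain[of ?u "n - 1"] le n0 by simp
    have "real n > (b - a) / \<eta>" using n N by linarith
    then have "(b - a) / real n < \<eta>" using \<eta> n0 by (simp add: field_simps)
    then have mesh: "\<forall>(x, K)\<in>?p. Sup K - Inf K < \<eta>"
      using le by (auto simp: grid_diff)
    \<comment> \<open>Since \<open>a < b\<close>, the cells are pairwise distinct; a sum over the
      set of tagged cells would lose repetitions.\<close>
    have "inj_on (\<lambda>k. (?u k, {?u k..?u (Suc k)})) {..<n}"
      using grid_strict_mono[OF ab _ n0] by (intro inj_onI) (metis Pair_inject less_irrefl nat_neq_iff)
    then have "(\<Sum>(x, K)\<in>?p. f x * (G (Sup K) - G (Inf K))) =
        (\<Sum>k<n. f (?u k) * (G (?u (Suc k)) - G (?u k)))"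
      using le by (subst sum.reindex) auto
    then show ?thesis using \<eta>(2)[OF p mesh] e by simp
  qed
  then show "\<exists>no. \<forall>n\<ge>no. norm ((\<Sum>k<n. f (grid a b n k) * (G (grid a b n (Suc k)) - G (grid a b n k))) -
      integral {a..b} (\<lambda>r. f r * g r)) < e" by blast
qed

section \<open>Mollified paths and their area\<close>

definition prim :: "(real \<Rightarrow> real) \<Rightarrow> real \<Rightarrow> real" where
  "prim x t = (LBINT r=ereal 0..ereal t. x r)"

lemma interval_integral_has_vector_derivative:
  fixes f :: "real \<Rightarrow> 'a :: euclidean_space"
  assumes "continuous_on UNIV f"
  shows "((\<lambda>u. LBINT r=ereal 0..ereal u. f r) has_vector_derivative f t) (at t)"
proof -
  \<comment> \<open>A compact interval that contains \<open>0\<close> and has \<open>t\<close> in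
    its interior turns the one-interval statement into a two-sided derivative, whatever the sign of
    \<open>t\<close>.\<close>
  define a b where "a = min t 0 - 1" and "b = max t 0 + 1"
  have "((\<lambda>u. LBINT r=ereal 0..ereal u. f r) has_vector_derivative f t) (at t within {a..b})"
    by (rule interval_integral_FTC2) (auto simp: a_def b_def intro: continuous_on_subset[OF assms])
  then have "((\<lambda>u. LBINT r=ereal 0..ereal u. f r) has_vector_derivative f t) (at t within {a<..<b})"
    by (rule has_vector_derivative_within_subset) auto
  then show ?thesis
    by (subst (asm) has_vector_derivative_within_open) (auto simp: a_def b_def)
qed

lemma prim_has_derivative:
  assumes "continuous_on UNIV x"
  shows "(prim x has_real_derivative x t) (at t)"
  using interval_integral_has_vector_derivative[OF assms, of t]
  by (simp add: has_real_derivative_iff_has_vector_derivative prim_def[abs_def])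

lemma continuous_on_prim: "continuous_on UNIV x \<Longrightarrow> continuous_on S (prim x)"
  by (meson DERIV_isCont continuous_at_imp_continuous_on prim_has_derivative)

lemma same_derivative_diff:
  fixes F G :: "real \<Rightarrow> real"
  assumes "\<And>t. (F has_real_derivative f t) (at t)" "\<And>t. (G has_real_derivative f t) (at t)"
  shows "F t - F s = G t - G s"
proof -
  have "((\<lambda>t. F t - G t) has_real_derivative 0) (at t)" for t
    using DERIV_diff[OF assms, of t] by simp
  then have "F t - G t = F s - G s"
    using DERIV_isconst_all[of "\<lambda>t. F t - G t" t s] by blast
  then show ?thesis by simp
qed

lemma integral_eq_prim:
  assumes "continuous_on UNIV x" "s \<le> t"
  shows "integral {s..t} x = prim x t - prim x s"
  using assms
  by (intro integral_unique fundamental_theorem_of_calculus)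
    (auto simp: has_real_derivative_iff_has_vector_derivative[symmetric]
      intro: has_field_derivative_at_within prim_has_derivative)

text \<open>Mean of \<open>x\<close> over [\<open>t\<close>, \<open>t + \<delta>\<close>]. Up to an
  additive constant it is the mollified path, since both have derivative
  \<open>(x (t + \<delta>) - x t) / \<delta>\<close>.\<close>

definition avg :: "real \<Rightarrow> (real \<Rightarrow> real) \<Rightarrow> real \<Rightarrow> real" where
  "avg \<delta> x t = (prim x (t + \<delta>) - prim x t) / \<delta>"

lemma avg_has_derivative:
  assumes "continuous_on UNIV x"
  shows "(avg \<delta> x has_real_derivative (x (t + \<delta>) - x t) / \<delta>) (at t)"
proof -
  have "((\<lambda>t. prim x (t + \<delta>)) has_real_derivative x (t + \<delta>)) (at t)"
    using prim_has_derivative[OF assms, of "t + \<delta>"] by (simp add: DERIV_shift)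
  then show ?thesis
    unfolding avg_def[abs_def] by (intro DERIV_cdivide DERIV_diff prim_has_derivative assms)
qed

lemma continuous_on_avg: "continuous_on UNIV x \<Longrightarrow> continuous_on S (avg \<delta> x)"
  by (meson DERIV_isCont continuous_at_imp_continuous_on avg_has_derivative)

lemma continuous_on_shift:
  fixes x :: "real \<Rightarrow> 'a :: topological_space"
  shows "continuous_on UNIV x \<Longrightarrow> continuous_on S (\<lambda>t. x (t + \<delta>))"
  by (rule continuous_on_compose2[of UNIV x]) (auto intro!: continuous_intros)

lemma continuous_on_diff_quotient:
  "continuous_on UNIV (x :: real \<Rightarrow> real) \<Longrightarrow> continuous_on S (\<lambda>t. (x (t + \<delta>) - x t) / \<delta>)"
  unfolding divide_inverse
  by (intro continuous_intros continuous_on_shift) (auto intro: continuous_on_subset)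

text \<open>The mean value theorem in the averaging variable. An increment of the average is an
  increment of \<open>x\<close> itself over an equally long interval, so Hoelder bounds pass to the
  average with the same constant.\<close>

lemma avg_diff_mean_value:
  assumes x: "continuous_on UNIV x" and "\<delta> > 0"
  obtains r where "0 < r" "r < \<delta>" "avg \<delta> x t - avg \<delta> x s = x (t + r) - x (s + r)"
proof -
  have "((\<lambda>r. prim x (r + t) - prim x (r + s)) has_real_derivative x (r + t) - x (r + s)) (at r)" for r
    by (intro DERIV_diff DERIV_shift[THEN iffD1] prim_has_derivative x)
  then obtain r where "0 < r" "r < \<delta>"
    "(prim x (\<delta> + t) - prim x (\<delta> + s)) - (prim x (0 + t) - prim x (0 + s)) = (\<delta> - 0) * (x (r + t) - x (r + s))"
    using MVT2[of 0 \<delta> "\<lambda>r. prim x (r + t) - prim x (r + s)" "\<lambda>r. x (r + t) - x (r + s)"] assms by blast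
  moreover have "avg \<delta> x t - avg \<delta> x s =
      ((prim x (\<delta> + t) - prim x (\<delta> + s)) - (prim x (0 + t) - prim x (0 + s))) / \<delta>"
    by (simp add: avg_def diff_divide_distrib add.commute)
  ultimately show thesis
    using assms by (intro that[of r]) (simp_all add: add.commute)
qed

lemma avg_mean_value:
  assumes x: "continuous_on UNIV x" and "\<delta> > 0"
  obtains r where "0 < r" "r < \<delta>" "avg \<delta> x t = x (t + r)"
proof -
  have "((\<lambda>r. prim x (r + t)) has_real_derivative x (r + t)) (at r)" for r
    by (intro DERIV_shift[THEN iffD1] prim_has_derivative x)
  then obtain r where "0 < r" "r < \<delta>" "prim x (\<delta> + t) - prim x (0 + t) = (\<delta> - 0) * x (r + t)"
    using MVT2[of 0 \<delta> "\<lambda>r. prim x (r + t)" "\<lambda>r. x (r + t)"] assms by blast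
  then show thesis
    using assms by (intro that[of r]) (auto simp: avg_def field_simps add.commute)
qed

lemma smooth_path_nth:
  assumes "continuous_on UNIV \<omega>"
  shows "smooth_path \<delta> \<omega> t $ i = avg \<delta> (\<lambda>r. \<omega> r $ i) t - avg \<delta> (\<lambda>r. \<omega> r $ i) 0"
proof -
  have c: "continuous_on UNIV (\<lambda>r. (1 / \<delta>) *\<^sub>R (\<omega> (r + \<delta>) - \<omega> r))"
    by (intro continuous_intros continuous_on_shift assms)
  have "((\<lambda>t. smooth_path \<delta> \<omega> t $ i) has_real_derivative (\<omega> (t + \<delta>) $ i - \<omega> t $ i) / \<delta>) (at t)" for t
    using bounded_linear.has_vector_derivative[OF bounded_linear_vec_nth[of i]
        interval_integral_has_vector_derivative[OF c, of t]]
    by (simp add: has_real_derivative_iff_has_vector_derivative smooth_path_def)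
  from same_derivative_diff[OF this avg_has_derivative[OF continuous_on_component[OF assms]], where t=t and s=0]
  show ?thesis by (simp add: smooth_path_def)
qed

definition area :: "real \<Rightarrow> (real \<Rightarrow> real) \<Rightarrow> (real \<Rightarrow> real) \<Rightarrow> real \<Rightarrow> real \<Rightarrow> real" where
  "area \<delta> x y s t = integral {s..t} (\<lambda>r. (avg \<delta> x r - avg \<delta> x s) * ((y (r + \<delta>) - y r) / \<delta>))"

lemma smooth_area_nth:
  assumes \<omega>: "continuous_on UNIV \<omega>" and "s \<le> t"
  shows "smooth_area \<delta> \<omega> s t $ i $ j = area \<delta> (\<lambda>r. \<omega> r $ i) (\<lambda>r. \<omega> r $ j) s t"
proof -
  have c: "continuous_on UNIV (\<lambda>r. \<omega> r $ i)" for i by (intro continuous_on_component \<omega>)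
  have "rs_integral (\<lambda>r. avg \<delta> (\<lambda>r. \<omega> r $ i) r - avg \<delta> (\<lambda>r. \<omega> r $ i) s)
      (\<lambda>r. avg \<delta> (\<lambda>r. \<omega> r $ j) r - avg \<delta> (\<lambda>r. \<omega> r $ j) 0) s t =
    area \<delta> (\<lambda>r. \<omega> r $ i) (\<lambda>r. \<omega> r $ j) s t"
    unfolding area_def
  proof (rule rs_integral_eq)
    show "((\<lambda>r. avg \<delta> (\<lambda>r. \<omega> r $ j) r - avg \<delta> (\<lambda>r. \<omega> r $ j) 0) has_real_derivative
        (\<omega> (r + \<delta>) $ j - \<omega> r $ j) / \<delta>) (at r within {s..t})" for r
      using DERIV_diff[OF has_field_derivative_at_within[OF avg_has_derivative[OF c[of j], of \<delta> r],
          of "{s..t}"] DERIV_const] by simp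
  qed (use assms in \<open>auto intro!: continuous_intros continuous_on_avg continuous_on_diff_quotient c\<close>)
  then show ?thesis
    by (simp add: smooth_area_def smooth_path_nth[OF \<omega>])
qed

text \<open>Averages over finitely many shifts give both measurability in the path and access to
  convexity inequalities for moments.\<close>

lemma avg_limit:
  assumes x: "continuous_on UNIV x" and \<delta>: "\<delta> > 0"
  shows "(\<lambda>n. (\<Sum>a<n. x (t + grid 0 \<delta> n a)) / real n) \<longlonglongrightarrow> avg \<delta> x t"
proof -
  have "(\<lambda>n. \<Sum>k<n. x (grid t (t + \<delta>) n k) * (grid t (t + \<delta>) n (Suc k) - grid t (t + \<delta>) n k))
      \<longlonglongrightarrow> integral {t..t + \<delta>} (\<lambda>r. x r * 1)"
    using \<delta> by (intro grid_rs_sums) (auto intro: continuous_on_subset[OF x] derivative_eq_intros)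
  then have "(\<lambda>n. (\<Sum>k<n. x (grid t (t + \<delta>) n k) * (grid t (t + \<delta>) n (Suc k) - grid t (t + \<delta>) n k)) / \<delta>)
      \<longlonglongrightarrow> integral {t..t + \<delta>} (\<lambda>r. x r * 1) / \<delta>"
    by (rule tendsto_divide) (use \<delta> in auto)
  moreover have "integral {t..t + \<delta>} (\<lambda>r. x r * 1) / \<delta> = avg \<delta> x t"
    using integral_eq_prim[OF x, of t "t + \<delta>"] \<delta> by (simp add: avg_def)
  moreover have "(\<Sum>k<n. x (grid t (t + \<delta>) n k) * (grid t (t + \<delta>) n (Suc k) - grid t (t + \<delta>) n k)) / \<delta> =
      (\<Sum>a<n. x (t + grid 0 \<delta> n a)) / real n" for n
    unfolding sum_divide_distrib grid_diff using \<delta> by (intro sum.cong) (auto simp: grid_def)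
  ultimately show ?thesis by simp
qed

text \<open>The sums use increments of the averaged path instead of values of its derivative, so
  that they are bilinear in increments and the Gaussian estimates apply to them.\<close>

lemma area_limit:
  assumes x: "continuous_on UNIV x" and y: "continuous_on UNIV y" and "s < t"
  shows "(\<lambda>n. \<Sum>k<n. (avg \<delta> x (grid s t n k) - avg \<delta> x s) *
      (avg \<delta> y (grid s t n (Suc k)) - avg \<delta> y (grid s t n k))) \<longlonglongrightarrow> area \<delta> x y s t"
  unfolding area_def using assms
  by (intro grid_rs_sums)
    (auto intro!: continuous_intros continuous_on_avg continuous_on_diff_quotient
      intro: has_field_derivative_at_within avg_has_derivative)

lemma integral_diff_quotient:
  assumes "continuous_on UNIV y" "s \<le> t"
  shows "((\<lambda>r. (y (r + \<delta>) - y r) / \<delta>) has_integral (avg \<delta> y t - avg \<delta> y s)) {s..t}"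
  using assms
  by (intro fundamental_theorem_of_calculus)
    (auto simp: has_real_derivative_iff_has_vector_derivative[symmetric]
      intro: has_field_derivative_at_within avg_has_derivative)

section \<open>Chen's relation, integration by parts and shifts\<close>

lemma area_integrable:
  assumes x: "continuous_on UNIV x" and y: "continuous_on UNIV y"
  shows "(\<lambda>r. (avg \<delta> x r - c) * ((y (r + \<delta>) - y r) / \<delta>)) integrable_on {s..t}"
  by (intro integrable_continuous_real continuous_intros continuous_on_avg continuous_on_diff_quotient x y)

text \<open>The integrand is split into a constant and the increment since \<open>u\<close>. The
  forms of Chen's relation below are instances of this change of base point.\<close>

lemma integral_avg_base:
  assumes x: "continuous_on UNIV x" and y: "continuous_on UNIV y" and "u \<le> v"
  shows "integral {u..v} (\<lambda>r. (avg \<delta> x r - c) * ((y (r + \<delta>) - y r) / \<delta>)) =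
    (avg \<delta> x u - c) * (avg \<delta> y v - avg \<delta> y u) + area \<delta> x y u v"
proof -
  have "((\<lambda>r. (avg \<delta> x u - c) * ((y (r + \<delta>) - y r) / \<delta>) +
      (avg \<delta> x r - avg \<delta> x u) * ((y (r + \<delta>) - y r) / \<delta>)) has_integral
      (avg \<delta> x u - c) * (avg \<delta> y v - avg \<delta> y u) + area \<delta> x y u v) {u..v}"
    unfolding area_def
    by (intro has_integral_add has_integral_mult_right integral_diff_quotient integrable_integral
        area_integrable assms)
  moreover have "(\<lambda>r. (avg \<delta> x u - c) * ((y (r + \<delta>) - y r) / \<delta>) +
      (avg \<delta> x r - avg \<delta> x u) * ((y (r + \<delta>) - y r) / \<delta>)) =
      (\<lambda>r. (avg \<delta> x r - c) * ((y (r + \<delta>) - y r) / \<delta>))"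
    by (simp only: distrib_right[symmetric]) simp
  ultimately show ?thesis by (simp only: integral_unique)
qed

lemma area_chen_division:
  assumes x: "continuous_on UNIV x" and y: "continuous_on UNIV y" and D: "D division_of {s..t}"
  shows "area \<delta> x y s t =
    (\<Sum>K\<in>D. (avg \<delta> x (Inf K) - avg \<delta> x s) * (avg \<delta> y (Sup K) - avg \<delta> y (Inf K))) +
    (\<Sum>K\<in>D. area \<delta> x y (Inf K) (Sup K))"
proof -
  have "area \<delta> x y s t = (\<Sum>K\<in>D. integral K (\<lambda>r. (avg \<delta> x r - avg \<delta> x s) * ((y (r + \<delta>) - y r) / \<delta>)))"
    unfolding area_def by (intro integral_combine_division_topdown area_integrable x y D)
  also have "\<dots> = (\<Sum>K\<in>D. (avg \<delta> x (Inf K) - avg \<delta> x s) * (avg \<delta> y (Sup K) - avg \<delta> y (Inf K))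
      + area \<delta> x y (Inf K) (Sup K))"
  proof (rule sum.cong[OF refl])
    fix K assume K: "K \<in> D"
    then obtain u v where uv: "K = {u..v}" using division_ofD(4)[OF D] by force
    moreover have "u \<le> v" using division_ofD(3)[OF D K] uv by auto
    ultimately show "integral K (\<lambda>r. (avg \<delta> x r - avg \<delta> x s) * ((y (r + \<delta>) - y r) / \<delta>)) =
        (avg \<delta> x (Inf K) - avg \<delta> x s) * (avg \<delta> y (Sup K) - avg \<delta> y (Inf K)) + area \<delta> x y (Inf K) (Sup K)"
      using integral_avg_base[OF x y] by simp
  qed
  finally show ?thesis by (simp add: sum.distrib)
qed

lemma area_chen:
  assumes x: "continuous_on UNIV x" and y: "continuous_on UNIV y" and "s \<le> u" "u \<le> t"
  shows "area \<delta> x y s t = area \<delta> x y s u +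
    (avg \<delta> x u - avg \<delta> x s) * (avg \<delta> y t - avg \<delta> y u) + area \<delta> x y u t"
  using Henstock_Kurzweil_Integration.integral_combine[OF \<open>s \<le> u\<close> \<open>u \<le> t\<close>
      area_integrable[OF x y, of \<delta> "avg \<delta> x s" s t]] integral_avg_base[OF x y \<open>u \<le> t\<close>, of \<delta> "avg \<delta> x s"]
  by (simp add: area_def)

text \<open>The product rule for the increments from \<open>s\<close>. In the limit it becomes the
  relation between the two off-diagonal entries of the lift, and for \<open>x = y\<close> it
  computes the diagonal ones.\<close>

lemma area_by_parts:
  assumes x: "continuous_on UNIV x" and y: "continuous_on UNIV y" and "s \<le> t"
  shows "area \<delta> x y s t + area \<delta> y x s t = (avg \<delta> x t - avg \<delta> x s) * (avg \<delta> y t - avg \<delta> y s)"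
proof -
  let ?X = "\<lambda>r. avg \<delta> x r - avg \<delta> x s" and ?Y = "\<lambda>r. avg \<delta> y r - avg \<delta> y s"
  have "((\<lambda>r. ?X r * ?Y r) has_real_derivative
      (?X r * ((y (r + \<delta>) - y r) / \<delta>) + ?Y r * ((x (r + \<delta>) - x r) / \<delta>))) (at r within {s..t})" for r
    using x y by (auto intro!: derivative_eq_intros has_field_derivative_at_within[OF avg_has_derivative] simp: mult.commute)
  then have 1: "((\<lambda>r. ?X r * ((y (r + \<delta>) - y r) / \<delta>) + ?Y r * ((x (r + \<delta>) - x r) / \<delta>))
      has_integral (?X t * ?Y t - ?X s * ?Y s)) {s..t}"
    using \<open>s \<le> t\<close> by (intro fundamental_theorem_of_calculus)
      (auto simp: has_real_derivative_iff_has_vector_derivative[symmetric])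
  have 2: "((\<lambda>r. ?X r * ((y (r + \<delta>) - y r) / \<delta>) + ?Y r * ((x (r + \<delta>) - x r) / \<delta>))
      has_integral (area \<delta> x y s t + area \<delta> y x s t)) {s..t}"
    unfolding area_def by (intro has_integral_add integrable_integral area_integrable x y)
  show ?thesis using has_integral_unique[OF 1 2] by simp
qed

lemma area_self:
  "continuous_on UNIV x \<Longrightarrow> s \<le> t \<Longrightarrow> area \<delta> x x s t = (avg \<delta> x t - avg \<delta> x s)\<^sup>2 / 2"
  using area_by_parts[of x x s t \<delta>] by (simp add: power2_eq_square)

text \<open>In this form \<open>s\<close> and \<open>t\<close> enter only through values of
  continuous functions, which makes continuity in the pair visible.\<close>

lemma area_eq_prim:
  fixes \<delta> :: real
  assumes x: "continuous_on UNIV x" and y: "continuous_on UNIV y" and "s \<le> t"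
  defines "h \<equiv> \<lambda>r. avg \<delta> x r * ((y (r + \<delta>) - y r) / \<delta>)"
  shows "area \<delta> x y s t = prim h t - prim h s - avg \<delta> x s * (avg \<delta> y t - avg \<delta> y s)"
proof -
  have h: "continuous_on UNIV h" unfolding h_def
    by (intro continuous_intros continuous_on_avg continuous_on_diff_quotient x y)
  show ?thesis
    using integral_avg_base[OF x y \<open>s \<le> t\<close>, of \<delta> 0] integral_eq_prim[OF h \<open>s \<le> t\<close>] by (simp add: h_def)
qed

lemma prim_shift:
  assumes x: "continuous_on UNIV x"
  shows "prim (\<lambda>r. x (r + u) - c) t - prim (\<lambda>r. x (r + u) - c) s =
    prim x (t + u) - prim x (s + u) - c * (t - s)"
proof -
  have "((\<lambda>t. prim x (t + u) - c * t) has_real_derivative (x (t + u) - c * 1)) (at t)" for t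
    by (intro DERIV_diff DERIV_shift[THEN iffD1] prim_has_derivative x DERIV_cmult DERIV_ident)
  moreover have "(prim (\<lambda>r. x (r + u) - c) has_real_derivative (x (t + u) - c * 1)) (at t)" for t
    using prim_has_derivative[of "\<lambda>r. x (r + u) - c"]
    by (simp add: continuous_on_diff continuous_on_shift[OF x])
  ultimately show ?thesis
    using same_derivative_diff[of "\<lambda>t. prim x (t + u) - c * t" "\<lambda>t. x (t + u) - c * 1"
        "prim (\<lambda>r. x (r + u) - c)" t s]
    by (simp add: right_diff_distrib)
qed

lemma avg_shift:
  assumes x: "continuous_on UNIV x" and "\<delta> > 0"
  shows "avg \<delta> (\<lambda>r. x (r + u) - c) t = avg \<delta> x (t + u) - c"
  using prim_shift[OF x, of u c "t + \<delta>" t] \<open>\<delta> > 0\<close> by (simp add: avg_def field_simps)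

text \<open>Areas see only increments, so \<open>c\<close> and \<open>d\<close> drop out; they model
  the recentring at \<open>0\<close> in the Wiener shift.\<close>

lemma area_shift:
  assumes x: "continuous_on UNIV x" and y: "continuous_on UNIV y" and "s \<le> t" "\<delta> > 0"
  shows "area \<delta> (\<lambda>r. x (r + u) - c) (\<lambda>r. y (r + u) - d) s t = area \<delta> x y (s + u) (t + u)"
proof -
  let ?h = "\<lambda>r. (avg \<delta> x r - avg \<delta> x (s + u)) * ((y (r + \<delta>) - y r) / \<delta>)"
  have h: "continuous_on UNIV ?h"
    by (intro continuous_intros continuous_on_avg continuous_on_diff_quotient x y)
  have h': "continuous_on UNIV (\<lambda>r. ?h (r + u))" using continuous_on_shift[OF h] by simp
  have "area \<delta> (\<lambda>r. x (r + u) - c) (\<lambda>r. y (r + u) - d) s t = integral {s..t} (\<lambda>r. ?h (r + u))"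
    unfolding area_def avg_shift[OF x \<open>\<delta> > 0\<close>]
    by (intro arg_cong2[where f=integral] refl ext) (simp add: ac_simps)
  also have "\<dots> = prim ?h (t + u) - prim ?h (s + u)"
    using integral_eq_prim[OF h' \<open>s \<le> t\<close>] prim_shift[OF h, of u 0 t s] by simp
  also have "\<dots> = area \<delta> x y (s + u) (t + u)"
    using integral_eq_prim[OF h, of "s + u" "t + u"] \<open>s \<le> t\<close> by (simp add: area_def)
  finally show ?thesis .
qed

text \<open>The window exceeds \<open>{-T..T}\<close> by \<open>1\<close> because mollification at a
  scale \<open>\<delta> \<le> 1\<close> looks ahead by at most \<open>1\<close>. The path
  \<open>x\<close> enters the area through averages, whose dependence on \<open>\<delta>\<close> is
  controlled by boundedness, whereas \<open>y\<close> enters through difference quotients, where a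
  change of \<open>\<delta>\<close> costs a modulus of continuity. The exponent \<open>1 / 3\<close>
  is available because \<open>H > 1 / 3\<close>.\<close>

locale bounded_pair =
  fixes x y :: "real \<Rightarrow> real" and T M K :: real
  assumes x: "continuous_on UNIV x" and y: "continuous_on UNIV y" and T: "0 \<le> T" and K: "0 \<le> K"
    and Mx: "\<And>r. r \<in> {-T - 1..T + 1} \<Longrightarrow> \<bar>x r\<bar> \<le> M"
    and My: "\<And>r. r \<in> {-T - 1..T + 1} \<Longrightarrow> \<bar>y r\<bar> \<le> M"
    and Ky: "\<And>r r'. r \<in> {-T - 1..T + 1} \<Longrightarrow> r' \<in> {-T - 1..T + 1} \<Longrightarrow>
      \<bar>y r' - y r\<bar> \<le> K * \<bar>r' - r\<bar> powr (1 / 3)"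
begin

lemma M_nonneg: "0 \<le> M"
  using Mx[of 0] T by auto

lemma diff_quotient_bound:
  assumes "0 < \<eta>" "\<eta> \<le> \<delta>" "\<delta> \<le> 1" "r \<in> {-T..T}"
  shows "\<bar>(x (r + \<delta>) - x r) / \<delta>\<bar> \<le> 2 * M / \<eta>" "\<bar>(y (r + \<delta>) - y r) / \<delta>\<bar> \<le> 2 * M / \<eta>"
proof -
  have "\<bar>x (r + \<delta>) - x r\<bar> \<le> 2 * M" "\<bar>y (r + \<delta>) - y r\<bar> \<le> 2 * M"
    using Mx[of "r + \<delta>"] Mx[of r] My[of "r + \<delta>"] My[of r] assms by auto
  then show "\<bar>(x (r + \<delta>) - x r) / \<delta>\<bar> \<le> 2 * M / \<eta>" "\<bar>(y (r + \<delta>) - y r) / \<delta>\<bar> \<le> 2 * M / \<eta>"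
    using assms M_nonneg by (simp_all add: abs_divide frac_le)
qed

lemma avg_lipschitz:
  assumes "0 < \<eta>" "\<eta> \<le> \<delta>" "\<delta> \<le> 1" "-T \<le> s" "s \<le> t" "t \<le> T"
  shows "\<bar>avg \<delta> x t - avg \<delta> x s\<bar> \<le> 2 * M / \<eta> * (t - s)"
    "\<bar>avg \<delta> y t - avg \<delta> y s\<bar> \<le> 2 * M / \<eta> * (t - s)"
proof -
  have "norm (avg \<delta> x t - avg \<delta> x s) \<le> 2 * M / \<eta> * measure lborel (cbox s t)"
    using assms M_nonneg integral_diff_quotient[OF x \<open>s \<le> t\<close>, of \<delta>] diff_quotient_bound[of \<eta> \<delta>]
    by (intro has_integral_bound[where f="\<lambda>r. (x (r + \<delta>) - x r) / \<delta>"]) auto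
  moreover have "norm (avg \<delta> y t - avg \<delta> y s) \<le> 2 * M / \<eta> * measure lborel (cbox s t)"
    using assms M_nonneg integral_diff_quotient[OF y \<open>s \<le> t\<close>, of \<delta>] diff_quotient_bound[of \<eta> \<delta>]
    by (intro has_integral_bound[where f="\<lambda>r. (y (r + \<delta>) - y r) / \<delta>"]) auto
  ultimately show "\<bar>avg \<delta> x t - avg \<delta> x s\<bar> \<le> 2 * M / \<eta> * (t - s)"
    "\<bar>avg \<delta> y t - avg \<delta> y s\<bar> \<le> 2 * M / \<eta> * (t - s)" using \<open>s \<le> t\<close> by simp_all
qed

lemma area_quadratic_bound:
  assumes "0 < \<eta>" "\<eta> \<le> \<delta>" "\<delta> \<le> 1" "-T \<le> s" "s \<le> t" "t \<le> T"
  shows "\<bar>area \<delta> x y s t\<bar> \<le> (2 * M / \<eta>)\<^sup>2 * (t - s)\<^sup>2"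
proof -
  let ?L = "2 * M / \<eta>"
  have L: "0 \<le> ?L" using assms M_nonneg by simp
  have "norm (area \<delta> x y s t) \<le> (?L * (t - s) * ?L) * measure lborel (cbox s t)"
  proof (rule has_integral_bound)
    show "((\<lambda>r. (avg \<delta> x r - avg \<delta> x s) * ((y (r + \<delta>) - y r) / \<delta>)) has_integral area \<delta> x y s t) (cbox s t)"
      unfolding area_def box_real by (intro integrable_integral area_integrable x y)
    fix r assume r: "r \<in> cbox s t"
    have "\<bar>avg \<delta> x r - avg \<delta> x s\<bar> \<le> ?L * (r - s)" using r assms by (intro avg_lipschitz) auto
    also have "\<dots> \<le> ?L * (t - s)" using L r by (intro mult_left_mono) auto
    finally have "\<bar>avg \<delta> x r - avg \<delta> x s\<bar> \<le> ?L * (t - s)" .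
    moreover have "\<bar>(y (r + \<delta>) - y r) / \<delta>\<bar> \<le> ?L" using r assms by (intro diff_quotient_bound) auto
    ultimately show "norm ((avg \<delta> x r - avg \<delta> x s) * ((y (r + \<delta>) - y r) / \<delta>)) \<le> ?L * (t - s) * ?L"
      unfolding real_norm_def abs_mult using L M_nonneg assms by (intro mult_mono mult_nonneg_nonneg) auto
  qed (use L M_nonneg assms in auto)
  then show ?thesis using assms by (simp add: power2_eq_square ac_simps)
qed

text \<open>Chen's relation splits the change into a product of two Lipschitz increments and a short
  area; each is at most \<open>2 * T * (2 * M / \<eta>)\<^sup>2 * (t - u)\<close>.\<close>

lemma area_change_right:
  assumes "0 < \<eta>" "\<eta> \<le> \<delta>" "\<delta> \<le> 1" "-T \<le> s" "s \<le> u" "u \<le> t" "t \<le> T"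
  shows "\<bar>area \<delta> x y s t - area \<delta> x y s u\<bar> \<le> 4 * T * (2 * M / \<eta>)\<^sup>2 * (t - u)"
proof -
  let ?L = "2 * M / \<eta>"
  have L: "0 \<le> ?L" using assms M_nonneg by simp
  have "\<bar>avg \<delta> x u - avg \<delta> x s\<bar> * \<bar>avg \<delta> y t - avg \<delta> y u\<bar> \<le> (?L * (u - s)) * (?L * (t - u))"
    using assms L M_nonneg by (intro mult_mono avg_lipschitz) auto
  also have "\<dots> \<le> (?L * (2 * T)) * (?L * (t - u))"
    using assms L M_nonneg by (intro mult_right_mono mult_left_mono) auto
  finally have 1: "\<bar>(avg \<delta> x u - avg \<delta> x s) * (avg \<delta> y t - avg \<delta> y u)\<bar> \<le> 2 * T * ?L\<^sup>2 * (t - u)"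
    by (simp add: abs_mult power2_eq_square ac_simps)
  have "\<bar>area \<delta> x y u t\<bar> \<le> ?L\<^sup>2 * (t - u)\<^sup>2" using assms by (intro area_quadratic_bound) auto
  also have "\<dots> \<le> ?L\<^sup>2 * (2 * T * (t - u))"
    unfolding power2_eq_square[of "t - u"] using assms L by (intro mult_left_mono mult_right_mono) auto
  finally have 2: "\<bar>area \<delta> x y u t\<bar> \<le> 2 * T * ?L\<^sup>2 * (t - u)" by (simp add: algebra_simps)
  show ?thesis using area_chen[OF x y \<open>s \<le> u\<close> \<open>u \<le> t\<close>, of \<delta>] 1 2 by linarith
qed

lemma area_change_left:
  assumes "0 < \<eta>" "\<eta> \<le> \<delta>" "\<delta> \<le> 1" "-T \<le> s" "s \<le> u" "u \<le> t" "t \<le> T"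
  shows "\<bar>area \<delta> x y s t - area \<delta> x y u t\<bar> \<le> 4 * T * (2 * M / \<eta>)\<^sup>2 * (u - s)"
proof -
  let ?L = "2 * M / \<eta>"
  have L: "0 \<le> ?L" using assms M_nonneg by simp
  have "\<bar>avg \<delta> x u - avg \<delta> x s\<bar> * \<bar>avg \<delta> y t - avg \<delta> y u\<bar> \<le> (?L * (u - s)) * (?L * (t - u))"
    using assms L M_nonneg by (intro mult_mono avg_lipschitz) auto
  also have "\<dots> \<le> (?L * (u - s)) * (?L * (2 * T))"
    using assms L M_nonneg by (intro mult_right_mono mult_left_mono) auto
  finally have 1: "\<bar>(avg \<delta> x u - avg \<delta> x s) * (avg \<delta> y t - avg \<delta> y u)\<bar> \<le> 2 * T * ?L\<^sup>2 * (u - s)"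
    by (simp add: abs_mult power2_eq_square ac_simps)
  have "\<bar>area \<delta> x y s u\<bar> \<le> ?L\<^sup>2 * (u - s)\<^sup>2" using assms by (intro area_quadratic_bound) auto
  also have "\<dots> \<le> ?L\<^sup>2 * (2 * T * (u - s))"
    unfolding power2_eq_square[of "u - s"] using assms L by (intro mult_left_mono mult_right_mono) auto
  finally have 2: "\<bar>area \<delta> x y s u\<bar> \<le> 2 * T * ?L\<^sup>2 * (u - s)" by (simp add: algebra_simps)
  show ?thesis using area_chen[OF x y \<open>s \<le> u\<close> \<open>u \<le> t\<close>, of \<delta>] 1 2 by linarith
qed

lemma inverse_diff_bound:
  fixes \<delta> \<delta>' :: real
  assumes "0 < \<eta>" "\<eta> \<le> \<delta>" "\<eta> \<le> \<delta>'"
  shows "\<bar>1 / \<delta> - 1 / \<delta>'\<bar> \<le> \<bar>\<delta> - \<delta>'\<bar> / (\<eta> * \<delta>')"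
proof -
  have "1 / \<delta> - 1 / \<delta>' = (\<delta>' - \<delta>) / (\<delta> * \<delta>')" using assms by (simp add: field_simps)
  then have "\<bar>1 / \<delta> - 1 / \<delta>'\<bar> = \<bar>\<delta> - \<delta>'\<bar> / (\<delta> * \<delta>')" using assms by (simp add: abs_mult)
  also have "\<dots> \<le> \<bar>\<delta> - \<delta>'\<bar> / (\<eta> * \<delta>')" using assms by (intro divide_left_mono mult_right_mono mult_pos_pos) auto
  finally show ?thesis .
qed

lemma avg_change_mesh:
  assumes \<eta>: "0 < \<eta>" "\<eta> \<le> \<delta>" "\<delta> \<le> 1" "\<eta> \<le> \<delta>'" "\<delta>' \<le> 1" "r \<in> {-T..T}"
  shows "\<bar>avg \<delta> x r - avg \<delta>' x r\<bar> \<le> 2 * M / \<eta> * \<bar>\<delta> - \<delta>'\<bar>"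
proof -
  have lip: "\<bar>prim x v - prim x u\<bar> \<le> M * \<bar>v - u\<bar>" if "u \<in> {-T..T+1}" "v \<in> {-T..T+1}" for u v
  proof -
    have *: "\<bar>prim x v - prim x u\<bar> \<le> M * (v - u)" if "u \<in> {-T..T+1}" "v \<in> {-T..T+1}" "u \<le> v" for u v
    proof -
      have "norm (prim x v - prim x u) \<le> M * measure lborel (cbox u v)"
      proof (rule has_integral_bound)
        have "x integrable_on {u..v}" by (intro integrable_continuous_real continuous_on_subset[OF x]) auto
        then show "(x has_integral (prim x v - prim x u)) (cbox u v)"
          using integral_eq_prim[OF x \<open>u \<le> v\<close>] integrable_integral by fastforce
      qed (use that M_nonneg Mx in auto)
      then show ?thesis using that by simp
    qed
    show ?thesis
      using *[of u v] *[of v u] that by (cases "u \<le> v") (auto simp: abs_minus_commute)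
  qed
  \<comment> \<open>The first term changes the endpoint of the averaging interval, the second the
    normalisation; each costs \<open>M * |\<delta> - \<delta>'| / \<eta>\<close>.\<close>
  have "avg \<delta> x r - avg \<delta>' x r =
      (prim x (r + \<delta>) - prim x (r + \<delta>')) / \<delta> + (prim x (r + \<delta>') - prim x r) * (1 / \<delta> - 1 / \<delta>')"
    using assms by (simp add: avg_def field_simps)
  moreover have "\<bar>(prim x (r + \<delta>) - prim x (r + \<delta>')) / \<delta>\<bar> \<le> M * \<bar>\<delta> - \<delta>'\<bar> / \<eta>"
    unfolding abs_divide using lip[of "r + \<delta>'" "r + \<delta>"] assms M_nonneg by (intro frac_le) auto
  moreover have "\<bar>(prim x (r + \<delta>') - prim x r) * (1 / \<delta> - 1 / \<delta>')\<bar> \<le> (M * \<delta>') * (\<bar>\<delta> - \<delta>'\<bar> / (\<eta> * \<delta>'))"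
    unfolding abs_mult using lip[of r "r + \<delta>'"] assms M_nonneg
    by (intro mult_mono inverse_diff_bound) auto
  moreover have "(M * \<delta>') * (\<bar>\<delta> - \<delta>'\<bar> / (\<eta> * \<delta>')) = M * \<bar>\<delta> - \<delta>'\<bar> / \<eta>" using assms by simp
  moreover have "2 * M / \<eta> * \<bar>\<delta> - \<delta>'\<bar> = M * \<bar>\<delta> - \<delta>'\<bar> / \<eta> + M * \<bar>\<delta> - \<delta>'\<bar> / \<eta>" by (simp add: field_simps)
  ultimately show ?thesis by linarith
qed

lemma diff_quotient_change_mesh:
  assumes \<eta>: "0 < \<eta>" "\<eta> \<le> \<delta>" "\<delta> \<le> 1" "\<eta> \<le> \<delta>'" "\<delta>' \<le> 1" "r \<in> {-T..T}"
  shows "\<bar>(y (r + \<delta>) - y r) / \<delta> - (y (r + \<delta>') - y r) / \<delta>'\<bar> \<le> (K + 2 * M) / \<eta>\<^sup>2 * \<bar>\<delta> - \<delta>'\<bar> powr (1 / 3)"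
proof -
  let ?w = "\<bar>\<delta> - \<delta>'\<bar> powr (1 / 3)"
  have d1: "\<bar>\<delta> - \<delta>'\<bar> \<le> 1" using assms by auto
  have dw: "\<bar>\<delta> - \<delta>'\<bar> \<le> ?w"
    using d1 powr_mono'[of "1/3" 1 "\<bar>\<delta> - \<delta>'\<bar>"] by simp
  have "\<bar>(y (r + \<delta>) - y (r + \<delta>')) / \<delta>\<bar> \<le> K * ?w / \<eta>"
    unfolding abs_divide using Ky[of "r + \<delta>'" "r + \<delta>"] assms K by (intro frac_le) auto
  also have "\<dots> \<le> K * ?w / \<eta>\<^sup>2"
    using assms K by (intro divide_left_mono) (auto simp: power2_eq_square mult_left_le)
  finally have 1: "\<bar>(y (r + \<delta>) - y (r + \<delta>')) / \<delta>\<bar> \<le> K * ?w / \<eta>\<^sup>2" .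
  have "\<bar>y (r + \<delta>') - y r\<bar> \<le> 2 * M" using My[of "r + \<delta>'"] My[of r] assms by auto
  moreover have "\<bar>1 / \<delta> - 1 / \<delta>'\<bar> \<le> ?w / \<eta>\<^sup>2"
  proof -
    have "\<bar>1 / \<delta> - 1 / \<delta>'\<bar> \<le> \<bar>\<delta> - \<delta>'\<bar> / (\<eta> * \<delta>')" using assms by (intro inverse_diff_bound) auto
    also have "\<dots> \<le> ?w / \<eta>\<^sup>2" using assms dw by (intro frac_le) (auto simp: power2_eq_square)
    finally show ?thesis .
  qed
  ultimately have "\<bar>(y (r + \<delta>') - y r) * (1 / \<delta> - 1 / \<delta>')\<bar> \<le> 2 * M * (?w / \<eta>\<^sup>2)"
    unfolding abs_mult using M_nonneg by (intro mult_mono) auto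
  moreover have "(y (r + \<delta>) - y r) / \<delta> - (y (r + \<delta>') - y r) / \<delta>' =
      (y (r + \<delta>) - y (r + \<delta>')) / \<delta> + (y (r + \<delta>') - y r) * (1 / \<delta> - 1 / \<delta>')"
    using assms by (simp add: field_simps)
  moreover have "(K + 2 * M) / \<eta>\<^sup>2 * ?w = K * ?w / \<eta>\<^sup>2 + 2 * M * (?w / \<eta>\<^sup>2)"
    by (simp add: add_divide_distrib distrib_right)
  ultimately show ?thesis using 1 by linarith
qed

lemma area_change_mesh:
  assumes \<eta>: "0 < \<eta>" "\<eta> \<le> \<delta>" "\<delta> \<le> 1" "\<eta> \<le> \<delta>'" "\<delta>' \<le> 1" and st: "-T \<le> s" "s \<le> t" "t \<le> T"
  shows "\<bar>area \<delta> x y s t - area \<delta>' x y s t\<bar> \<le>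
    2 * T * (12 * M\<^sup>2 + 2 * M * K) / \<eta>\<^sup>2 * \<bar>\<delta> - \<delta>'\<bar> powr (1 / 3)"
proof -
  let ?w = "\<bar>\<delta> - \<delta>'\<bar> powr (1 / 3)"
  let ?B = "(12 * M\<^sup>2 + 2 * M * K) / \<eta>\<^sup>2 * ?w"
  have d1: "\<bar>\<delta> - \<delta>'\<bar> \<le> 1" using assms by auto
  have dw: "\<bar>\<delta> - \<delta>'\<bar> \<le> ?w"
    using d1 powr_mono'[of "1/3" 1 "\<bar>\<delta> - \<delta>'\<bar>"] by simp
  have "norm (area \<delta> x y s t - area \<delta>' x y s t) \<le> ?B * measure lborel (cbox s t)"
  proof (rule has_integral_bound)
    show "((\<lambda>r. (avg \<delta> x r - avg \<delta> x s) * ((y (r + \<delta>) - y r) / \<delta>) -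
        (avg \<delta>' x r - avg \<delta>' x s) * ((y (r + \<delta>') - y r) / \<delta>')) has_integral
        (area \<delta> x y s t - area \<delta>' x y s t)) (cbox s t)"
      unfolding area_def box_real by (intro has_integral_diff integrable_integral area_integrable x y)
    fix r assume r: "r \<in> cbox s t"
    define a a' b b' where ab: "a = avg \<delta> x r - avg \<delta> x s" "a' = avg \<delta>' x r - avg \<delta>' x s"
      "b = (y (r + \<delta>) - y r) / \<delta>" "b' = (y (r + \<delta>') - y r) / \<delta>'"
    have rs: "r \<in> {-T..T}" "s \<in> {-T..T}" using r st by auto
    have "\<bar>a - a'\<bar> \<le> 4 * M / \<eta> * \<bar>\<delta> - \<delta>'\<bar>"
      using avg_change_mesh[OF \<eta> rs(1)] avg_change_mesh[OF \<eta> rs(2)] unfolding ab by simp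
    also have "\<dots> \<le> 4 * M / \<eta> * ?w" using dw M_nonneg \<eta> by (intro mult_left_mono) auto
    finally have 1: "\<bar>a - a'\<bar> \<le> 4 * M / \<eta> * ?w" .
    have 2: "\<bar>b\<bar> \<le> 2 * M / \<eta>" using diff_quotient_bound(2)[of \<eta> \<delta> r] \<eta> rs by (simp add: ab)
    have 3: "\<bar>b - b'\<bar> \<le> (K + 2 * M) / \<eta>\<^sup>2 * ?w" using diff_quotient_change_mesh[OF \<eta> rs(1)] by (simp add: ab)
    obtain r1 where r1: "0 < r1" "r1 < \<delta>'" "a' = x (r + r1) - x (s + r1)"
      using avg_diff_mean_value[OF x, of \<delta>' r s] \<eta> unfolding ab by (metis less_le_trans)
    have 4: "\<bar>a'\<bar> \<le> 2 * M"
      using r1 Mx[of "r + r1"] Mx[of "s + r1"] rs \<eta> by auto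
    have "\<bar>a * b - a' * b'\<bar> \<le> \<bar>a - a'\<bar> * \<bar>b\<bar> + \<bar>a'\<bar> * \<bar>b - b'\<bar>"
      unfolding abs_mult[symmetric] by (rule order_trans[OF _ abs_triangle_ineq]) (simp add: algebra_simps)
    \<comment> \<open>The first product contributes \<open>8 * M\<^sup>2\<close> and the second
      \<open>4 * M\<^sup>2 + 2 * M * K\<close>, all over \<open>\<eta>\<^sup>2\<close>.\<close>
    also have "\<dots> \<le> (4 * M / \<eta> * ?w) * (2 * M / \<eta>) + (2 * M) * ((K + 2 * M) / \<eta>\<^sup>2 * ?w)"
      using M_nonneg K \<eta> by (intro add_mono mult_mono 1 2 3 4) auto
    also have "\<dots> = ?B" using \<eta> by (simp add: field_simps power2_eq_square)
    finally show "norm ((avg \<delta> x r - avg \<delta> x s) * ((y (r + \<delta>) - y r) / \<delta>) -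
        (avg \<delta>' x r - avg \<delta>' x s) * ((y (r + \<delta>') - y r) / \<delta>')) \<le> ?B" by (simp add: ab)
  qed (use M_nonneg K in auto)
  also have "\<dots> \<le> ?B * (2 * T)" using M_nonneg K st by (intro mult_left_mono) auto
  finally show ?thesis by (simp add: algebra_simps)
qed

text \<open>One constant serves all scales, and a small scale costs only the factor
  \<open>1 / \<eta>\<^sup>2\<close>; this polynomial loss is what finite grids of polynomial size
  can afford.\<close>

lemma area_crude_bounds:
  obtains C where "0 \<le> C"
    "\<And>\<eta> \<delta> s t. 0 < \<eta> \<Longrightarrow> \<eta> \<le> \<delta> \<Longrightarrow> \<delta> \<le> 1 \<Longrightarrow> -T \<le> s \<Longrightarrow> s \<le> t \<Longrightarrow> t \<le> T \<Longrightarrow>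
      \<bar>area \<delta> x y s t\<bar> \<le> C / \<eta>\<^sup>2 * (t - s)\<^sup>2"
    "\<And>\<eta> \<delta> \<delta>' s s' t t'. 0 < \<eta> \<Longrightarrow> \<eta> \<le> \<delta> \<Longrightarrow> \<delta> \<le> 1 \<Longrightarrow> \<eta> \<le> \<delta>' \<Longrightarrow> \<delta>' \<le> 1 \<Longrightarrow>
      -T \<le> s' \<Longrightarrow> s' \<le> s \<Longrightarrow> s \<le> t \<Longrightarrow> s' \<le> t' \<Longrightarrow> t' \<le> t \<Longrightarrow> t \<le> T \<Longrightarrow>
      \<bar>area \<delta> x y s t - area \<delta>' x y s' t'\<bar> \<le> C / \<eta>\<^sup>2 * (\<bar>\<delta> - \<delta>'\<bar> powr (1 / 3) + (s - s') + (t - t'))"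
proof (rule that)
  let ?C = "4 * M\<^sup>2 + 16 * T * M\<^sup>2 + 2 * T * (12 * M\<^sup>2 + 2 * M * K)"
  show C0: "0 \<le> ?C" using T K M_nonneg by (intro add_nonneg_nonneg mult_nonneg_nonneg) auto
  have pos: "0 \<le> 4 * M\<^sup>2" "0 \<le> 16 * T * M\<^sup>2" "0 \<le> 2 * T * (12 * M\<^sup>2 + 2 * M * K)"
    using T K M_nonneg by auto
  {
    fix \<eta> \<delta> s t :: real
    assume \<eta>: "0 < \<eta>" and a: "\<eta> \<le> \<delta>" "\<delta> \<le> 1" "-T \<le> s" "s \<le> t" "t \<le> T"
    have "\<bar>area \<delta> x y s t\<bar> \<le> (2 * M / \<eta>)\<^sup>2 * (t - s)\<^sup>2" using \<eta> a by (intro area_quadratic_bound) auto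
    also have "\<dots> \<le> ?C / \<eta>\<^sup>2 * (t - s)\<^sup>2"
      unfolding power_divide using pos \<eta> by (intro mult_right_mono divide_right_mono) (auto simp: power_mult_distrib)
    finally show "\<bar>area \<delta> x y s t\<bar> \<le> ?C / \<eta>\<^sup>2 * (t - s)\<^sup>2" .
  }
  fix \<eta> \<delta> \<delta>' s s' t t' :: real
  assume \<eta>: "0 < \<eta>" and a: "\<eta> \<le> \<delta>" "\<delta> \<le> 1" "\<eta> \<le> \<delta>'" "\<delta>' \<le> 1"
    "-T \<le> s'" "s' \<le> s" "s \<le> t" "s' \<le> t'" "t' \<le> t" "t \<le> T"
  let ?w = "\<bar>\<delta> - \<delta>'\<bar> powr (1 / 3)"
  have "\<bar>area \<delta> x y s' t - area \<delta> x y s t\<bar> \<le> 4 * T * (2 * M / \<eta>)\<^sup>2 * (s - s')"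
    using a \<eta> by (intro area_change_left) auto
  also have "\<dots> = 16 * T * M\<^sup>2 / \<eta>\<^sup>2 * (s - s')" by (simp add: power_divide power_mult_distrib)
  also have "\<dots> \<le> ?C / \<eta>\<^sup>2 * (s - s')" using pos a by (intro mult_right_mono divide_right_mono) auto
  finally have 1: "\<bar>area \<delta> x y s' t - area \<delta> x y s t\<bar> \<le> ?C / \<eta>\<^sup>2 * (s - s')" .
  have "\<bar>area \<delta> x y s' t - area \<delta> x y s' t'\<bar> \<le> 4 * T * (2 * M / \<eta>)\<^sup>2 * (t - t')"
    using a \<eta> by (intro area_change_right) auto
  also have "\<dots> = 16 * T * M\<^sup>2 / \<eta>\<^sup>2 * (t - t')" by (simp add: power_divide power_mult_distrib)
  also have "\<dots> \<le> ?C / \<eta>\<^sup>2 * (t - t')" using pos a by (intro mult_right_mono divide_right_mono) auto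
  finally have 2: "\<bar>area \<delta> x y s' t - area \<delta> x y s' t'\<bar> \<le> ?C / \<eta>\<^sup>2 * (t - t')" .
  have "\<bar>area \<delta> x y s' t' - area \<delta>' x y s' t'\<bar> \<le> 2 * T * (12 * M\<^sup>2 + 2 * M * K) / \<eta>\<^sup>2 * ?w"
    using a \<eta> by (intro area_change_mesh) auto
  also have "\<dots> \<le> ?C / \<eta>\<^sup>2 * ?w" using pos a by (intro mult_right_mono divide_right_mono) auto
  finally have 3: "\<bar>area \<delta> x y s' t' - area \<delta>' x y s' t'\<bar> \<le> ?C / \<eta>\<^sup>2 * ?w" .
  have "?C / \<eta>\<^sup>2 * (?w + (s - s') + (t - t')) = ?C / \<eta>\<^sup>2 * ?w + ?C / \<eta>\<^sup>2 * (s - s') + ?C / \<eta>\<^sup>2 * (t - t')"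
    by (simp only: distrib_left)
  then show "\<bar>area \<delta> x y s t - area \<delta>' x y s' t'\<bar> \<le> ?C / \<eta>\<^sup>2 * (?w + (s - s') + (t - t'))"
    using 1 2 3 by linarith
qed

end

text \<open>Two regimes. For increments no longer than \<open>\<delta>\<close>, both paths are
  Hoelder of exponent \<open>\<gamma>\<close>, and \<open>|t - s| powr (\<gamma> - \<beta>)\<close>
  is at most \<open>\<delta> powr (\<gamma> - \<beta>)\<close>. For longer ones, averaging moves
  each endpoint value by at most \<open>K * \<delta> powr \<gamma>\<close>, of which a factor
  \<open>\<delta> powr \<beta>\<close> is traded for \<open>|t - s| powr \<beta>\<close>.\<close>

lemma avg_rate:
  assumes x: "continuous_on UNIV x" and K: "0 \<le> K"
    and hold: "\<And>r r'. r \<in> {-T - 1..T + 1} \<Longrightarrow> r' \<in> {-T - 1..T + 1} \<Longrightarrow>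
      \<bar>x r' - x r\<bar> \<le> K * \<bar>r' - r\<bar> powr \<gamma>"
    and \<beta>: "0 < \<beta>" "\<beta> \<le> \<gamma>" and \<delta>: "0 < \<delta>" "\<delta> \<le> 1" and st: "s \<in> {-T..T}" "t \<in> {-T..T}"
  shows "\<bar>(x t - x s) - (avg \<delta> x t - avg \<delta> x s)\<bar> \<le> 2 * K * \<delta> powr (\<gamma> - \<beta>) * \<bar>t - s\<bar> powr \<beta>"
proof (cases "\<bar>t - s\<bar> \<le> \<delta>")
  case True
  obtain r where r: "0 < r" "r < \<delta>" "avg \<delta> x t - avg \<delta> x s = x (t + r) - x (s + r)"
    using avg_diff_mean_value[OF x \<delta>(1)] by metis
  have "\<bar>x (t + r) - x (s + r)\<bar> \<le> K * \<bar>t - s\<bar> powr \<gamma>"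
    using hold[of "s + r" "t + r"] r st \<delta> by auto
  moreover have "\<bar>x t - x s\<bar> \<le> K * \<bar>t - s\<bar> powr \<gamma>" using hold[of s t] st by auto
  moreover have "\<bar>t - s\<bar> powr \<gamma> = \<bar>t - s\<bar> powr (\<gamma> - \<beta>) * \<bar>t - s\<bar> powr \<beta>" by (simp add: powr_add[symmetric])
  then have "K * \<bar>t - s\<bar> powr \<gamma> = K * (\<bar>t - s\<bar> powr (\<gamma> - \<beta>) * \<bar>t - s\<bar> powr \<beta>)" by simp
  moreover have "K * (\<bar>t - s\<bar> powr (\<gamma> - \<beta>) * \<bar>t - s\<bar> powr \<beta>) \<le> K * (\<delta> powr (\<gamma> - \<beta>) * \<bar>t - s\<bar> powr \<beta>)"
    using True \<beta> K by (intro mult_left_mono mult_right_mono powr_mono2) auto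
  ultimately have "\<bar>(x t - x s) - (x (t + r) - x (s + r))\<bar> \<le> 2 * (K * (\<delta> powr (\<gamma> - \<beta>) * \<bar>t - s\<bar> powr \<beta>))"
    using abs_triangle_ineq4[of "x t - x s" "x (t + r) - x (s + r)"] by linarith
  then show ?thesis unfolding r(3) by (simp add: ac_simps)
next
  case False
  have *: "\<bar>avg \<delta> x u - x u\<bar> \<le> K * \<delta> powr \<gamma>" if u: "u \<in> {-T..T}" for u
  proof -
    obtain r where r: "0 < r" "r < \<delta>" "avg \<delta> x u = x (u + r)" using avg_mean_value[OF x \<delta>(1)] by metis
    have "\<bar>x (u + r) - x u\<bar> \<le> K * \<bar>r\<bar> powr \<gamma>" using hold[of u "u + r"] r u \<delta> by auto
    also have "\<dots> \<le> K * \<delta> powr \<gamma>" using r K \<beta> by (intro mult_left_mono powr_mono2) auto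
    finally show ?thesis using r by simp
  qed
  have "\<delta> powr \<gamma> = \<delta> powr (\<gamma> - \<beta>) * \<delta> powr \<beta>" by (simp add: powr_add[symmetric])
  moreover have "K * (\<delta> powr (\<gamma> - \<beta>) * \<delta> powr \<beta>) \<le> K * (\<delta> powr (\<gamma> - \<beta>) * \<bar>t - s\<bar> powr \<beta>)"
    using False \<beta> K \<delta> by (intro mult_left_mono powr_mono2) auto
  ultimately show ?thesis using *[OF st(1)] *[OF st(2)] by simp
qed

text \<open>With \<open>h\<close> the \<open>(k + 1)\<close>-st power of \<open>1/2\<close>, rounding to multiples of \<open>h ^ 24\<close> costs
  \<open>(h ^ 24) powr (1/3) = h ^ 8\<close>, which absorbs the factor \<open>1 / h\<^sup>2\<close> of the crude bounds and still
  beats \<open>(t - s) powr (2 * \<beta>)\<close> as soon as \<open>t - s \<ge> h ^ 3\<close>.\<close>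

definition fine_mesh :: "nat \<Rightarrow> real" where
  "fine_mesh k = ((1 / 2) ^ Suc k) ^ 24"

text \<open>Scale and endpoints are rounded down to the grid. Intervals shorter than
  \<open>h ^ 3\<close> need no grid: there the quadratic bound
  \<open>C / h\<^sup>2 * (t - s)\<^sup>2\<close> already has the right size.\<close>

lemma (in bounded_pair) grid_interpolation:
  fixes n :: nat
  assumes Tn: "T = real n" and \<beta>: "0 \<le> \<beta>" "\<beta> \<le> 1 / 2" and \<kappa>: "\<kappa> \<le> 1" and Z: "0 \<le> Z"
    and grid: "\<And>k a b c. a < b \<Longrightarrow> -T \<le> real_of_int a * fine_mesh k \<Longrightarrow> real_of_int b * fine_mesh k \<le> T \<Longrightarrow>
      (1 / 2) ^ Suc k \<le> real_of_int c * fine_mesh k \<Longrightarrow> real_of_int c * fine_mesh k \<le> (1 / 2) ^ k \<Longrightarrow>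
      \<bar>area (real_of_int c * fine_mesh k) x y (real_of_int a * fine_mesh k) (real_of_int b * fine_mesh k) -
        area ((1 / 2) ^ k) x y (real_of_int a * fine_mesh k) (real_of_int b * fine_mesh k)\<bar>
      \<le> Z * 2 powr (- \<kappa> * k) * (real_of_int b * fine_mesh k - real_of_int a * fine_mesh k) powr (2 * \<beta>)"
  shows "\<exists>C\<ge>0. \<forall>k \<delta> s t. (1 / 2) ^ Suc k \<le> \<delta> \<longrightarrow> \<delta> \<le> (1 / 2) ^ k \<longrightarrow> -T \<le> s \<longrightarrow> s < t \<longrightarrow> t \<le> T \<longrightarrow>
    \<bar>area \<delta> x y s t - area ((1 / 2) ^ k) x y s t\<bar> \<le> C * 2 powr (- \<kappa> * k) * (t - s) powr (2 * \<beta>)"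
proof -
  obtain C where C: "0 \<le> C"
    and quad: "\<And>\<eta> \<delta> s t. 0 < \<eta> \<Longrightarrow> \<eta> \<le> \<delta> \<Longrightarrow> \<delta> \<le> 1 \<Longrightarrow> -T \<le> s \<Longrightarrow> s \<le> t \<Longrightarrow> t \<le> T \<Longrightarrow>
      \<bar>area \<delta> x y s t\<bar> \<le> C / \<eta>\<^sup>2 * (t - s)\<^sup>2"
    and crude: "\<And>\<eta> \<delta> \<delta>' s s' t t'. 0 < \<eta> \<Longrightarrow> \<eta> \<le> \<delta> \<Longrightarrow> \<delta> \<le> 1 \<Longrightarrow> \<eta> \<le> \<delta>' \<Longrightarrow> \<delta>' \<le> 1 \<Longrightarrow>
      -T \<le> s' \<Longrightarrow> s' \<le> s \<Longrightarrow> s \<le> t \<Longrightarrow> s' \<le> t' \<Longrightarrow> t' \<le> t \<Longrightarrow> t \<le> T \<Longrightarrow>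
      \<bar>area \<delta> x y s t - area \<delta>' x y s' t'\<bar> \<le> C / \<eta>\<^sup>2 * (\<bar>\<delta> - \<delta>'\<bar> powr (1 / 3) + (s - s') + (t - t'))"
    by (rule area_crude_bounds) blast
  have "\<bar>area \<delta> x y s t - area ((1 / 2) ^ k) x y s t\<bar> \<le> (2 * Z + 6 * C) * 2 powr (- \<kappa> * k) * (t - s) powr (2 * \<beta>)"
    if \<delta>: "(1 / 2) ^ Suc k \<le> \<delta>" "\<delta> \<le> (1 / 2) ^ k" and st: "-T \<le> s" "s < t" "t \<le> T" for k \<delta> s t
  proof -
    define h where "h = (1 / 2 :: real) ^ Suc k"
    define p where "p = (t - s) powr (2 * \<beta>)"
    define q where "q = 2 powr (- \<kappa> * k)"
    have k1: "(1 / 2 :: real) ^ k \<le> 1" by (simp add: power_le_one)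
    have h: "0 < h" "h \<le> 1" "h \<le> \<delta>" "h \<le> (1 / 2) ^ k"
      using \<delta> k1 by (auto simp: h_def)
    have \<delta>1: "\<delta> \<le> 1" using \<delta> k1 by linarith
    have p0: "0 \<le> p" and q0: "0 \<le> q" by (simp_all add: p_def q_def)
    have hq: "h \<le> q"
    proof -
      have "h \<le> (1 / 2) ^ k" using h by simp
      also have "\<dots> = 2 powr (- real k)" by (simp add: powr_minus powr_realpow power_one_over inverse_eq_divide)
      also have "\<dots> \<le> q" unfolding q_def using mult_right_mono[OF \<kappa>, of "real k"] by (intro powr_mono) auto
      finally show ?thesis .
    qed
    \<comment> \<open>Since \<open>2 * \<beta> \<le> 1\<close>, the weight \<open>p\<close>
      dominates the length of intervals no longer than \<open>1\<close>.\<close>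
    have tsp: "min (t - s) 1 \<le> p"
    proof (cases "t - s \<le> 1")
      case True
      then have "(t - s) powr 1 \<le> p" unfolding p_def using st \<beta> by (intro powr_mono') auto
      then show ?thesis using st by simp
    next
      case False
      then show ?thesis unfolding p_def using \<beta> by (simp add: ge_one_powr_ge_zero)
    qed
    show ?thesis
    proof (cases "t - s < h ^ 3")
      case True
      have h31: "h ^ 3 \<le> 1" using h by (simp add: power_le_one)
      have ts1: "t - s \<le> p" using tsp True h31 by simp
      have bd: "\<bar>area d x y s t\<bar> \<le> C * (q * p)" if "h \<le> d" "d \<le> 1" for d
      proof -
        have "\<bar>area d x y s t\<bar> \<le> C / h\<^sup>2 * (t - s)\<^sup>2" using that h st by (intro quad) auto
        also have "\<dots> \<le> C / h\<^sup>2 * (h ^ 3 * p)"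
          unfolding power2_eq_square[of "t - s"] using True ts1 st h C by (intro mult_left_mono mult_mono) auto
        also have "C / h\<^sup>2 * (h ^ 3 * p) = C * (h * p)" using h by (simp add: power2_eq_square power3_eq_cube)
        also have "\<dots> \<le> C * (q * p)" using C hq p0 by (intro mult_left_mono mult_right_mono) auto
        finally show ?thesis .
      qed
      have "\<bar>area \<delta> x y s t - area ((1 / 2) ^ k) x y s t\<bar> \<le> 2 * C * (q * p)"
        using bd[of \<delta>] bd[of "(1/2)^k"] h \<delta>1 k1 by linarith
      also have "\<dots> \<le> (2 * Z + 6 * C) * (q * p)" using C Z p0 q0 by (intro mult_right_mono) auto
      finally show ?thesis by (simp add: p_def q_def ac_simps)
    next
      case False
      define e where "e = fine_mesh k"
      have e_eq: "e = h ^ 24" by (simp add: e_def fine_mesh_def h_def)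
      have e: "0 < e" using h by (simp add: e_eq)
      have eh: "e \<le> h ^ 8" "h ^ 8 \<le> h ^ 3" "e \<le> h ^ 3"
        unfolding e_eq using h by (auto intro!: power_decreasing)
      have e3: "e powr (1 / 3) = h ^ 8"
      proof -
        have "e powr (1 / 3) = ((h ^ 8) powr real 3) powr (1 / 3)"
          using h by (subst powr_realpow) (simp_all add: e_eq power_mult[symmetric])
        also have "\<dots> = h ^ 8" using h by (subst powr_powr) simp
        finally show ?thesis .
      qed
      \<comment> \<open>Both \<open>1 / e\<close> and \<open>h / e\<close> are integers, and so is
        \<open>T\<close>. Hence the lower bounds \<open>-T\<close> and \<open>h\<close> are grid
        points themselves and survive rounding down.\<close>
      have inv_e: "1 / e = of_int (2 ^ (24 * Suc k))" "h / e = of_int (2 ^ (23 * Suc k))"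
        unfolding e_eq h_def by (simp_all add: power_mult[symmetric] power_one_over field_simps power_add[symmetric])
          (simp_all add: power_add)
      define a b c where abc: "a = \<lfloor>s / e\<rfloor>" "b = \<lfloor>t / e\<rfloor>" "c = \<lfloor>\<delta> / e\<rfloor>"
      have fl: "real_of_int \<lfloor>r / e\<rfloor> * e \<le> r" "r - real_of_int \<lfloor>r / e\<rfloor> * e \<le> e" for r
      proof -
        show "real_of_int \<lfloor>r / e\<rfloor> * e \<le> r" using e by (simp add: pos_le_divide_eq[symmetric])
        have "r / e \<le> real_of_int \<lfloor>r / e\<rfloor> + 1" by linarith
        then show "r - real_of_int \<lfloor>r / e\<rfloor> * e \<le> e" using e by (simp add: pos_divide_le_eq algebra_simps)
      qed
      define s' t' d where s't': "s' = real_of_int a * e" "t' = real_of_int b * e" "d = real_of_int c * e"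
      have s': "s' \<le> s" "s - s' \<le> e" and t': "t' \<le> t" "t - t' \<le> e" and d: "d \<le> \<delta>" "\<delta> - d \<le> e"
        using fl by (auto simp: s't' abc)
      have ab: "a < b"
      proof -
        have "e \<le> t - s" using False eh by linarith
        then have "1 \<le> (t - s) / e" using e by (simp add: pos_le_divide_eq)
        then have "s / e + 1 \<le> t / e" by (simp add: diff_divide_distrib)
        then show ?thesis unfolding abc by linarith
      qed
      have s'T: "-T \<le> s'"
      proof -
        have "of_int (- int n * 2 ^ (24 * Suc k)) = - T * (1 / e)" unfolding inv_e(1) Tn by simp
        also have "\<dots> \<le> s / e" using divide_right_mono[of "-T" s e] e st by simp
        finally have "- int n * 2 ^ (24 * Suc k) \<le> a" unfolding abc by (simp only: le_floor_iff)
        then have "real_of_int (- int n * 2 ^ (24 * Suc k)) * e \<le> s'" unfolding s't' using e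
          by (intro mult_right_mono) (simp_all only: of_int_le_iff)
        moreover have "real_of_int (- int n * 2 ^ (24 * Suc k)) * e = - T * (1 / e) * e" unfolding inv_e(1) Tn by simp
        ultimately show ?thesis using e by simp
      qed
      have hd: "h \<le> d"
      proof -
        have "h / e \<le> \<delta> / e" using h e by (simp add: divide_right_mono)
        then have "2 ^ (23 * Suc k) \<le> c" unfolding abc inv_e(2) by (simp only: le_floor_iff)
        then have "real_of_int (2 ^ (23 * Suc k)) * e \<le> d" unfolding s't' using e
          by (intro mult_right_mono) (simp_all only: of_int_le_iff)
        then show ?thesis unfolding inv_e(2)[symmetric] using e by simp
      qed
      have st': "s' < t'" using ab e unfolding s't' by simp
      have G: "\<bar>area d x y s' t' - area ((1 / 2) ^ k) x y s' t'\<bar> \<le> Z * q * (t' - s') powr (2 * \<beta>)"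
        using grid[OF ab, of k c] s'T hd t' d st \<delta> unfolding s't' q_def e_def[symmetric] h_def by auto
      \<comment> \<open>Here \<open>t' - s' \<le> t - s + e\<close> and
        \<open>e \<le> h ^ 3 \<le> t - s\<close>, so rounding at most doubles the length.\<close>
      have "(t' - s') powr (2 * \<beta>) \<le> (2 * (t - s)) powr (2 * \<beta>)"
        using st' s' t' False eh \<beta> by (intro powr_mono2) auto
      also have "\<dots> = 2 powr (2 * \<beta>) * p" by (simp only: p_def powr_mult)
      also have "\<dots> \<le> 2 powr 1 * p" using \<beta> p0 by (intro mult_right_mono powr_mono) auto
      finally have "(t' - s') powr (2 * \<beta>) \<le> 2 * p" by simp
      then have "Z * q * (t' - s') powr (2 * \<beta>) \<le> Z * q * (2 * p)" using Z q0 by (intro mult_left_mono) auto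
      with G have G': "\<bar>area d x y s' t' - area ((1 / 2) ^ k) x y s' t'\<bar> \<le> 2 * Z * (q * p)" by (simp add: ac_simps)
      have h3p: "h ^ 3 \<le> p" using tsp False h power_le_one[of h 3] by auto
      \<comment> \<open>\<open>h ^ 8 / h\<^sup>2\<close> is \<open>h ^ 3 * h ^ 3\<close>; one factor
        is at most the weight \<open>p\<close>, the other at most the rate \<open>q\<close>.\<close>
      have hbd: "C / h\<^sup>2 * (3 * h ^ 8) \<le> 3 * C * (q * p)"
      proof -
        have "C / h\<^sup>2 * (3 * h ^ 8) = 3 * C * (h ^ 3 * h ^ 3)"
          using h by (simp add: field_simps power_add[symmetric])
        also have "h ^ 3 * h ^ 3 \<le> q * p"
          using h3p hq h power_decreasing[of 1 3 h] by (intro mult_mono) auto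
        finally show ?thesis using C by (simp add: mult_left_mono)
      qed
      have c1: "\<bar>area \<delta> x y s t - area d x y s' t'\<bar> \<le> 3 * C * (q * p)"
      proof -
        have "\<bar>area \<delta> x y s t - area d x y s' t'\<bar> \<le> C / h\<^sup>2 * (\<bar>\<delta> - d\<bar> powr (1 / 3) + (s - s') + (t - t'))"
          using h \<delta>1 hd d s'T s' st st' t' by (intro crude) auto
        also have "\<dots> \<le> C / h\<^sup>2 * (3 * h ^ 8)"
        proof (intro mult_left_mono)
          have "\<bar>\<delta> - d\<bar> powr (1 / 3) \<le> e powr (1 / 3)" using d by (intro powr_mono2) auto
          then show "\<bar>\<delta> - d\<bar> powr (1 / 3) + (s - s') + (t - t') \<le> 3 * h ^ 8"
            using s' t' eh e3 by linarith
        qed (use C in auto)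
        finally show ?thesis using hbd by linarith
      qed
      have c2: "\<bar>area ((1 / 2) ^ k) x y s t - area ((1 / 2) ^ k) x y s' t'\<bar> \<le> 3 * C * (q * p)"
      proof -
        have "\<bar>area ((1 / 2) ^ k) x y s t - area ((1 / 2) ^ k) x y s' t'\<bar> \<le>
            C / h\<^sup>2 * (\<bar>(1 / 2) ^ k - (1 / 2) ^ k\<bar> powr (1 / 3) + (s - s') + (t - t'))"
          using h k1 s'T s' st st' t' by (intro crude) auto
        also have "\<dots> \<le> C / h\<^sup>2 * (3 * h ^ 8)"
          using s' t' eh C h by (intro mult_left_mono) auto
        finally show ?thesis using hbd by linarith
      qed
      have "\<bar>area \<delta> x y s t - area ((1 / 2) ^ k) x y s t\<bar> \<le> (2 * Z + 6 * C) * (q * p)"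
        unfolding distrib_right using c1 c2 G' by linarith
      then show ?thesis by (simp add: p_def q_def ac_simps)
    qed
  qed
  then show ?thesis using C Z by (intro exI[of _ "2 * Z + 6 * C"]) auto
qed

section \<open>Covariance of fractional increments\<close>

text \<open>Covariance of the increments from \<open>u\<close> to \<open>v\<close> and from
  \<open>w\<close> to \<open>z\<close> of one coordinate of fractional Brownian motion.\<close>

definition icov :: "real \<Rightarrow> real \<Rightarrow> real \<Rightarrow> real \<Rightarrow> real \<Rightarrow> real" where
  "icov H u v w z = (\<bar>u - z\<bar> powr (2 * H) + \<bar>v - w\<bar> powr (2 * H) -
    \<bar>u - w\<bar> powr (2 * H) - \<bar>v - z\<bar> powr (2 * H)) / 2"

lemma icov_sym: "icov H u v w z = icov H w z u v"
  by (simp add: icov_def abs_minus_commute)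

lemma icov_shift [simp]: "icov H (u + r) (v + r) (w + r) (z + r) = icov H u v w z"
  by (simp add: icov_def)

lemma icov_self: "0 < H \<Longrightarrow> icov H u v u v = \<bar>v - u\<bar> powr (2 * H)"
  by (simp add: icov_def abs_minus_commute)

lemma icov_add: "icov H u v a b + icov H u v b c = icov H u v a c"
  by (simp add: icov_def field_simps)

lemma icov_telescope:
  "(\<Sum>l<n. icov H u v (w l) (w (Suc l))) = icov H u v (w 0) (w n)"
proof (induction n)
  case 0
  then show ?case using icov_add[of H u v "w 0" "w 0" "w 0"] by simp
qed (simp add: icov_add)

text \<open>Moving from \<open>u\<close> to \<open>v\<close> brings the point closer to
  \<open>t\<close> and farther from \<open>s\<close>, and powers are monotone. Row sums of the
  covariance matrix of a partition have this form.\<close>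

lemma icov_subinterval_nonneg:
  assumes "0 < H" "s \<le> u" "u \<le> v" "v \<le> t"
  shows "0 \<le> icov H u v s t"
proof -
  have "\<bar>v - t\<bar> powr (2 * H) \<le> \<bar>u - t\<bar> powr (2 * H)" "\<bar>u - s\<bar> powr (2 * H) \<le> \<bar>v - s\<bar> powr (2 * H)"
    using assms by (auto intro!: powr_mono2)
  then show ?thesis by (simp add: icov_def)
qed

text \<open>A concave function has decreasing increments: for fixed \<open>p\<close>, the difference
  \<open>(a + p + q) powr \<theta> - (a + q) powr \<theta>\<close> decreases in
  \<open>q\<close>.\<close>

lemma powr_concave_exchange:
  fixes a p q \<theta> :: real
  assumes a: "0 \<le> a" "0 \<le> p" "0 \<le> q" and \<theta>: "0 < \<theta>" "\<theta> \<le> 1"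
  shows "(a + p + q) powr \<theta> + a powr \<theta> \<le> (a + p) powr \<theta> + (a + q) powr \<theta>"
proof (cases "p = 0")
  case True
  then show ?thesis using a by auto
next
  case False
  then have ap: "0 < p" using a by auto
  let ?g = "\<lambda>q. (a + q) powr \<theta> - (a + p + q) powr \<theta>"
  have "?g 0 \<le> ?g q"
  \<comment> \<open>For \<open>a = 0\<close> and \<open>\<theta> < 1\<close> there is no derivative
    at \<open>0\<close>, hence the criterion on the open interval.\<close>
  proof (rule DERIV_nonneg_imp_increasing_open[OF a(3)])
    fix x assume x: "0 < x" "x < q"
    have "((\<lambda>q. (a + q) powr \<theta> - (a + p + q) powr \<theta>) has_real_derivative
        \<theta> * (a + x) powr (\<theta> - 1) - \<theta> * (a + p + x) powr (\<theta> - 1)) (at x)"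
      using x a by (auto intro!: derivative_eq_intros)
    moreover have "(a + p + x) powr (\<theta> - 1) \<le> (a + x) powr (\<theta> - 1)"
      using x a \<theta> by (intro powr_mono2') auto
    ultimately show "\<exists>y. (?g has_real_derivative y) (at x) \<and> 0 \<le> y"
      using \<theta> by (intro exI conjI) (auto simp: mult_left_mono)
  next
    show "continuous_on {0..q} ?g"
      using a \<theta> by (intro continuous_intros continuous_on_powr') auto
  qed
  then show ?thesis by simp
qed

text \<open>With \<open>w - v\<close> as the gap between the intervals this is concavity of
  \<open>r powr (2 * H)\<close>, which holds because \<open>2 * H \<le> 1\<close>.\<close>

lemma icov_disjoint_nonpos:
  assumes H: "0 < H" "H \<le> 1 / 2" and uv: "u \<le> v" "w \<le> z" and dis: "v \<le> w \<or> z \<le> u"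
  shows "icov H u v w z \<le> 0"
proof -
  have *: "icov H u v w z \<le> 0" if "u \<le> v" "v \<le> w" "w \<le> z" for u v w z
  proof -
    have "(w - v + (v - u) + (z - w)) powr (2 * H) + (w - v) powr (2 * H) \<le>
        (w - v + (v - u)) powr (2 * H) + (w - v + (z - w)) powr (2 * H)"
      using that H by (intro powr_concave_exchange) auto
    then show ?thesis using that by (simp add: icov_def abs_minus_commute)
  qed
  from dis show ?thesis
  proof
    assume "z \<le> u"
    then show ?thesis using uv *[of w z u v] by (subst icov_sym) auto
  qed (use uv * in auto)
qed

section \<open>Lag sums of the covariance on equidistant grids\<close>

lemma powr_diff_le:
  fixes m :: real
  assumes "1 \<le> m" "0 < \<theta>" "\<theta> \<le> 1"
  shows "m powr \<theta> - (m - 1) powr \<theta> \<le> m powr (\<theta> - 1)"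
proof -
  \<comment> \<open>A base in [0, 1] yields a larger power for a smaller exponent. This covers
    \<open>m = 1\<close>, where a bound by the derivative at \<open>m - 1\<close> is of no
    use.\<close>
  have "1 - 1 / m \<le> (1 - 1 / m) powr \<theta>"
    using powr_mono'[of \<theta> 1 "1 - 1 / m"] assms by simp
  then have "m powr \<theta> * (1 - 1 / m) \<le> m powr \<theta> * (1 - 1 / m) powr \<theta>" by (intro mult_left_mono) auto
  also have "\<dots> = (m - 1) powr \<theta>" using assms by (simp add: powr_mult[symmetric] right_diff_distrib)
  finally show ?thesis using assms by (simp add: powr_diff right_diff_distrib)
qed

lemma powr_diff_ge:
  fixes m :: real
  assumes m: "1 \<le> m" and \<epsilon>: "0 < \<epsilon>" "\<epsilon> \<le> 1"
  shows "\<epsilon> * m powr (\<epsilon> - 1) \<le> m powr \<epsilon> - (m - 1) powr \<epsilon>"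
proof (cases "m = 1")
  case True
  then show ?thesis using \<epsilon> by simp
next
  case False
  then have m1: "1 < m" using m by simp
  have "\<exists>z>m - 1. z < m \<and> m powr \<epsilon> - (m - 1) powr \<epsilon> = (m - (m - 1)) * (\<epsilon> * z powr (\<epsilon> - 1))"
    using m1 by (intro MVT2) (auto intro!: derivative_eq_intros)
  then obtain z where z: "m - 1 < z" "z < m" "m powr \<epsilon> - (m - 1) powr \<epsilon> = \<epsilon> * z powr (\<epsilon> - 1)" by auto
  have "m powr (\<epsilon> - 1) \<le> z powr (\<epsilon> - 1)" using z m1 \<epsilon> by (intro powr_mono2') auto
  then show ?thesis using z \<epsilon> by simp
qed

text \<open>Comparison with an integral, in the telescoping form provided by
  \<open>powr_diff_ge\<close>.\<close>

lemma sum_powr_le: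
  fixes \<epsilon> :: real
  assumes \<epsilon>: "0 < \<epsilon>" "\<epsilon> \<le> 1"
  shows "(\<Sum>m=1..n. real m powr (\<epsilon> - 1)) \<le> real n powr \<epsilon> / \<epsilon>"
proof (induction n)
  case (Suc n)
  have "\<epsilon> * real (Suc n) powr (\<epsilon> - 1) \<le> real (Suc n) powr \<epsilon> - real n powr \<epsilon>"
    using powr_diff_ge[of "real (Suc n)" \<epsilon>] \<epsilon> by simp
  then have "real (Suc n) powr (\<epsilon> - 1) \<le> real (Suc n) powr \<epsilon> / \<epsilon> - real n powr \<epsilon> / \<epsilon>"
    using \<epsilon> by (simp add: diff_divide_distrib[symmetric] pos_le_divide_eq mult.commute)
  then show ?case using Suc by simp
qed (use \<epsilon> in simp)

text \<open>Minus the autocovariance at distance \<open>m\<close> of fractional Gaussian noise, the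
  sequence of unit increments.\<close>

definition lag :: "real \<Rightarrow> nat \<Rightarrow> real" where
  "lag H m = (2 * real m powr (2 * H) - real (m + 1) powr (2 * H) - (real m - 1) powr (2 * H)) / 2"

lemma lag_nonneg: "0 < H \<Longrightarrow> H \<le> 1 / 2 \<Longrightarrow> 1 \<le> m \<Longrightarrow> 0 \<le> lag H m"
  using powr_concave_exchange[of "real m - 1" 1 1 "2 * H"] by (simp add: lag_def algebra_simps)

text \<open>Summation by parts. \<open>lag\<close> is minus half the second difference of
  \<open>m powr (2 * H)\<close>; moving one difference to \<open>m powr (2 * \<alpha>)\<close>
  leaves products of first differences of order \<open>m powr (2 * \<alpha> + 2 * H - 2)\<close>,
  whose sum is a power of \<open>n\<close> because \<open>2 * \<alpha> + 2 * H > 1\<close>.\<close>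

lemma sum_lag_le:
  assumes H: "0 < H" "H \<le> 1 / 2" and \<alpha>: "0 < \<alpha>" "\<alpha> \<le> 1 / 2" and big: "1 < 2 * \<alpha> + 2 * H"
  shows "(\<Sum>m=1..n. real m powr (2 * \<alpha>) * lag H m) \<le> real n powr (2 * \<alpha> + 2 * H - 1) / (2 * (2 * \<alpha> + 2 * H - 1))"
proof -
  define d where "d m = real m powr (2 * H) - (real m - 1) powr (2 * H)" for m :: nat
  have lag: "2 * lag H m = d m - d (Suc m)" for m by (simp add: lag_def d_def add.commute)
  have abel: "((\<Sum>m=1..n. real m powr (2 * \<alpha>) * (d m - d (Suc m))) :: real) =
      (\<Sum>m=1..n. (real m powr (2 * \<alpha>) - (real m - 1) powr (2 * \<alpha>)) * d m) - real n powr (2 * \<alpha>) * d (Suc n)"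
    for n using \<alpha> by (induction n) (auto simp: algebra_simps)
  have d0: "0 \<le> d m" if "1 \<le> m" for m unfolding d_def using that H by (auto intro!: powr_mono2)
  have "2 * (\<Sum>m=1..n. real m powr (2 * \<alpha>) * lag H m) = (\<Sum>m=1..n. real m powr (2 * \<alpha>) * (d m - d (Suc m)))"
    unfolding sum_distrib_left lag[symmetric] by (simp add: ac_simps)
  \<comment> \<open>The boundary term has a favourable sign and is dropped.\<close>
  also have "\<dots> \<le> (\<Sum>m=1..n. (real m powr (2 * \<alpha>) - (real m - 1) powr (2 * \<alpha>)) * d m)"
    unfolding abel using d0[of "Suc n"] by simp
  also have "\<dots> \<le> (\<Sum>m=1..n. real m powr (2 * \<alpha> - 1) * real m powr (2 * H - 1))"
    using \<alpha> H d0 by (intro sum_mono mult_mono) (auto simp: d_def intro!: powr_diff_le)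
  also have "\<dots> = (\<Sum>m=1..n. real m powr ((2 * \<alpha> + 2 * H - 1) - 1))"
    by (intro sum.cong refl) (simp add: powr_add[symmetric] algebra_simps)
  also have "\<dots> \<le> real n powr (2 * \<alpha> + 2 * H - 1) / (2 * \<alpha> + 2 * H - 1)"
    using big H \<alpha> by (intro sum_powr_le) auto
  finally show ?thesis using big by (simp add: field_simps)
qed

lemma icov_grid:
  assumes st: "s < t" and n: "0 < n" and kl: "k \<noteq> l"
  shows "icov H (grid s t n k) (grid s t n (Suc k)) (grid s t n l) (grid s t n (Suc l)) =
    - (((t - s) / n) powr (2 * H) * lag H (nat \<bar>int k - int l\<bar>))"
proof -
  define h where "h = (t - s) / n"
  have h: "0 < h" using st n by (simp add: h_def)
  have gd: "\<bar>grid s t n k - grid s t n l\<bar> = \<bar>real k - real l\<bar> * h" for k l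
    unfolding grid_diff h_def[symmetric] abs_mult using h by simp
  have *: "icov H (grid s t n k) (grid s t n (Suc k)) (grid s t n l) (grid s t n (Suc l)) =
      - (h powr (2 * H) * lag H (l - k))" if "k < l" for k l
  proof -
    define m where "m = l - k"
    have l: "l = k + m" and m: "1 \<le> real m" using that by (auto simp: m_def)
    have eqs: "\<bar>grid s t n k - grid s t n (Suc l)\<bar> = (real (m + 1)) * h"
      "\<bar>grid s t n (Suc k) - grid s t n l\<bar> = (real m - 1) * h"
      "\<bar>grid s t n k - grid s t n l\<bar> = real m * h"
      "\<bar>grid s t n (Suc k) - grid s t n (Suc l)\<bar> = real m * h"
      unfolding gd l using m by auto
    have alg: "(a * d + b * d - c * d - c * d) / 2 = - (d * ((2 * c - a - b) / 2))" for a b c d :: real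
      by (simp add: field_simps)
    show ?thesis unfolding icov_def lag_def eqs m_def[symmetric] powr_mult by (rule alg)
  qed
  note * = *[unfolded h_def]
  show ?thesis
  proof (cases "k < l")
    case True
    then have e: "nat \<bar>int k - int l\<bar> = l - k" by linarith
    show ?thesis unfolding e by (rule *[OF True])
  next
    case False
    then have "l < k" using kl by simp
    then have e: "nat \<bar>int k - int l\<bar> = k - l" by linarith
    show ?thesis unfolding e by (subst icov_sym) (rule *[OF \<open>l < k\<close>])
  qed
qed

text \<open>Each lag is attained by at most one index on either side of \<open>k\<close>.\<close>

lemma sum_over_lags_le:
  fixes \<phi> :: "nat \<Rightarrow> real"
  assumes \<phi>: "\<And>m. 1 \<le> m \<Longrightarrow> 0 \<le> \<phi> m" and k: "k < n"
  shows "(\<Sum>l\<in>{..<n} - {k}. \<phi> (nat \<bar>int k - int l\<bar>)) \<le> 2 * (\<Sum>m=1..n. \<phi> m)"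
proof -
  have split: "{..<n} - {k} = {..<k} \<union> {Suc k..<n}" using k by auto
  have "(\<Sum>l\<in>{..<k}. \<phi> (nat \<bar>int k - int l\<bar>)) = (\<Sum>m=1..k. \<phi> m)"
    by (rule sum.reindex_bij_witness[of _ "\<lambda>m. k - m" "\<lambda>l. k - l"]) (auto intro!: arg_cong[of _ _ \<phi>])
  also have "\<dots> \<le> (\<Sum>m=1..n. \<phi> m)" using k \<phi> by (intro sum_mono2) auto
  finally have 1: "(\<Sum>l\<in>{..<k}. \<phi> (nat \<bar>int k - int l\<bar>)) \<le> (\<Sum>m=1..n. \<phi> m)" .
  have "(\<Sum>l\<in>{Suc k..<n}. \<phi> (nat \<bar>int k - int l\<bar>)) = (\<Sum>m\<in>{1..<n - k}. \<phi> m)"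
    by (rule sum.reindex_bij_witness[of _ "\<lambda>m. k + m" "\<lambda>l. l - k"]) (auto intro!: arg_cong[of _ _ \<phi>])
  also have "\<dots> \<le> (\<Sum>m=1..n. \<phi> m)" using \<phi> by (intro sum_mono2) auto
  finally show ?thesis using 1 unfolding split by (subst sum.union_disjoint) auto
qed

text \<open>Positive exactly when \<open>1 < 2 * \<alpha> + 2 * H\<close>. Under this Young
  condition the weighted double sum of grid covariances is bounded independently of the number of
  cells.\<close>

definition young_const :: "real \<Rightarrow> real \<Rightarrow> real" where
  "young_const \<alpha> H = 1 / (2 * \<alpha> + 2 * H - 1)"

text \<open>By scaling, \<open>n\<close> cancels: the cell length contributes
  \<open>((t - s) / n) powr (2 * \<alpha> + 2 * H)\<close>, and the \<open>n\<close> rows together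
  contribute \<open>n * n powr (2 * \<alpha> + 2 * H - 1)\<close>.\<close>

lemma sum_grid_icov_le:
  assumes H: "0 < H" "H \<le> 1 / 2" and \<alpha>: "0 < \<alpha>" "\<alpha> \<le> 1 / 2" and big: "1 < 2 * \<alpha> + 2 * H"
    and st: "s < t" and n: "0 < n"
  shows "(\<Sum>k<n. \<Sum>l\<in>{..<n} - {k}. \<bar>grid s t n k - grid s t n l\<bar> powr (2 * \<alpha>) *
      (- icov H (grid s t n k) (grid s t n (Suc k)) (grid s t n l) (grid s t n (Suc l))))
    \<le> young_const \<alpha> H * (t - s) powr (2 * \<alpha> + 2 * H)"
proof -
  let ?h = "(t - s) / n" and ?\<epsilon> = "2 * \<alpha> + 2 * H - 1"
  have h: "0 < ?h" using st n by simp
  define \<phi> where "\<phi> m = real m powr (2 * \<alpha>) * lag H m" for m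
  have \<phi>: "0 \<le> \<phi> m" if "1 \<le> m" for m using lag_nonneg[OF H that] by (simp add: \<phi>_def)
  have eq: "\<bar>grid s t n k - grid s t n l\<bar> powr (2 * \<alpha>) *
      (- icov H (grid s t n k) (grid s t n (Suc k)) (grid s t n l) (grid s t n (Suc l))) =
      ?h powr (2 * \<alpha> + 2 * H) * \<phi> (nat \<bar>int k - int l\<bar>)" if "k \<noteq> l" for k l
  proof -
    have "\<bar>grid s t n k - grid s t n l\<bar> = real (nat \<bar>int k - int l\<bar>) * ?h"
      unfolding grid_diff abs_mult abs_of_pos[OF h] by simp
    then have "\<bar>grid s t n k - grid s t n l\<bar> powr (2 * \<alpha>) =
        real (nat \<bar>int k - int l\<bar>) powr (2 * \<alpha>) * ?h powr (2 * \<alpha>)"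
      using h by (simp only: powr_mult)
    then show ?thesis unfolding icov_grid[OF st n that] \<phi>_def powr_add
      by (simp only: minus_minus ac_simps)
  qed
  have "(\<Sum>k<n. \<Sum>l\<in>{..<n} - {k}. \<bar>grid s t n k - grid s t n l\<bar> powr (2 * \<alpha>) *
      (- icov H (grid s t n k) (grid s t n (Suc k)) (grid s t n l) (grid s t n (Suc l)))) =
      ?h powr (2 * \<alpha> + 2 * H) * (\<Sum>k<n. \<Sum>l\<in>{..<n} - {k}. \<phi> (nat \<bar>int k - int l\<bar>))"
    unfolding sum_distrib_left by (intro sum.cong refl eq) auto
  also have "\<dots> \<le> ?h powr (2 * \<alpha> + 2 * H) * (\<Sum>k<n. 2 * (\<Sum>m=1..n. \<phi> m))"
    by (intro mult_left_mono sum_mono sum_over_lags_le \<phi>) auto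
  also have "\<dots> \<le> ?h powr (2 * \<alpha> + 2 * H) * (\<Sum>k<n. 2 * (real n powr ?\<epsilon> / (2 * ?\<epsilon>)))"
    unfolding \<phi>_def by (intro mult_left_mono sum_mono sum_lag_le assms) auto
  also have "2 * (real n powr ?\<epsilon> / (2 * ?\<epsilon>)) = real n powr ?\<epsilon> * young_const \<alpha> H"
  proof -
    define e where "e = ?\<epsilon>"
    show ?thesis unfolding young_const_def e_def[symmetric] by simp
  qed
  also have "?h powr (2 * \<alpha> + 2 * H) * (\<Sum>k<n. real n powr ?\<epsilon> * young_const \<alpha> H) =
      ?h powr (2 * \<alpha> + 2 * H) * (real n * real n powr ?\<epsilon>) * young_const \<alpha> H"
    by simp
  also have "real n * real n powr ?\<epsilon> = real n powr (2 * \<alpha> + 2 * H)"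
    using n powr_add[of "real n" 1 ?\<epsilon>] by simp
  also have "?h powr (2 * \<alpha> + 2 * H) * real n powr (2 * \<alpha> + 2 * H) = (t - s) powr (2 * \<alpha> + 2 * H)"
    using st n by (simp add: powr_divide)
  finally show ?thesis by (simp add: mult.commute)
qed

section \<open>Moments of decoupled Gaussian sums\<close>

text \<open>The double factorial (2p - 1)!!, the moment of order \<open>2 * p\<close> of a standard
  Gaussian variable.\<close>

definition gauss_const :: "nat \<Rightarrow> real" where
  "gauss_const p = fact (2 * p) / (2 ^ p * fact p)"

lemma gauss_const_pos: "0 < gauss_const p"
  by (simp add: gauss_const_def)

lemma gauss_const_1 [simp]: "gauss_const (Suc 0) = 1"
  by (simp add: gauss_const_def numeral_2_eq_2)

lemma (in prob_space) gaussian_rv_integrable: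
  assumes "gaussian_rv M Z"
  shows "integrable M Z"
  using assms unfolding gaussian_rv_def
proof (elim conjE disjE exE)
  fix \<mu> \<sigma> :: real
  assume "0 < \<sigma>" "distributed M lborel Z (\<lambda>x. ennreal (normal_density \<mu> \<sigma> x))"
  then show ?thesis
    using distributed_integrable_var[of M Z "normal_density \<mu> \<sigma>"] integrable_normal_moment_nz_1[of \<sigma> \<mu>]
    by (simp add: normal_density_nonneg)
next
  fix \<mu>
  assume "Z \<in> borel_measurable M" "AE x in M. Z x = \<mu>"
  then show ?thesis by (subst integrable_cong_AE[where g="\<lambda>_. \<mu>"]) auto
qed

text \<open>One \<open>v\<close> serves all \<open>p\<close>, so that the case \<open>p = 1\<close>
  identifies it as the variance. Point masses are the case \<open>v = 0\<close>, where
  \<open>0 ^ 0 = 1\<close> gives the correct moment of order zero.\<close>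

lemma (in prob_space) gaussian_rv_moment_aux:
  assumes Z: "gaussian_rv M Z" and mean: "expectation Z = 0"
  shows "\<exists>v\<ge>0. \<forall>p. (\<integral>\<^sup>+x. ennreal (Z x ^ (2 * p)) \<partial>M) = ennreal (gauss_const p * v ^ p)"
  using Z unfolding gaussian_rv_def
proof (elim conjE disjE exE)
  fix \<mu> \<sigma> :: real
  assume \<sigma>: "0 < \<sigma>" and D: "distributed M lborel Z (\<lambda>x. ennreal (normal_density \<mu> \<sigma> x))"
  have \<mu>: "\<mu> = 0" using normal_distributed_expectation[OF \<sigma> D] mean by simp
  have "(\<integral>\<^sup>+x. ennreal (Z x ^ (2 * p)) \<partial>M) = ennreal (gauss_const p * (\<sigma>\<^sup>2) ^ p)" for p
  proof -
    have "(\<integral>\<^sup>+x. ennreal (Z x ^ (2 * p)) \<partial>M) = (\<integral>\<^sup>+x. ennreal (normal_density \<mu> \<sigma> x) * ennreal (x ^ (2 * p)) \<partial>lborel)"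
      by (rule distributed_nn_integral[OF D, symmetric]) simp
    also have "\<dots> = (\<integral>\<^sup>+x. ennreal (normal_density \<mu> \<sigma> x * (x - \<mu>) ^ (2 * p)) \<partial>lborel)"
      by (simp add: \<mu> ennreal_mult)
    also have "\<dots> = ennreal (fact (2 * p) / ((2 / \<sigma>\<^sup>2) ^ p * fact p))"
      using normal_moment_even[OF \<sigma>, of \<mu> p]
      by (subst nn_integral_eq_integral) (auto simp: has_bochner_integral_iff zero_le_even_power)
    also have "fact (2 * p) / ((2 / \<sigma>\<^sup>2) ^ p * fact p) = gauss_const p * (\<sigma>\<^sup>2) ^ p"
      using \<sigma> by (simp add: gauss_const_def power_divide)
    finally show ?thesis .
  qed
  then show ?thesis by (intro exI[of _ "\<sigma>\<^sup>2"]) auto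
next
  fix \<mu>
  assume m: "Z \<in> borel_measurable M" and ae: "AE x in M. Z x = \<mu>"
  have "expectation Z = expectation (\<lambda>_. \<mu>)" using ae m by (intro integral_cong_AE) auto
  then have \<mu>: "\<mu> = 0" using mean prob_space by simp
  have "(\<integral>\<^sup>+x. ennreal (Z x ^ (2 * p)) \<partial>M) = ennreal (gauss_const p * 0 ^ p)" for p
  proof -
    have "(\<integral>\<^sup>+x. ennreal (Z x ^ (2 * p)) \<partial>M) = (\<integral>\<^sup>+x. ennreal (0 ^ (2 * p)) \<partial>M)"
      using ae by (intro nn_integral_cong_AE) (auto simp: \<mu>)
    then show ?thesis by (cases p) (auto simp: emeasure_space_1 gauss_const_def)
  qed
  then show ?thesis by (intro exI[of _ 0]) auto
qed

lemma (in prob_space) gaussian_rv_square: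
  assumes Z: "gaussian_rv M Z" and mean: "expectation Z = 0"
  shows "integrable M (\<lambda>x. (Z x)\<^sup>2)"
    and "(\<integral>\<^sup>+x. ennreal (Z x ^ (2 * p)) \<partial>M) = ennreal (gauss_const p * expectation (\<lambda>x. (Z x)\<^sup>2) ^ p)"
proof -
  obtain v where v: "0 \<le> v" "\<And>p. (\<integral>\<^sup>+x. ennreal (Z x ^ (2 * p)) \<partial>M) = ennreal (gauss_const p * v ^ p)"
    using gaussian_rv_moment_aux[OF assms] by blast
  have m: "Z \<in> borel_measurable M" using Z by (simp add: gaussian_rv_def)
  have sq: "(\<integral>\<^sup>+x. ennreal ((Z x)\<^sup>2) \<partial>M) = ennreal v" using v(2)[of 1] by simp
  show int: "integrable M (\<lambda>x. (Z x)\<^sup>2)" using m sq by (intro integrableI_nonneg) auto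
  have "expectation (\<lambda>x. (Z x)\<^sup>2) = v"
    using m sq v(1) by (subst integral_eq_nn_integral) auto
  then show "(\<integral>\<^sup>+x. ennreal (Z x ^ (2 * p)) \<partial>M) = ennreal (gauss_const p * expectation (\<lambda>x. (Z x)\<^sup>2) ^ p)"
    using v(2) by simp
qed

lemma convex_on_power_nonneg: "convex_on {0..} (\<lambda>x::real. x ^ p)"
proof (cases "even p")
  case True
  then show ?thesis using convex_power_even convex_on_subset by (meson convex_real_interval(1) subset_UNIV)
qed (rule convex_power_odd)

text \<open>Jensen's inequality for the points \<open>z m / B m\<close> with probabilities
  proportional to \<open>w m * B m\<close>. With this choice the bound collapses to a multiple of
  the \<open>p\<close>-th power of \<open>\<Sum>m\<in>J. w m * B m\<close> once
  \<open>z m ^ p\<close> is replaced by a multiple of \<open>B m ^ p\<close>.\<close>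

lemma weighted_sum_power_le:
  fixes w B z :: "'a \<Rightarrow> real"
  assumes J: "finite J" and w: "\<And>m. m \<in> J \<Longrightarrow> 0 \<le> w m" and B: "\<And>m. m \<in> J \<Longrightarrow> 0 < B m"
    and z: "\<And>m. m \<in> J \<Longrightarrow> 0 \<le> z m" and W: "0 < (\<Sum>m\<in>J. w m * B m)"
  shows "(\<Sum>m\<in>J. w m * z m) ^ p \<le>
    (\<Sum>m\<in>J. (\<Sum>m\<in>J. w m * B m) ^ p * (w m * B m / (\<Sum>m\<in>J. w m * B m)) * (z m ^ p / B m ^ p))"
proof -
  let ?W = "\<Sum>m\<in>J. w m * B m"
  have "J \<noteq> {}" using W by auto
  have "(\<Sum>m\<in>J. (w m * B m / ?W) *\<^sub>R (z m / B m)) ^ p \<le> (\<Sum>m\<in>J. (w m * B m / ?W) * (z m / B m) ^ p)"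
  proof (rule convex_on_sum[OF J \<open>J \<noteq> {}\<close> convex_on_power_nonneg])
    show "(\<Sum>m\<in>J. w m * B m / ?W) = 1" using W by (simp add: sum_divide_distrib[symmetric])
  qed (use w B z W in \<open>auto intro!: divide_nonneg_nonneg mult_nonneg_nonneg simp: less_imp_le\<close>)
  also have "(\<Sum>m\<in>J. (w m * B m / ?W) *\<^sub>R (z m / B m)) = (\<Sum>m\<in>J. w m * z m) / ?W"
    unfolding sum_divide_distrib[of _ _ ?W] using B by (intro sum.cong) (auto simp: less_imp_neq[symmetric])
  finally have "?W ^ p * ((\<Sum>m\<in>J. w m * z m) / ?W) ^ p \<le> ?W ^ p * (\<Sum>m\<in>J. (w m * B m / ?W) * (z m / B m) ^ p)"
    using W by (intro mult_left_mono) auto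
  then show ?thesis
    using W by (simp add: power_divide sum_distrib_left mult.assoc)
qed

text \<open>The constant \<open>c\<close> is inherited from single variables: neither the number of
  summands nor their dependence enters.\<close>

lemma (in prob_space) moment_sum_squares:
  fixes w B :: "'i \<Rightarrow> real"
  assumes J: "finite J" and w: "\<And>m. m \<in> J \<Longrightarrow> 0 \<le> w m" and B: "\<And>m. m \<in> J \<Longrightarrow> 0 < B m" and p: "1 \<le> p"
    and h [measurable]: "\<And>m. m \<in> J \<Longrightarrow> h m \<in> borel_measurable M" and c: "0 \<le> c"
    and mom: "\<And>m. m \<in> J \<Longrightarrow> (\<integral>\<^sup>+x. ennreal (h m x ^ (2 * p)) \<partial>M) \<le> ennreal (c * B m ^ p)"
  shows "(\<integral>\<^sup>+x. ennreal ((\<Sum>m\<in>J. w m * (h m x)\<^sup>2) ^ p) \<partial>M) \<le> ennreal (c * (\<Sum>m\<in>J. w m * B m) ^ p)"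
proof -
  let ?W = "\<Sum>m\<in>J. w m * B m"
  have W0: "0 \<le> ?W" using w B by (intro sum_nonneg mult_nonneg_nonneg) (auto simp: less_imp_le)
  show ?thesis
  proof (cases "?W = 0")
    case True
    then have "\<forall>m\<in>J. w m * B m = 0"
      using w B J by (subst (asm) sum_nonneg_eq_0_iff) (auto simp: less_imp_le)
    then have "\<forall>m\<in>J. w m = 0" using B by fastforce
    then show ?thesis using p by (cases p) auto
  next
    case False
    then have W: "0 < ?W" using W0 by simp
    define v where "v m = ?W ^ p * (w m * B m / ?W) / B m ^ p" for m
    have v0: "0 \<le> v m" if "m \<in> J" for m
      unfolding v_def using W w[OF that] B[OF that] by (intro divide_nonneg_nonneg mult_nonneg_nonneg) auto
    have "(\<integral>\<^sup>+x. ennreal ((\<Sum>m\<in>J. w m * (h m x)\<^sup>2) ^ p) \<partial>M) \<le> (\<integral>\<^sup>+x. (\<Sum>m\<in>J. ennreal (v m) * ennreal (h m x ^ (2 * p))) \<partial>M)"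
    proof (intro nn_integral_mono)
      fix x
      have "(\<Sum>m\<in>J. w m * (h m x)\<^sup>2) ^ p \<le> (\<Sum>m\<in>J. ?W ^ p * (w m * B m / ?W) * (((h m x)\<^sup>2) ^ p / B m ^ p))"
        using weighted_sum_power_le[OF J w B _ W, of "\<lambda>m. (h m x)\<^sup>2" p] by simp
      also have "\<dots> = (\<Sum>m\<in>J. v m * h m x ^ (2 * p))"
        by (intro sum.cong) (auto simp: v_def power_mult)
      finally have "ennreal ((\<Sum>m\<in>J. w m * (h m x)\<^sup>2) ^ p) \<le> ennreal (\<Sum>m\<in>J. v m * h m x ^ (2 * p))" by (rule ennreal_leI)
      also have "\<dots> = (\<Sum>m\<in>J. ennreal (v m * h m x ^ (2 * p)))"
        using v0 by (subst sum_ennreal) (auto intro!: mult_nonneg_nonneg simp: zero_le_even_power)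
      finally show "ennreal ((\<Sum>m\<in>J. w m * (h m x)\<^sup>2) ^ p) \<le> (\<Sum>m\<in>J. ennreal (v m) * ennreal (h m x ^ (2 * p)))"
        using v0 by (simp add: ennreal_mult' zero_le_even_power cong: sum.cong)
    qed
    also have "\<dots> = (\<Sum>m\<in>J. ennreal (v m) * (\<integral>\<^sup>+x. ennreal (h m x ^ (2 * p)) \<partial>M))"
      by (subst nn_integral_sum) (auto intro!: sum.cong nn_integral_cmult)
    also have "\<dots> \<le> (\<Sum>m\<in>J. ennreal (v m) * ennreal (c * B m ^ p))"
      by (intro sum_mono mult_left_mono mom) auto
    also have "\<dots> = (\<Sum>m\<in>J. ennreal (v m * (c * B m ^ p)))"
      using v0 by (intro sum.cong refl) (simp add: ennreal_mult')
    also have "\<dots> = ennreal (\<Sum>m\<in>J. v m * (c * B m ^ p))"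
      using v0 c B by (intro sum_ennreal mult_nonneg_nonneg) (auto simp: less_imp_le)
    also have "(\<Sum>m\<in>J. v m * (c * B m ^ p)) = (\<Sum>m\<in>J. c * ?W ^ p / ?W * (w m * B m))"
      using B by (intro sum.cong refl) (auto simp: v_def field_simps less_imp_neq[symmetric])
    also have "\<dots> = c * ?W ^ p" unfolding sum_distrib_left[symmetric] using W by simp
    finally show ?thesis .
  qed
qed

text \<open>Finite linear functionals of coordinate \<open>i\<close>. Under
  \<open>canonical_fbm\<close> they are centred Gaussian, and they depend on the path through
  coordinate \<open>i\<close> alone, which is what decoupling needs.\<close>

definition lincomb :: "'d \<Rightarrow> ((real \<Rightarrow> real ^ 'd) \<Rightarrow> real) \<Rightarrow> bool" where
  "lincomb i Z \<longleftrightarrow> (\<exists>S c. finite S \<and> Z = (\<lambda>\<omega>. \<Sum>t\<in>S. c t * \<omega> t $ i))"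

lemma lincomb_eval [intro]: "lincomb i (\<lambda>\<omega>. \<omega> t $ i)"
  unfolding lincomb_def by (intro exI[of _ "{t}"] exI[of _ "\<lambda>_. 1"]) simp

lemma lincomb_0 [intro]: "lincomb i (\<lambda>\<omega>. 0)"
  unfolding lincomb_def by (intro exI[of _ "{}"]) simp

lemma lincomb_cmult [intro]: "lincomb i Z \<Longrightarrow> lincomb i (\<lambda>\<omega>. a * Z \<omega>)"
  unfolding lincomb_def
proof (elim exE conjE)
  fix S c assume "finite S" "Z = (\<lambda>\<omega>. \<Sum>t\<in>S. c t * \<omega> t $ i)"
  then show "\<exists>S c'. finite S \<and> (\<lambda>\<omega>. a * Z \<omega>) = (\<lambda>\<omega>. \<Sum>t\<in>S. c' t * \<omega> t $ i)"
    by (intro exI[of _ S] exI[of _ "\<lambda>t. a * c t"]) (simp add: sum_distrib_left mult.assoc)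
qed

lemma lincomb_add [intro]:
  assumes "lincomb i Y" "lincomb i Z"
  shows "lincomb i (\<lambda>\<omega>. Y \<omega> + Z \<omega>)"
proof -
  obtain S c T d where S: "finite S" "Y = (\<lambda>\<omega>. \<Sum>t\<in>S. c t * \<omega> t $ i)"
    and T: "finite T" "Z = (\<lambda>\<omega>. \<Sum>t\<in>T. d t * \<omega> t $ i)"
    using assms unfolding lincomb_def by auto
  let ?c = "\<lambda>t. (if t \<in> S then c t else 0)" and ?d = "\<lambda>t. (if t \<in> T then d t else 0)"
  have "(\<Sum>t\<in>S. c t * \<omega> t $ i) = (\<Sum>t\<in>S \<union> T. ?c t * \<omega> t $ i)"
    "(\<Sum>t\<in>T. d t * \<omega> t $ i) = (\<Sum>t\<in>S \<union> T. ?d t * \<omega> t $ i)" for \<omega> :: "real \<Rightarrow> real ^ 'a"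
    using S(1) T(1) by (auto intro!: sum.mono_neutral_cong_left)
  then have "(\<lambda>\<omega>. Y \<omega> + Z \<omega>) = (\<lambda>\<omega>. \<Sum>t\<in>S \<union> T. (?c t + ?d t) * \<omega> t $ i)"
    unfolding S(2) T(2) by (simp add: sum.distrib[symmetric] distrib_right)
  then show ?thesis unfolding lincomb_def using S(1) T(1) by (intro exI[of _ "S \<union> T"] exI) auto
qed

lemma lincomb_diff [intro]: "lincomb i Y \<Longrightarrow> lincomb i Z \<Longrightarrow> lincomb i (\<lambda>\<omega>. Y \<omega> - Z \<omega>)"
  using lincomb_add[OF _ lincomb_cmult[of i Z "-1"], of Y] by simp

lemma lincomb_sum: "(\<And>k. k \<in> I \<Longrightarrow> lincomb i (f k)) \<Longrightarrow> lincomb i (\<lambda>\<omega>. \<Sum>k\<in>I. f k \<omega>)"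
  by (induction I rule: infinite_finite_induct) auto

section \<open>Gaussian moments and decoupling of two coordinates\<close>

context canonical_fbm
begin

lemma space_P: "space P = holder_paths H"
  using sets_eq_imp_space_eq[OF sets_P]
  by (simp add: path_space_def space_restrict_space space_PiM)

lemma measurable_coord [measurable]: "(\<lambda>\<omega>. \<omega> t $ i) \<in> borel_measurable P"
  using gaussian[of "{(t, i)}" "\<lambda>_. 1"] by (simp add: gaussian_rv_def)

lemma lincomb_gaussian: "lincomb i Z \<Longrightarrow> gaussian_rv P Z"
  unfolding lincomb_def
proof (elim exE conjE)
  fix S c assume S: "finite S" "Z = (\<lambda>\<omega>. \<Sum>t\<in>S. c t * \<omega> t $ i)"
  have "Z = (\<lambda>\<omega>. \<Sum>(t, j)\<in>S \<times> {i}. (\<lambda>(t, j). c t) (t, j) * \<omega> t $ j)"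
    unfolding S(2) by (simp add: sum.cartesian_product[symmetric])
  then show "gaussian_rv P Z" using gaussian[of "S \<times> {i}" "\<lambda>(t, j). c t"] S(1) by simp
qed

lemma lincomb_measurable: "lincomb i Z \<Longrightarrow> Z \<in> borel_measurable P"
  using lincomb_gaussian by (auto simp: gaussian_rv_def)

lemma lincomb_expectation:
  assumes "lincomb i Z"
  shows "expectation Z = 0"
proof -
  obtain S c where S: "finite S" "Z = (\<lambda>\<omega>. \<Sum>t\<in>S. c t * \<omega> t $ i)"
    using assms unfolding lincomb_def by auto
  have "integrable P (\<lambda>\<omega>. \<omega> t $ i)" for t
    by (rule gaussian_rv_integrable[OF lincomb_gaussian[OF lincomb_eval]])
  then show ?thesis unfolding S(2) by (simp add: centered)
qed

lemma lincomb_square_integrable: "lincomb i Z \<Longrightarrow> integrable P (\<lambda>\<omega>. (Z \<omega>)\<^sup>2)"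
  by (intro gaussian_rv_square lincomb_gaussian lincomb_expectation)

text \<open>By polarisation, since \<open>Y + Z\<close> is square integrable as well.\<close>

lemma lincomb_mult_integrable:
  assumes "lincomb i Y" "lincomb i Z"
  shows "integrable P (\<lambda>\<omega>. Y \<omega> * Z \<omega>)"
proof -
  have "integrable P (\<lambda>\<omega>. ((Y \<omega> + Z \<omega>)\<^sup>2 - (Y \<omega>)\<^sup>2 - (Z \<omega>)\<^sup>2) / 2)"
    by (intro integrable_divide_zero Bochner_Integration.integrable_diff
        lincomb_square_integrable[OF assms(1)] lincomb_square_integrable[OF assms(2)]
        lincomb_square_integrable[OF lincomb_add[OF assms]])
  then show ?thesis by (simp add: power2_sum)
qed

lemma lincomb_moment:
  "lincomb i Z \<Longrightarrow>
    (\<integral>\<^sup>+\<omega>. ennreal (Z \<omega> ^ (2 * p)) \<partial>P) = ennreal (gauss_const p * expectation (\<lambda>\<omega>. (Z \<omega>)\<^sup>2) ^ p)"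
  by (intro gaussian_rv_square lincomb_gaussian lincomb_expectation)

lemma lincomb_square_sum:
  assumes "\<And>k. k \<in> I \<Longrightarrow> lincomb i (g k)"
  shows "expectation (\<lambda>\<omega>. (\<Sum>k\<in>I. x k * g k \<omega>)\<^sup>2) =
    (\<Sum>k\<in>I. \<Sum>l\<in>I. x k * x l * expectation (\<lambda>\<omega>. g k \<omega> * g l \<omega>))"
proof -
  have "expectation (\<lambda>\<omega>. (\<Sum>k\<in>I. x k * g k \<omega>)\<^sup>2) =
      expectation (\<lambda>\<omega>. \<Sum>k\<in>I. \<Sum>l\<in>I. x k * x l * (g k \<omega> * g l \<omega>))"
    by (simp add: power2_eq_square sum_product ac_simps)
  also have "\<dots> = (\<Sum>k\<in>I. expectation (\<lambda>\<omega>. \<Sum>l\<in>I. x k * x l * (g k \<omega> * g l \<omega>)))"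
    by (intro Bochner_Integration.integral_sum Bochner_Integration.integrable_sum integrable_mult_right
        lincomb_mult_integrable[OF assms assms])
  also have "\<dots> = (\<Sum>k\<in>I. \<Sum>l\<in>I. expectation (\<lambda>\<omega>. x k * x l * (g k \<omega> * g l \<omega>)))"
    by (intro sum.cong refl Bochner_Integration.integral_sum integrable_mult_right
        lincomb_mult_integrable[OF assms assms])
  finally show ?thesis by simp
qed

lemma expectation_increments:
  "expectation (\<lambda>\<omega>. (\<omega> v $ i - \<omega> u $ i) * (\<omega> z $ i - \<omega> w $ i)) = icov H u v w z"
proof -
  have int: "integrable P (\<lambda>\<omega>. \<omega> a $ i * \<omega> b $ i)" for a b
    by (rule lincomb_mult_integrable[OF lincomb_eval lincomb_eval])
  have "expectation (\<lambda>\<omega>. (\<omega> v $ i - \<omega> u $ i) * (\<omega> z $ i - \<omega> w $ i)) =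
      expectation (\<lambda>\<omega>. \<omega> v $ i * \<omega> z $ i - \<omega> v $ i * \<omega> w $ i - \<omega> u $ i * \<omega> z $ i + \<omega> u $ i * \<omega> w $ i)"
    by (simp add: algebra_simps)
  also have "\<dots> = fbm_cov H v z - fbm_cov H v w - fbm_cov H u z + fbm_cov H u w"
    using int by (simp add: covariance)
  also have "\<dots> = icov H u v w z" by (simp add: fbm_cov_def icov_def abs_minus_commute field_simps)
  finally show ?thesis .
qed

lemma indep_coords:
  assumes "i \<noteq> j"
  shows "indep_var (\<Pi>\<^sub>M t\<in>UNIV. borel) (\<lambda>\<omega> t. \<omega> t $ i) (\<Pi>\<^sub>M t\<in>UNIV. borel) (\<lambda>\<omega> t. \<omega> t $ j)"
proof -
  let ?N = "\<Pi>\<^sub>M t\<in>(UNIV :: real set). (borel :: real measure)"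
  have "indep_var ?N ((\<lambda>f. f i) \<circ> (\<lambda>\<omega>. \<lambda>k\<in>{i}. (\<lambda>t. \<omega> t $ k))) ?N ((\<lambda>f. f j) \<circ> (\<lambda>\<omega>. \<lambda>k\<in>{j}. (\<lambda>t. \<omega> t $ k)))"
    using assms by (intro indep_var_compose[OF indep_var_restrict[OF indep_components, of "{i}" "{j}"]]) auto
  then show ?thesis by (simp add: comp_def)
qed

text \<open>Independence makes the joint law a product, so by Tonelli's theorem coordinate
  \<open>j\<close> can be read off an independent copy \<open>\<omega>'\<close> of the path.\<close>

lemma nn_integral_indep_coords:
  assumes ij: "i \<noteq> j"
    and \<Phi> [measurable]: "\<Phi> \<in> borel_measurable ((\<Pi>\<^sub>M t\<in>UNIV. borel) \<Otimes>\<^sub>M (\<Pi>\<^sub>M t\<in>UNIV. borel))"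
  shows "(\<integral>\<^sup>+\<omega>. \<Phi> (\<lambda>t. \<omega> t $ i, \<lambda>t. \<omega> t $ j) \<partial>P) = (\<integral>\<^sup>+\<omega>. \<integral>\<^sup>+\<omega>'. \<Phi> (\<lambda>t. \<omega> t $ i, \<lambda>t. \<omega>' t $ j) \<partial>P \<partial>P)"
proof -
  let ?N = "\<Pi>\<^sub>M t\<in>(UNIV :: real set). (borel :: real measure)"
  let ?X = "\<lambda>i \<omega> t. \<omega> t $ i"
  note eq = indep_coords[OF ij, unfolded indep_var_distribution_eq]
  have rv [measurable]: "?X k \<in> measurable P ?N" if "k \<in> {i, j}" for k using eq that by auto
  interpret J: prob_space "distr P ?N (?X j)" using rv by (intro prob_space_distr) auto
  have "(\<integral>\<^sup>+\<omega>. \<Phi> (?X i \<omega>, ?X j \<omega>) \<partial>P) = (\<integral>\<^sup>+z. \<Phi> z \<partial>distr P (?N \<Otimes>\<^sub>M ?N) (\<lambda>\<omega>. (?X i \<omega>, ?X j \<omega>)))"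
    using rv by (subst nn_integral_distr) auto
  also have "\<dots> = (\<integral>\<^sup>+z. \<Phi> z \<partial>(distr P ?N (?X i) \<Otimes>\<^sub>M distr P ?N (?X j)))" using eq by simp
  also have "\<dots> = (\<integral>\<^sup>+u. \<integral>\<^sup>+v. \<Phi> (u, v) \<partial>distr P ?N (?X j) \<partial>distr P ?N (?X i))"
    by (rule J.nn_integral_fst[symmetric]) simp
  also have "\<dots> = (\<integral>\<^sup>+\<omega>. \<integral>\<^sup>+v. \<Phi> (?X i \<omega>, v) \<partial>distr P ?N (?X j) \<partial>P)"
    using rv J.borel_measurable_nn_integral_fst[of \<Phi> "?N"] by (subst nn_integral_distr) auto
  also have "\<dots> = (\<integral>\<^sup>+\<omega>. \<integral>\<^sup>+\<omega>'. \<Phi> (?X i \<omega>, ?X j \<omega>') \<partial>P \<partial>P)"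
    using rv by (intro nn_integral_cong nn_integral_distr) auto
  finally show ?thesis .
qed

lemma nn_integral_bilinear_split:
  assumes ij: "i \<noteq> j" and f: "\<And>k. k \<in> I \<Longrightarrow> lincomb i (f k)" and g: "\<And>k. k \<in> I \<Longrightarrow> lincomb j (g k)"
  shows "(\<integral>\<^sup>+\<omega>. ennreal ((\<Sum>k\<in>I. f k \<omega> * g k \<omega>) ^ n) \<partial>P) =
    (\<integral>\<^sup>+\<omega>. \<integral>\<^sup>+\<omega>'. ennreal ((\<Sum>k\<in>I. f k \<omega> * g k \<omega>') ^ n) \<partial>P \<partial>P)"
proof -
  obtain S c where S: "\<And>k. k \<in> I \<Longrightarrow> f k = (\<lambda>\<omega>. \<Sum>t\<in>S k. c k t * \<omega> t $ i)"
    using f unfolding lincomb_def by metis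
  obtain T d where T: "\<And>k. k \<in> I \<Longrightarrow> g k = (\<lambda>\<omega>. \<Sum>t\<in>T k. d k t * \<omega> t $ j)"
    using g unfolding lincomb_def by metis
  define \<Phi> where "\<Phi> = (\<lambda>(u, v). ennreal ((\<Sum>k\<in>I. (\<Sum>t\<in>S k. c k t * u t) * (\<Sum>t\<in>T k. d k t * v t)) ^ n))"
  have "\<Phi> \<in> borel_measurable ((\<Pi>\<^sub>M t\<in>UNIV. borel) \<Otimes>\<^sub>M (\<Pi>\<^sub>M t\<in>UNIV. borel))"
    unfolding \<Phi>_def by measurable
  from nn_integral_indep_coords[OF ij this] show ?thesis
    by (simp add: \<Phi>_def S T cong: sum.cong)
qed

text \<open>For fixed \<open>\<omega>\<close> the decoupled sum is a centred Gaussian variable in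
  \<open>\<omega>'\<close> whose variance is the quadratic form in \<open>quad\<close>. The constant
  is squared because Gaussian moments are taken twice: over \<open>\<omega>'\<close>, and then over
  \<open>\<omega>\<close> for the variables \<open>h m\<close>.\<close>

lemma bilinear_moment:
  fixes w B :: "'i \<Rightarrow> real"
  assumes ij: "i \<noteq> j" and p: "1 \<le> p"
    and f: "\<And>k. k \<in> I \<Longrightarrow> lincomb i (f k)" and g: "\<And>k. k \<in> I \<Longrightarrow> lincomb j (g k)"
    and J: "finite J" and w: "\<And>m. m \<in> J \<Longrightarrow> 0 \<le> w m" and B: "\<And>m. m \<in> J \<Longrightarrow> 0 < B m"
    and h: "\<And>m. m \<in> J \<Longrightarrow> lincomb i (h m)"
    and hB: "\<And>m. m \<in> J \<Longrightarrow> expectation (\<lambda>\<omega>. (h m \<omega>)\<^sup>2) \<le> B m"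
    and quad: "\<And>\<omega>. (\<Sum>k\<in>I. \<Sum>l\<in>I. f k \<omega> * f l \<omega> * expectation (\<lambda>\<omega>. g k \<omega> * g l \<omega>)) \<le> (\<Sum>m\<in>J. w m * (h m \<omega>)\<^sup>2)"
  shows "(\<integral>\<^sup>+\<omega>. ennreal ((\<Sum>k\<in>I. f k \<omega> * g k \<omega>) ^ (2 * p)) \<partial>P) \<le>
    ennreal ((gauss_const p)\<^sup>2 * (\<Sum>m\<in>J. w m * B m) ^ p)"
proof -
  have gc: "0 \<le> gauss_const p" using gauss_const_pos[of p] by simp
  have [measurable]: "h m \<in> borel_measurable P" if "m \<in> J" for m using h[OF that] by (rule lincomb_measurable)
  have inner: "(\<integral>\<^sup>+\<omega>'. ennreal ((\<Sum>k\<in>I. f k \<omega> * g k \<omega>') ^ (2 * p)) \<partial>P) \<le>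
      ennreal (gauss_const p) * ennreal ((\<Sum>m\<in>J. w m * (h m \<omega>)\<^sup>2) ^ p)" for \<omega>
  proof -
    have lc: "lincomb j (\<lambda>\<omega>'. \<Sum>k\<in>I. f k \<omega> * g k \<omega>')" by (intro lincomb_sum lincomb_cmult g)
    let ?E = "expectation (\<lambda>\<omega>'. (\<Sum>k\<in>I. f k \<omega> * g k \<omega>')\<^sup>2)"
    have "?E \<le> (\<Sum>m\<in>J. w m * (h m \<omega>)\<^sup>2)"
      using quad[of \<omega>] lincomb_square_sum[OF g, where x="\<lambda>k. f k \<omega>"] by simp
    moreover have "0 \<le> ?E" by simp
    ultimately have "gauss_const p * ?E ^ p \<le> gauss_const p * (\<Sum>m\<in>J. w m * (h m \<omega>)\<^sup>2) ^ p"
      using gc by (intro mult_left_mono power_mono) auto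
    then show ?thesis unfolding lincomb_moment[OF lc] ennreal_mult'[OF gc, symmetric] by (rule ennreal_leI)
  qed
  have "(\<integral>\<^sup>+\<omega>. ennreal ((\<Sum>k\<in>I. f k \<omega> * g k \<omega>) ^ (2 * p)) \<partial>P) =
      (\<integral>\<^sup>+\<omega>. \<integral>\<^sup>+\<omega>'. ennreal ((\<Sum>k\<in>I. f k \<omega> * g k \<omega>') ^ (2 * p)) \<partial>P \<partial>P)"
    by (intro nn_integral_bilinear_split[OF ij] f g)
  also have "\<dots> \<le> (\<integral>\<^sup>+\<omega>. ennreal (gauss_const p) * ennreal ((\<Sum>m\<in>J. w m * (h m \<omega>)\<^sup>2) ^ p) \<partial>P)"
    by (intro nn_integral_mono inner)
  also have "\<dots> = ennreal (gauss_const p) * (\<integral>\<^sup>+\<omega>. ennreal ((\<Sum>m\<in>J. w m * (h m \<omega>)\<^sup>2) ^ p) \<partial>P)"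
    by (intro nn_integral_cmult) measurable
  also have "\<dots> \<le> ennreal (gauss_const p) * ennreal (gauss_const p * (\<Sum>m\<in>J. w m * B m) ^ p)"
  proof (intro mult_left_mono moment_sum_squares J w B p gc)
    fix m assume m: "m \<in> J"
    show "(\<integral>\<^sup>+\<omega>. ennreal (h m \<omega> ^ (2 * p)) \<partial>P) \<le> ennreal (gauss_const p * B m ^ p)"
      unfolding lincomb_moment[OF h[OF m]]
      using hB[OF m] gc by (intro ennreal_leI mult_left_mono power_mono) auto
  qed auto
  also have "\<dots> = ennreal ((gauss_const p)\<^sup>2 * (\<Sum>m\<in>J. w m * B m) ^ p)"
    using gc by (simp add: ennreal_mult'[symmetric] power2_eq_square mult.assoc)
  finally show ?thesis .
qed

end

text \<open>Polarisation \<open>x k * x l = ((x k)\<^sup>2 + (x l)\<^sup>2 - (x k - x l)\<^sup>2) /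
  2\<close>; by symmetry the first two squares combine into row sums.\<close>

lemma quad_form_eq:
  fixes c :: "'i \<Rightarrow> 'i \<Rightarrow> real"
  assumes I: "finite I" and sym: "\<And>k l. c k l = c l k"
  shows "(\<Sum>k\<in>I. \<Sum>l\<in>I. x k * x l * c k l) =
    (\<Sum>k\<in>I. (\<Sum>l\<in>I. c k l) * (x k)\<^sup>2 + (\<Sum>l\<in>I - {k}. (- c k l / 2) * (x k - x l)\<^sup>2))"
proof -
  have pt: "x k * x l * c k l = c k l * (x k)\<^sup>2 / 2 + c k l * (x l)\<^sup>2 / 2 + (- c k l / 2) * (x k - x l)\<^sup>2" for k l
    by (simp add: power2_eq_square field_simps)
  have swap: "(\<Sum>k\<in>I. \<Sum>l\<in>I. c k l * (x l)\<^sup>2 / 2) = (\<Sum>k\<in>I. \<Sum>l\<in>I. c k l * (x k)\<^sup>2 / 2)"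
    by (subst sum.swap) (simp add: sym)
  have rem: "(\<Sum>l\<in>I. (- c k l / 2) * (x k - x l)\<^sup>2) = (\<Sum>l\<in>I - {k}. (- c k l / 2) * (x k - x l)\<^sup>2)" for k
    using I by (intro sum.mono_neutral_right) auto
  have "(\<Sum>k\<in>I. \<Sum>l\<in>I. x k * x l * c k l) = (\<Sum>k\<in>I. \<Sum>l\<in>I. c k l * (x k)\<^sup>2 / 2) +
      (\<Sum>k\<in>I. \<Sum>l\<in>I. c k l * (x l)\<^sup>2 / 2) + (\<Sum>k\<in>I. \<Sum>l\<in>I. (- c k l / 2) * (x k - x l)\<^sup>2)"
    unfolding pt sum.distrib ..
  also have "\<dots> = (\<Sum>k\<in>I. \<Sum>l\<in>I. c k l * (x k)\<^sup>2) + (\<Sum>k\<in>I. \<Sum>l\<in>I. (- c k l / 2) * (x k - x l)\<^sup>2)"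
    unfolding swap by (simp add: sum.distrib[symmetric])
  finally show ?thesis unfolding rem by (simp add: sum.distrib sum_distrib_right)
qed

text \<open>Interchanges integrand and integrator. The new coefficients are increments of
  \<open>g\<close> up to the right endpoint, so no boundary term remains.\<close>

lemma sum_by_parts:
  fixes x g :: "nat \<Rightarrow> real"
  assumes "x 0 = 0"
  shows "(\<Sum>k<n. x k * (g (Suc k) - g k)) = (\<Sum>k<n. (g n - g (Suc k)) * (x (Suc k) - x k))"
proof -
  have "(\<Sum>k<n. (g m - g (Suc k)) * (x (Suc k) - x k)) =
      (\<Sum>k<n. x k * (g (Suc k) - g k)) + (g m - g n) * x n" for m
    by (induction n) (use assms in \<open>auto simp: algebra_simps\<close>)
  from this[of n] show ?thesis by simp
qed

lemma even_power_add_le: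
  fixes x y :: real
  shows "(x + y) ^ (2 * p) \<le> 2 ^ (2 * p) * ((x ^ (2 * p) + y ^ (2 * p)) / 2)"
proof -
  have "((1 - 1 / 2) *\<^sub>R x + (1 / 2) *\<^sub>R y) ^ (2 * p) \<le> (1 - 1 / 2) * x ^ (2 * p) + (1 / 2) * y ^ (2 * p)"
    by (rule convex_onD[OF convex_power_even]) auto
  then have "((x + y) / 2) ^ (2 * p) \<le> (x ^ (2 * p) + y ^ (2 * p)) / 2"
    by (simp add: field_simps)
  then show ?thesis by (simp add: power_divide pos_divide_le_eq mult.commute)
qed

lemma even_power_mean_le:
  fixes z :: "'a \<Rightarrow> real"
  assumes "finite A" "A \<noteq> {}"
  shows "((\<Sum>a\<in>A. z a) / card A) ^ (2 * p) \<le> (\<Sum>a\<in>A. z a ^ (2 * p)) / card A"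
proof -
  have "(\<Sum>a\<in>A. (1 / card A) *\<^sub>R z a) ^ (2 * p) \<le> (\<Sum>a\<in>A. (1 / card A) * z a ^ (2 * p))"
    using assms by (intro convex_on_sum[OF _ _ convex_power_even]) auto
  then show ?thesis by (simp add: sum_divide_distrib)
qed

lemma (in prob_space) moment_add_le:
  assumes [measurable]: "Y \<in> borel_measurable M" "Z \<in> borel_measurable M"
    and Y: "(\<integral>\<^sup>+x. ennreal (Y x ^ (2 * p)) \<partial>M) \<le> ennreal C" and Z: "(\<integral>\<^sup>+x. ennreal (Z x ^ (2 * p)) \<partial>M) \<le> ennreal C"
    and C: "0 \<le> C"
  shows "(\<integral>\<^sup>+x. ennreal ((Y x + Z x) ^ (2 * p)) \<partial>M) \<le> ennreal (2 ^ (2 * p) * C)"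
proof -
  have "(\<integral>\<^sup>+x. ennreal ((Y x + Z x) ^ (2 * p)) \<partial>M) \<le>
      (\<integral>\<^sup>+x. ennreal (2 ^ (2 * p) / 2) * (ennreal (Y x ^ (2 * p)) + ennreal (Z x ^ (2 * p))) \<partial>M)"
  proof (intro nn_integral_mono)
    fix x
    have "ennreal ((Y x + Z x) ^ (2 * p)) \<le> ennreal (2 ^ (2 * p) / 2 * (Y x ^ (2 * p) + Z x ^ (2 * p)))"
      using even_power_add_le[of "Y x" "Z x" p] by (intro ennreal_leI) simp
    also have "\<dots> = ennreal (2 ^ (2 * p) / 2) * (ennreal (Y x ^ (2 * p)) + ennreal (Z x ^ (2 * p)))"
      by (subst ennreal_mult', simp, subst ennreal_plus) (auto simp: zero_le_even_power)
    finally show "ennreal ((Y x + Z x) ^ (2 * p)) \<le>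
        ennreal (2 ^ (2 * p) / 2) * (ennreal (Y x ^ (2 * p)) + ennreal (Z x ^ (2 * p)))" .
  qed
  also have "\<dots> = ennreal (2 ^ (2 * p) / 2) *
      ((\<integral>\<^sup>+x. ennreal (Y x ^ (2 * p)) \<partial>M) + (\<integral>\<^sup>+x. ennreal (Z x ^ (2 * p)) \<partial>M))"
    by (subst nn_integral_cmult) (auto simp: nn_integral_add)
  also have "\<dots> \<le> ennreal (2 ^ (2 * p) / 2) * (ennreal C + ennreal C)"
    by (intro mult_left_mono add_mono Y Z) auto
  also have "\<dots> = ennreal (2 ^ (2 * p) * C)"
    using C by (simp add: ennreal_plus[symmetric] ennreal_mult'[symmetric] del: ennreal_plus)
  finally show ?thesis .
qed

lemma (in prob_space) moment_mean_le:
  assumes A: "finite A" "A \<noteq> {}" and [measurable]: "\<And>a. a \<in> A \<Longrightarrow> Z a \<in> borel_measurable M"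
    and Z: "\<And>a. a \<in> A \<Longrightarrow> (\<integral>\<^sup>+x. ennreal (Z a x ^ (2 * p)) \<partial>M) \<le> C"
  shows "(\<integral>\<^sup>+x. ennreal (((\<Sum>a\<in>A. Z a x) / card A) ^ (2 * p)) \<partial>M) \<le> C"
proof -
  have cA: "0 < card A" using A by (simp add: card_gt_0_iff)
  have "(\<integral>\<^sup>+x. ennreal (((\<Sum>a\<in>A. Z a x) / card A) ^ (2 * p)) \<partial>M) \<le>
      (\<integral>\<^sup>+x. ennreal (1 / card A) * (\<Sum>a\<in>A. ennreal (Z a x ^ (2 * p))) \<partial>M)"
  proof (intro nn_integral_mono)
    fix x
    have "ennreal (((\<Sum>a\<in>A. Z a x) / card A) ^ (2 * p)) \<le> ennreal (1 / card A * (\<Sum>a\<in>A. Z a x ^ (2 * p)))"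
      using even_power_mean_le[OF A, of "\<lambda>a. Z a x" p] by (intro ennreal_leI) simp
    also have "\<dots> = ennreal (1 / card A) * (\<Sum>a\<in>A. ennreal (Z a x ^ (2 * p)))"
      by (subst sum_ennreal) (auto simp: ennreal_mult'[symmetric] zero_le_even_power)
    finally show "ennreal (((\<Sum>a\<in>A. Z a x) / card A) ^ (2 * p)) \<le> ennreal (1 / card A) * (\<Sum>a\<in>A. ennreal (Z a x ^ (2 * p)))" .
  qed
  also have "\<dots> = ennreal (1 / card A) * (\<Sum>a\<in>A. \<integral>\<^sup>+x. ennreal (Z a x ^ (2 * p)) \<partial>M)"
    by (subst nn_integral_cmult) (auto simp: nn_integral_sum simp del: sum_ennreal)
  also have "\<dots> \<le> ennreal (1 / card A) * (\<Sum>a\<in>A. C)"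
    by (intro mult_left_mono sum_mono Z) auto
  also have "\<dots> = (ennreal (1 / card A) * of_nat (card A)) * C" by (simp add: mult.assoc)
  also have "ennreal (1 / card A) * of_nat (card A) = 1"
    using cA by (simp add: ennreal_of_nat_eq_real_of_nat ennreal_mult'[symmetric])
  finally show ?thesis by simp
qed

text \<open>Fatou's lemma: moment bounds that hold uniformly along Riemann sums pass to the
  pointwise limit.\<close>

lemma nn_integral_fatou_le:
  fixes f :: "nat \<Rightarrow> 'a \<Rightarrow> real"
  assumes [measurable]: "\<And>n. f n \<in> borel_measurable M"
    and lim: "AE x in M. (\<lambda>n. f n x) \<longlonglongrightarrow> g x"
    and le: "eventually (\<lambda>n. (\<integral>\<^sup>+x. ennreal (f n x ^ p) \<partial>M) \<le> C) sequentially"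
  shows "(\<integral>\<^sup>+x. ennreal (g x ^ p) \<partial>M) \<le> C"
proof -
  have "(\<integral>\<^sup>+x. ennreal (g x ^ p) \<partial>M) = (\<integral>\<^sup>+x. liminf (\<lambda>n. ennreal (f n x ^ p)) \<partial>M)"
  proof (intro nn_integral_cong_AE, use lim in eventually_elim)
    fix x assume "(\<lambda>n. f n x) \<longlonglongrightarrow> g x"
    then have "(\<lambda>n. ennreal (f n x ^ p)) \<longlonglongrightarrow> ennreal (g x ^ p)"
      by (intro tendsto_ennrealI tendsto_power)
    then show "ennreal (g x ^ p) = liminf (\<lambda>n. ennreal (f n x ^ p))"
      by (simp add: lim_imp_Liminf)
  qed
  also have "\<dots> \<le> liminf (\<lambda>n. \<integral>\<^sup>+x. ennreal (f n x ^ p) \<partial>M)"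
    by (intro nn_integral_liminf) simp
  also have "\<dots> \<le> liminf (\<lambda>n. C)" using le by (intro Liminf_mono) simp
  finally show ?thesis by (simp add: Liminf_const)
qed

section \<open>Moment bounds for bilinear forms in the increments\<close>

context canonical_fbm
begin

lemma lincomb_increment: "lincomb i (\<lambda>\<omega>. \<omega> v $ i - \<omega> u $ i)"
  by (intro lincomb_diff lincomb_eval)

lemma expectation_increment_square:
  "0 < H \<Longrightarrow> expectation (\<lambda>\<omega>. (\<omega> v $ i - \<omega> u $ i)\<^sup>2) = \<bar>v - u\<bar> powr (2 * H)"
  using expectation_increments[of v i u v u] by (simp add: power2_eq_square icov_self)

text \<open>The squares of \<open>f k\<close> and of \<open>f k - f l\<close> form one family over
  \<open>I \<times> I\<close>, with \<open>k = l\<close> standing for the former. The common shift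
  \<open>r\<close> of the integrator disappears by stationarity of the increments.\<close>

lemma fbm_bilinear_moment:
  fixes I :: "'i set" and a b :: "'i \<Rightarrow> real" and B :: "'i \<Rightarrow> 'i \<Rightarrow> real"
  assumes ij: "i \<noteq> j" and p: "1 \<le> p" and I: "finite I" and f: "\<And>k. k \<in> I \<Longrightarrow> lincomb i (f k)"
    and row: "\<And>k. k \<in> I \<Longrightarrow> 0 \<le> (\<Sum>l\<in>I. icov H (a k) (b k) (a l) (b l))"
    and off: "\<And>k l. k \<in> I \<Longrightarrow> l \<in> I \<Longrightarrow> k \<noteq> l \<Longrightarrow> icov H (a k) (b k) (a l) (b l) \<le> 0"
    and B: "\<And>k l. k \<in> I \<Longrightarrow> l \<in> I \<Longrightarrow> 0 < B k l"
    and fB: "\<And>k. k \<in> I \<Longrightarrow> expectation (\<lambda>\<omega>. (f k \<omega>)\<^sup>2) \<le> B k k"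
    and fB2: "\<And>k l. k \<in> I \<Longrightarrow> l \<in> I \<Longrightarrow> k \<noteq> l \<Longrightarrow> expectation (\<lambda>\<omega>. (f k \<omega> - f l \<omega>)\<^sup>2) \<le> B k l"
  shows "(\<integral>\<^sup>+\<omega>. ennreal ((\<Sum>k\<in>I. f k \<omega> * (\<omega> (b k + r) $ j - \<omega> (a k + r) $ j)) ^ (2 * p)) \<partial>P) \<le>
    ennreal ((gauss_const p)\<^sup>2 * (\<Sum>k\<in>I. (\<Sum>l\<in>I. icov H (a k) (b k) (a l) (b l)) * B k k +
      (\<Sum>l\<in>I - {k}. (- icov H (a k) (b k) (a l) (b l) / 2) * B k l)) ^ p)"
proof -
  let ?c = "\<lambda>k l. icov H (a k) (b k) (a l) (b l)"
  define w where "w = (\<lambda>(k, l). if k = l then (\<Sum>l\<in>I. ?c k l) else - ?c k l / 2)"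
  define h where "h = (\<lambda>(k, l) \<omega>. if k = l then f k \<omega> else f k \<omega> - f l \<omega>)"
  have split: "(\<Sum>m\<in>I \<times> I. w m * z m) =
      (\<Sum>k\<in>I. (\<Sum>l\<in>I. ?c k l) * z (k, k) + (\<Sum>l\<in>I - {k}. (- ?c k l / 2) * z (k, l)))" for z
  proof -
    have "(\<Sum>l\<in>I. w (k, l) * z (k, l)) =
        (\<Sum>l\<in>I. ?c k l) * z (k, k) + (\<Sum>l\<in>I - {k}. (- ?c k l / 2) * z (k, l))" if k: "k \<in> I" for k
      by (subst sum.remove[OF I k], intro arg_cong2[where f="(+)"] sum.cong) (auto simp: w_def)
    then show ?thesis unfolding sum.cartesian_product[symmetric, of "\<lambda>k l. w (k, l) * z (k, l)" I I, simplified]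
      by (simp cong: sum.cong)
  qed
  have "(\<integral>\<^sup>+\<omega>. ennreal ((\<Sum>k\<in>I. f k \<omega> * (\<omega> (b k + r) $ j - \<omega> (a k + r) $ j)) ^ (2 * p)) \<partial>P) \<le>
    ennreal ((gauss_const p)\<^sup>2 * (\<Sum>m\<in>I \<times> I. w m * (\<lambda>(k, l). B k l) m) ^ p)"
  proof (rule bilinear_moment[OF ij p f lincomb_increment])
    show "0 \<le> w m" if "m \<in> I \<times> I" for m using that row off by (auto simp: w_def)
    show "0 < (\<lambda>(k, l). B k l) m" if "m \<in> I \<times> I" for m using that B by auto
    show "lincomb i (h m)" if "m \<in> I \<times> I" for m
      using that f by (cases "fst m = snd m") (auto simp: h_def intro!: lincomb_diff)
    show "expectation (\<lambda>\<omega>. (h m \<omega>)\<^sup>2) \<le> (\<lambda>(k, l). B k l) m" if "m \<in> I \<times> I" for m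
      using that fB fB2 by (cases "fst m = snd m") (auto simp: h_def)
    show "(\<Sum>k\<in>I. \<Sum>l\<in>I. f k \<omega> * f l \<omega> * expectation (\<lambda>\<omega>. (\<omega> (b k + r) $ j - \<omega> (a k + r) $ j) *
        (\<omega> (b l + r) $ j - \<omega> (a l + r) $ j))) \<le> (\<Sum>m\<in>I \<times> I. w m * (h m \<omega>)\<^sup>2)" for \<omega>
      unfolding expectation_increments icov_shift split
      by (subst quad_form_eq[OF I], rule icov_sym, intro eq_refl sum.cong arg_cong2[where f="(+)"])
        (auto simp: h_def)
  qed (use I in auto)
  then show ?thesis unfolding split by simp
qed

text \<open>A discrete Young estimate in mean square. The row sums add up to
  \<open>(t - s) powr (2 * H)\<close> by telescoping; off the diagonal, the regularity of order
  \<open>\<alpha>\<close> of \<open>f\<close> compensates the singularity of the covariance.\<close>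

lemma grid_moment:
  assumes H: "0 < H" "H \<le> 1 / 2" and \<alpha>: "0 < \<alpha>" "\<alpha> \<le> 1 / 2" and big: "1 < 2 * \<alpha> + 2 * H"
    and ij: "i \<noteq> j" and p: "1 \<le> p" and st: "s < t" and n: "0 < n" and K: "0 < K"
    and f: "\<And>k. k < n \<Longrightarrow> lincomb i (f k)"
    and fB: "\<And>k. k < n \<Longrightarrow> expectation (\<lambda>\<omega>. (f k \<omega>)\<^sup>2) \<le> K * (t - s) powr (2 * \<alpha>)"
    and fB2: "\<And>k l. k < n \<Longrightarrow> l < n \<Longrightarrow>
      expectation (\<lambda>\<omega>. (f k \<omega> - f l \<omega>)\<^sup>2) \<le> K * \<bar>grid s t n k - grid s t n l\<bar> powr (2 * \<alpha>)"
  shows "(\<integral>\<^sup>+\<omega>. ennreal ((\<Sum>k<n. f k \<omega> * (\<omega> (grid s t n (Suc k) + r) $ j - \<omega> (grid s t n k + r) $ j)) ^ (2 * p)) \<partial>P)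
    \<le> ennreal ((gauss_const p)\<^sup>2 * (K * (1 + young_const \<alpha> H) * (t - s) powr (2 * \<alpha> + 2 * H)) ^ p)"
proof -
  let ?u = "grid s t n"
  let ?c = "\<lambda>k l. icov H (?u k) (?u (Suc k)) (?u l) (?u (Suc l))"
  \<comment> \<open>The diagonal bounds \<open>f k\<close> itself, the other entries differences of
    \<open>f\<close>; all of them are positive, as the normalisation in Jensen's inequality
    requires.\<close>
  define B where "B k l = (if k = l then K * (t - s) powr (2 * \<alpha>) else K * \<bar>?u k - ?u l\<bar> powr (2 * \<alpha>))" for k l
  have mono: "?u k \<le> ?u l" if "k \<le> l" for k l using st that by (intro grid_mono) auto
  have neq: "?u k \<noteq> ?u l" if "k \<noteq> l" for k l
    using st n that grid_strict_mono[of s t k l n] grid_strict_mono[of s t l k n] by (cases "k < l") auto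
  have row: "(\<Sum>l<n. ?c k l) = icov H (?u k) (?u (Suc k)) s t" for k
    using icov_telescope[of H "?u k" "?u (Suc k)" ?u n] n by simp
  have row0: "0 \<le> icov H (?u k) (?u (Suc k)) s t" if "k < n" for k
    using that st n H by (intro icov_subinterval_nonneg mono) (auto intro: grid_ge grid_le)
  have off: "?c k l \<le> 0" if "k \<noteq> l" for k l
    using that H by (intro icov_disjoint_nonpos mono) (auto intro!: mono)
  have "(\<integral>\<^sup>+\<omega>. ennreal ((\<Sum>k<n. f k \<omega> * (\<omega> (?u (Suc k) + r) $ j - \<omega> (?u k + r) $ j)) ^ (2 * p)) \<partial>P) \<le>
    ennreal ((gauss_const p)\<^sup>2 * (\<Sum>k<n. (\<Sum>l<n. ?c k l) * B k k + (\<Sum>l\<in>{..<n} - {k}. (- ?c k l / 2) * B k l)) ^ p)"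
  proof (rule fbm_bilinear_moment[OF ij p])
    show "0 < B k l" for k l using K st neq[of k l] by (auto simp: B_def)
  qed (use f fB fB2 row row0 off in \<open>auto simp: B_def\<close>)
  also have "\<dots> \<le> ennreal ((gauss_const p)\<^sup>2 * (K * (1 + young_const \<alpha> H) * (t - s) powr (2 * \<alpha> + 2 * H)) ^ p)"
  proof (intro ennreal_leI mult_left_mono power_mono)
    let ?S = "\<Sum>k<n. (\<Sum>l<n. ?c k l) * B k k + (\<Sum>l\<in>{..<n} - {k}. (- ?c k l / 2) * B k l)"
    show "0 \<le> ?S"
      unfolding row using row0 off K by (intro sum_nonneg add_nonneg_nonneg mult_nonneg_nonneg) (auto simp: B_def)
    have "?S = (\<Sum>k<n. icov H (?u k) (?u (Suc k)) s t) * (K * (t - s) powr (2 * \<alpha>)) +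
        (\<Sum>k<n. \<Sum>l\<in>{..<n} - {k}. (- ?c k l / 2) * B k l)"
      unfolding row by (simp add: B_def sum.distrib sum_distrib_right)
    also have "(\<Sum>k<n. icov H (?u k) (?u (Suc k)) s t) = (t - s) powr (2 * H)"
      unfolding icov_sym[of H _ _ s t] using icov_telescope[of H s t ?u n] n st H by (simp add: icov_self)
    also have "(\<Sum>k<n. \<Sum>l\<in>{..<n} - {k}. (- ?c k l / 2) * B k l) =
        K / 2 * (\<Sum>k<n. \<Sum>l\<in>{..<n} - {k}. \<bar>?u k - ?u l\<bar> powr (2 * \<alpha>) * (- ?c k l))"
      unfolding sum_distrib_left by (intro sum.cong refl) (auto simp: B_def)
    also have "\<dots> \<le> K / 2 * (young_const \<alpha> H * (t - s) powr (2 * \<alpha> + 2 * H))"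
      using K by (intro mult_left_mono sum_grid_icov_le H \<alpha> big st n) auto
    also have "\<dots> \<le> K * (young_const \<alpha> H * (t - s) powr (2 * \<alpha> + 2 * H))"
      using K big by (intro mult_right_mono) (auto simp: young_const_def)
    finally have "?S \<le> (t - s) powr (2 * H) * (K * (t - s) powr (2 * \<alpha>)) +
        K * (young_const \<alpha> H * (t - s) powr (2 * \<alpha> + 2 * H))" by simp
    also have "\<dots> = K * (1 + young_const \<alpha> H) * (t - s) powr (2 * \<alpha> + 2 * H)"
      by (simp add: powr_add algebra_simps)
    finally show "?S \<le> K * (1 + young_const \<alpha> H) * (t - s) powr (2 * \<alpha> + 2 * H)" .
  qed simp
  finally show ?thesis .
qed

lemma expectation_diff_square_le:
  assumes "lincomb i Y" "lincomb i Z"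
  shows "expectation (\<lambda>\<omega>. (Y \<omega> - Z \<omega>)\<^sup>2) \<le> 2 * expectation (\<lambda>\<omega>. (Y \<omega>)\<^sup>2) + 2 * expectation (\<lambda>\<omega>. (Z \<omega>)\<^sup>2)"
proof -
  have "expectation (\<lambda>\<omega>. (Y \<omega> - Z \<omega>)\<^sup>2) \<le> expectation (\<lambda>\<omega>. 2 * (Y \<omega>)\<^sup>2 + 2 * (Z \<omega>)\<^sup>2)"
  proof (intro integral_mono)
    fix \<omega>
    have "0 \<le> (Y \<omega> + Z \<omega>)\<^sup>2" by simp
    then show "(Y \<omega> - Z \<omega>)\<^sup>2 \<le> 2 * (Y \<omega>)\<^sup>2 + 2 * (Z \<omega>)\<^sup>2"
      by (simp add: power2_eq_square algebra_simps)
  qed (use assms in \<open>auto intro!: lincomb_square_integrable Bochner_Integration.integrable_add integrable_mult_right\<close>)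
  then show ?thesis using assms by (simp add: lincomb_square_integrable)
qed

text \<open>Two groupings of the same four values: for \<open>|u - v| \<le> \<delta>\<close> into
  increments over distance \<open>|u - v|\<close>, otherwise into increments over distance
  \<open>a \<le> \<delta>\<close>. In either case the length to the power \<open>2 * H\<close> is
  split into a power of \<open>\<delta>\<close> and one of \<open>|u - v|\<close>.\<close>

lemma shift_difference_square:
  assumes H: "0 < H" and \<alpha>: "0 < \<alpha>" "\<alpha> \<le> H" and a: "0 \<le> a" "a \<le> \<delta>" and \<delta>: "0 < \<delta>"
  shows "expectation (\<lambda>\<omega>. ((\<omega> (u + a) $ i - \<omega> u $ i) - (\<omega> (v + a) $ i - \<omega> v $ i))\<^sup>2)
    \<le> 4 * \<delta> powr (2 * H - 2 * \<alpha>) * \<bar>u - v\<bar> powr (2 * \<alpha>)" (is "?E \<le> _")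
proof (cases "\<bar>u - v\<bar> \<le> \<delta>")
  case True
  have "?E = expectation (\<lambda>\<omega>. ((\<omega> (u + a) $ i - \<omega> (v + a) $ i) - (\<omega> u $ i - \<omega> v $ i))\<^sup>2)"
    by (simp add: algebra_simps)
  also have "\<dots> \<le> 4 * \<bar>u - v\<bar> powr (2 * H)"
    using expectation_diff_square_le[OF lincomb_increment[where i=i] lincomb_increment[where i=i], of "u + a" "v + a" u v]
    by (simp add: expectation_increment_square[OF H])
  also have "\<bar>u - v\<bar> powr (2 * H) = \<bar>u - v\<bar> powr (2 * H - 2 * \<alpha>) * \<bar>u - v\<bar> powr (2 * \<alpha>)"
    by (simp add: powr_add[symmetric])
  also have "\<dots> \<le> \<delta> powr (2 * H - 2 * \<alpha>) * \<bar>u - v\<bar> powr (2 * \<alpha>)"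
    using True \<alpha> by (intro mult_right_mono powr_mono2) auto
  finally show ?thesis by simp
next
  case False
  have "?E \<le> 4 * a powr (2 * H)"
    using expectation_diff_square_le[OF lincomb_increment[where i=i] lincomb_increment[where i=i], of "u + a" u "v + a" v] a
    by (simp add: expectation_increment_square[OF H])
  also have "a powr (2 * H) \<le> \<delta> powr (2 * H)" using a H by (intro powr_mono2) auto
  also have "\<delta> powr (2 * H) = \<delta> powr (2 * H - 2 * \<alpha>) * \<delta> powr (2 * \<alpha>)"
    by (simp add: powr_add[symmetric])
  also have "\<dots> \<le> \<delta> powr (2 * H - 2 * \<alpha>) * \<bar>u - v\<bar> powr (2 * \<alpha>)"
    using False \<alpha> \<delta> by (intro mult_left_mono powr_mono2) auto
  finally show ?thesis by simp
qed

end

section \<open>Moments of mollified areas\<close>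

lemma area_refl: "area \<delta> x y s s = 0"
  by (simp add: area_def)

context canonical_fbm
begin

lemma path_continuous: "\<omega> \<in> space P \<Longrightarrow> continuous_on UNIV \<omega>"
  by (simp add: space_P holder_paths_def)

lemma coord_continuous: "\<omega> \<in> space P \<Longrightarrow> continuous_on UNIV (\<lambda>r. \<omega> r $ i)"
  by (intro continuous_on_component path_continuous)

lemma avg_measurable:
  assumes "0 < \<delta>"
  shows "(\<lambda>\<omega>. avg \<delta> (\<lambda>r. \<omega> r $ i) t) \<in> borel_measurable P"
  by (rule borel_measurable_LIMSEQ_real[OF avg_limit[OF coord_continuous assms]]) measurable

lemma area_measurable:
  assumes \<delta>: "0 < \<delta>" and st: "s \<le> t"
  shows "(\<lambda>\<omega>. area \<delta> (\<lambda>r. \<omega> r $ i) (\<lambda>r. \<omega> r $ j) s t) \<in> borel_measurable P"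
proof (cases "s < t")
  case True
  note avg_measurable[OF \<delta>, measurable]
  show ?thesis
    by (rule borel_measurable_LIMSEQ_real[OF area_limit[OF coord_continuous coord_continuous True]]) measurable
next
  case False
  then show ?thesis using st by (simp add: area_refl)
qed

text \<open>The mollified increments are averages of the increments of the shifted paths, so by
  convexity every moment bound that is uniform in the shifts is inherited.\<close>

lemma mollified_moment:
  fixes I :: "'i set" and u v a b :: "'i \<Rightarrow> real" and Z :: "(real \<Rightarrow> real ^ 'd) \<Rightarrow> real"
  assumes \<delta>: "0 < \<delta>" and Z [measurable]: "Z \<in> borel_measurable P"
    and bound: "\<And>x y. x \<in> {0..\<delta>} \<Longrightarrow> y \<in> {0..\<delta>} \<Longrightarrow>
      (\<integral>\<^sup>+\<omega>. ennreal (((\<Sum>k\<in>I. (\<omega> (v k + x) $ i - \<omega> (u k + x) $ i) * (\<omega> (b k + y) $ j - \<omega> (a k + y) $ j)) - Z \<omega>) ^ (2 * p)) \<partial>P) \<le> C"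
  shows "(\<integral>\<^sup>+\<omega>. ennreal (((\<Sum>k\<in>I. (avg \<delta> (\<lambda>r. \<omega> r $ i) (v k) - avg \<delta> (\<lambda>r. \<omega> r $ i) (u k)) *
      (avg \<delta> (\<lambda>r. \<omega> r $ j) (b k) - avg \<delta> (\<lambda>r. \<omega> r $ j) (a k))) - Z \<omega>) ^ (2 * p)) \<partial>P) \<le> C"
proof (rule nn_integral_fatou_le)
  define T where "T = (\<lambda>x y \<omega>. (\<Sum>k\<in>I. (\<omega> (v k + x) $ i - \<omega> (u k + x) $ i) * (\<omega> (b k + y) $ j - \<omega> (a k + y) $ j)) - Z \<omega>)"
  \<comment> \<open>The two coordinates are shifted independently, because a product of two averages
    is an average over pairs of shifts.\<close>
  define A where "A n = {..<n} \<times> {..<n :: nat}" for n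
  define f where "f n \<omega> = (\<Sum>z\<in>A n. T (grid 0 \<delta> n (fst z)) (grid 0 \<delta> n (snd z)) \<omega>) / card (A n)" for n \<omega>
  have T_meas [measurable]: "T x y \<in> borel_measurable P" for x y unfolding T_def by measurable
  show "f n \<in> borel_measurable P" for n unfolding f_def by measurable
  show "\<forall>\<^sub>F n in sequentially. (\<integral>\<^sup>+\<omega>. ennreal (f n \<omega> ^ (2 * p)) \<partial>P) \<le> C"
    using eventually_gt_at_top[of 0]
  proof eventually_elim
    case (elim n)
    show ?case unfolding f_def
    proof (rule moment_mean_le)
      show "finite (A n)" "A n \<noteq> {}" using elim by (auto simp: A_def)
      fix z assume z: "z \<in> A n"
      have "grid 0 \<delta> n k \<in> {0..\<delta>}" if "k < n" for k
        using grid_ge[of 0 \<delta> n k] grid_le[of 0 \<delta> k n] \<delta> elim that by auto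
      then show "(\<integral>\<^sup>+\<omega>. ennreal (T (grid 0 \<delta> n (fst z)) (grid 0 \<delta> n (snd z)) \<omega> ^ (2 * p)) \<partial>P) \<le> C"
        unfolding T_def using z by (intro bound) (auto simp: A_def)
    qed simp
  qed
  show "AE \<omega> in P. (\<lambda>n. f n \<omega>) \<longlonglongrightarrow> (\<Sum>k\<in>I. (avg \<delta> (\<lambda>r. \<omega> r $ i) (v k) - avg \<delta> (\<lambda>r. \<omega> r $ i) (u k)) *
      (avg \<delta> (\<lambda>r. \<omega> r $ j) (b k) - avg \<delta> (\<lambda>r. \<omega> r $ j) (a k))) - Z \<omega>"
  proof (rule AE_I2)
    fix \<omega> assume \<omega>: "\<omega> \<in> space P"
    define m where "m i t n = (\<Sum>x<n. \<omega> (t + grid 0 \<delta> n x) $ i) / real n" for i t n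
    have m: "m i t \<longlonglongrightarrow> avg \<delta> (\<lambda>r. \<omega> r $ i) t" for i t
      unfolding m_def[abs_def] by (intro avg_limit coord_continuous \<omega> \<delta>)
    have "(\<lambda>n. (\<Sum>k\<in>I. (m i (v k) n - m i (u k) n) * (m j (b k) n - m j (a k) n)) - Z \<omega>) \<longlonglongrightarrow>
      (\<Sum>k\<in>I. (avg \<delta> (\<lambda>r. \<omega> r $ i) (v k) - avg \<delta> (\<lambda>r. \<omega> r $ i) (u k)) *
      (avg \<delta> (\<lambda>r. \<omega> r $ j) (b k) - avg \<delta> (\<lambda>r. \<omega> r $ j) (a k))) - Z \<omega>"
      by (intro tendsto_intros m)
    moreover have "\<forall>\<^sub>F n in sequentially. (\<Sum>k\<in>I. (m i (v k) n - m i (u k) n) * (m j (b k) n - m j (a k) n)) - Z \<omega> = f n \<omega>"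
      using eventually_gt_at_top[of 0]
    proof eventually_elim
      case (elim n)
      let ?g = "grid 0 \<delta> n"
      have prod: "(\<Sum>z\<in>A n. F (fst z) * G (snd z)) = (\<Sum>x<n. F x) * (\<Sum>y<n. G y)" for F G :: "nat \<Rightarrow> real"
        unfolding A_def sum_product sum.cartesian_product by (simp add: split_def)
      have md: "m i t n - m i r n = (\<Sum>x<n. \<omega> (t + ?g x) $ i - \<omega> (r + ?g x) $ i) / real n" for i t r
        by (simp add: m_def sum_subtractf diff_divide_distrib)
      have card: "real (card (A n)) = real n * real n" by (simp add: A_def)
      have "f n \<omega> = ((\<Sum>z\<in>A n. \<Sum>k\<in>I. (\<omega> (v k + ?g (fst z)) $ i - \<omega> (u k + ?g (fst z)) $ i) *
          (\<omega> (b k + ?g (snd z)) $ j - \<omega> (a k + ?g (snd z)) $ j)) - real (card (A n)) * Z \<omega>) / card (A n)"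
        by (simp add: f_def T_def sum_subtractf)
      also have "\<dots> = (\<Sum>z\<in>A n. \<Sum>k\<in>I. (\<omega> (v k + ?g (fst z)) $ i - \<omega> (u k + ?g (fst z)) $ i) *
          (\<omega> (b k + ?g (snd z)) $ j - \<omega> (a k + ?g (snd z)) $ j)) / (real n * real n) - Z \<omega>"
        unfolding card using elim by (simp add: diff_divide_distrib)
      also have "(\<Sum>z\<in>A n. \<Sum>k\<in>I. (\<omega> (v k + ?g (fst z)) $ i - \<omega> (u k + ?g (fst z)) $ i) *
          (\<omega> (b k + ?g (snd z)) $ j - \<omega> (a k + ?g (snd z)) $ j)) =
          (\<Sum>k\<in>I. (\<Sum>x<n. \<omega> (v k + ?g x) $ i - \<omega> (u k + ?g x) $ i) * (\<Sum>y<n. \<omega> (b k + ?g y) $ j - \<omega> (a k + ?g y) $ j))"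
        by (subst sum.swap) (intro sum.cong refl prod)
      also have "\<dots> / (real n * real n) = (\<Sum>k\<in>I. (m i (v k) n - m i (u k) n) * (m j (b k) n - m j (a k) n))"
        unfolding md by (simp only: sum_divide_distrib[of _ I] times_divide_times_eq)
      finally show ?case by simp
    qed
    ultimately show "(\<lambda>n. f n \<omega>) \<longlonglongrightarrow> (\<Sum>k\<in>I. (avg \<delta> (\<lambda>r. \<omega> r $ i) (v k) - avg \<delta> (\<lambda>r. \<omega> r $ i) (u k)) *
      (avg \<delta> (\<lambda>r. \<omega> r $ j) (b k) - avg \<delta> (\<lambda>r. \<omega> r $ j) (a k))) - Z \<omega>"
      by (rule Lim_transform_eventually)
  qed
qed

definition riem :: "'d \<Rightarrow> 'd \<Rightarrow> nat \<Rightarrow> real \<Rightarrow> real \<Rightarrow> real \<Rightarrow> real \<Rightarrow> (real \<Rightarrow> real ^ 'd) \<Rightarrow> real" where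
  "riem i j n a b s t \<omega> = (\<Sum>k<n. (\<omega> (grid s t n k + a) $ i - \<omega> (s + a) $ i) *
    (\<omega> (grid s t n (Suc k) + b) $ j - \<omega> (grid s t n k + b) $ j))"

lemma riem_measurable [measurable]: "riem i j n a b s t \<in> borel_measurable P"
  unfolding riem_def[abs_def] by measurable

text \<open>The bound of \<open>grid_moment\<close> on an interval of length \<open>r\<close> for
  the constant \<open>K = 4 * \<delta> powr (2 * H - 2 * \<alpha>)\<close> of
  \<open>shift_difference_square\<close>.\<close>

definition shift_bound :: "real \<Rightarrow> nat \<Rightarrow> real \<Rightarrow> real \<Rightarrow> real" where
  "shift_bound \<alpha> p \<delta> r = (gauss_const p)\<^sup>2 *
    (4 * \<delta> powr (2 * H - 2 * \<alpha>) * (1 + young_const \<alpha> H) * r powr (2 * \<alpha> + 2 * H)) ^ p"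

lemma shift_bound_nonneg: "1 < 2 * \<alpha> + 2 * H \<Longrightarrow> 0 \<le> shift_bound \<alpha> p \<delta> r"
  unfolding shift_bound_def
  by (intro mult_nonneg_nonneg zero_le_power add_nonneg_nonneg) (auto simp: young_const_def less_imp_le[OF gauss_const_pos])

text \<open>The shifts are removed one at a time. Removing \<open>a\<close> leaves a sum whose
  integrand is a shift difference of coordinate \<open>i\<close>. Removing \<open>b\<close> puts the
  shift difference into the integrator; summation by parts makes it the integrand, with the
  coordinates exchanged, and \<open>grid_moment\<close> applies again.\<close>

lemma riem_shift_moment:
  assumes H: "0 < H" "H \<le> 1 / 2" and \<alpha>: "0 < \<alpha>" "\<alpha> \<le> H" and big: "1 < 2 * \<alpha> + 2 * H"
    and ij: "i \<noteq> j" and p: "1 \<le> p" and st: "s < t" and n: "0 < n" and \<delta>: "0 < \<delta>"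
    and ab: "a \<in> {0..\<delta>}" "b \<in> {0..\<delta>}"
  shows "(\<integral>\<^sup>+\<omega>. ennreal ((riem i j n a b s t \<omega> - riem i j n 0 0 s t \<omega>) ^ (2 * p)) \<partial>P) \<le>
    ennreal (2 ^ (2 * p) * shift_bound \<alpha> p \<delta> (t - s))"
proof -
  let ?u = "grid s t n"
  let ?K = "4 * \<delta> powr (2 * H - 2 * \<alpha>)"
  define F where "F a i u v \<omega> = (\<omega> (u + a) $ i - \<omega> u $ i) - (\<omega> (v + a) $ i - \<omega> v $ i)"
    for a i u v and \<omega> :: "real \<Rightarrow> real ^ 'd"
  have lc: "lincomb i (F a i u v)" for a i u v
    unfolding F_def by (intro lincomb_diff lincomb_eval)
  have sq: "expectation (\<lambda>\<omega>. (F a i u v \<omega>)\<^sup>2) \<le> ?K * \<bar>u - v\<bar> powr (2 * \<alpha>)" if "a \<in> {0..\<delta>}" for a i u v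
    unfolding F_def using that by (intro shift_difference_square H \<alpha> \<delta>) auto
  have sq': "expectation (\<lambda>\<omega>. (F a i u v \<omega>)\<^sup>2) \<le> ?K * (t - s) powr (2 * \<alpha>)"
    if a: "a \<in> {0..\<delta>}" and uv: "\<bar>u - v\<bar> \<le> t - s" for a i u v
  proof -
    have "\<bar>u - v\<bar> powr (2 * \<alpha>) \<le> (t - s) powr (2 * \<alpha>)" using uv \<alpha> by (intro powr_mono2) auto
    then show ?thesis by (intro order_trans[OF sq[OF a]] mult_left_mono) auto
  qed
  have diff: "F a i u v \<omega> - F a i u' v \<omega> = F a i u u' \<omega>" "F a i v u \<omega> - F a i v u' \<omega> = F a i u' u \<omega>" for a i u u' v \<omega>
    by (simp_all add: F_def)
  have u: "s \<le> ?u k" "?u k \<le> t" if "k \<le> n" for k using that st n grid_ge grid_le by (auto simp: less_imp_le)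
  have K: "0 < ?K" using \<delta> by simp
  have \<alpha>': "\<alpha> \<le> 1 / 2" using \<alpha> H by simp
  have 1: "(\<integral>\<^sup>+\<omega>. ennreal ((riem i j n a b s t \<omega> - riem i j n 0 b s t \<omega>) ^ (2 * p)) \<partial>P) \<le> ennreal (shift_bound \<alpha> p \<delta> (t - s))"
  proof -
    have eq: "riem i j n a b s t \<omega> - riem i j n 0 b s t \<omega> =
        (\<Sum>k<n. F a i (?u k) s \<omega> * (\<omega> (?u (Suc k) + b) $ j - \<omega> (?u k + b) $ j))" for \<omega>
      unfolding riem_def sum_subtractf[symmetric] F_def by (intro sum.cong refl) (simp add: algebra_simps)
    show ?thesis unfolding eq shift_bound_def
    proof (rule grid_moment[OF H \<alpha>(1) \<alpha>' big ij p st n K lc])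
      show "expectation (\<lambda>\<omega>. (F a i (?u k) s \<omega>)\<^sup>2) \<le> ?K * (t - s) powr (2 * \<alpha>)" if "k < n" for k
        using u[of k] that by (intro sq' ab) auto
      show "expectation (\<lambda>\<omega>. (F a i (?u k) s \<omega> - F a i (?u l) s \<omega>)\<^sup>2) \<le> ?K * \<bar>?u k - ?u l\<bar> powr (2 * \<alpha>)" for k l
        unfolding diff by (intro sq ab)
    qed
  qed
  have 2: "(\<integral>\<^sup>+\<omega>. ennreal ((riem i j n 0 b s t \<omega> - riem i j n 0 0 s t \<omega>) ^ (2 * p)) \<partial>P) \<le> ennreal (shift_bound \<alpha> p \<delta> (t - s))"
  proof -
    have eq: "riem i j n 0 b s t \<omega> - riem i j n 0 0 s t \<omega> =
        (\<Sum>k<n. F b j t (?u (Suc k)) \<omega> * (\<omega> (?u (Suc k) + 0) $ i - \<omega> (?u k + 0) $ i))" for \<omega>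
    proof -
      have "riem i j n 0 b s t \<omega> - riem i j n 0 0 s t \<omega> =
          (\<Sum>k<n. (\<omega> (?u k) $ i - \<omega> s $ i) * ((\<omega> (?u (Suc k) + b) $ j - \<omega> (?u (Suc k)) $ j) - (\<omega> (?u k + b) $ j - \<omega> (?u k) $ j)))"
        unfolding riem_def sum_subtractf[symmetric] by (intro sum.cong refl) (simp add: algebra_simps)
      also have "\<dots> = (\<Sum>k<n. ((\<omega> (?u n + b) $ j - \<omega> (?u n) $ j) - (\<omega> (?u (Suc k) + b) $ j - \<omega> (?u (Suc k)) $ j)) *
          ((\<omega> (?u (Suc k)) $ i - \<omega> s $ i) - (\<omega> (?u k) $ i - \<omega> s $ i)))"
        by (rule sum_by_parts[where g="\<lambda>k. \<omega> (?u k + b) $ j - \<omega> (?u k) $ j"]) simp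
      finally show ?thesis using n by (simp add: F_def)
    qed
    show ?thesis unfolding eq shift_bound_def
    proof (rule grid_moment[OF H \<alpha>(1) \<alpha>' big ij[symmetric] p st n K lc])
      show "expectation (\<lambda>\<omega>. (F b j t (?u (Suc k)) \<omega>)\<^sup>2) \<le> ?K * (t - s) powr (2 * \<alpha>)" if "k < n" for k
        using u[of "Suc k"] that by (intro sq' ab) auto
      fix k l
      have "\<bar>?u (Suc l) - ?u (Suc k)\<bar> = \<bar>?u k - ?u l\<bar>" unfolding grid_diff abs_mult by auto
      then show "expectation (\<lambda>\<omega>. (F b j t (?u (Suc k)) \<omega> - F b j t (?u (Suc l)) \<omega>)\<^sup>2) \<le> ?K * \<bar>?u k - ?u l\<bar> powr (2 * \<alpha>)"
        unfolding diff using sq[OF ab(2), of j "?u (Suc l)" "?u (Suc k)"] by simp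
    qed
  qed
  from moment_add_le[OF _ _ 1 2 shift_bound_nonneg[OF big]] show ?thesis by simp
qed

text \<open>The unmollified Riemann sum on the same grid is the reference for both scales; only its
  distance to the mollified sums matters, and that is bounded uniformly in \<open>n\<close>. Each of
  the two triangle inequalities, here and in \<open>riem_shift_moment\<close>, contributes
  \<open>2 ^ (2 * p)\<close>.\<close>

lemma area_diff_moment:
  assumes H: "0 < H" "H \<le> 1 / 2" and \<alpha>: "0 < \<alpha>" "\<alpha> \<le> H" and big: "1 < 2 * \<alpha> + 2 * H"
    and ij: "i \<noteq> j" and p: "1 \<le> p" and st: "s < t" and \<delta>: "0 < \<delta>\<^sub>1" "\<delta>\<^sub>1 \<le> \<delta>" "0 < \<delta>\<^sub>2" "\<delta>\<^sub>2 \<le> \<delta>"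
  shows "(\<integral>\<^sup>+\<omega>. ennreal ((area \<delta>\<^sub>1 (\<lambda>r. \<omega> r $ i) (\<lambda>r. \<omega> r $ j) s t - area \<delta>\<^sub>2 (\<lambda>r. \<omega> r $ i) (\<lambda>r. \<omega> r $ j) s t) ^ (2 * p)) \<partial>P)
    \<le> ennreal (2 ^ (4 * p) * shift_bound \<alpha> p \<delta> (t - s))"
proof -
  define S where "S d n \<omega> = (\<Sum>k<n. (avg d (\<lambda>r. \<omega> r $ i) (grid s t n k) - avg d (\<lambda>r. \<omega> r $ i) s) *
      (avg d (\<lambda>r. \<omega> r $ j) (grid s t n (Suc k)) - avg d (\<lambda>r. \<omega> r $ j) (grid s t n k)))"
    for d n and \<omega> :: "real \<Rightarrow> real ^ 'd"
  have S_meas [measurable]: "S d n \<in> borel_measurable P" if "0 < d" for d n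
  proof -
    note avg_measurable[OF that, measurable]
    show ?thesis unfolding S_def by measurable
  qed
  have nonneg: "0 \<le> shift_bound \<alpha> p \<delta> (t - s)" by (rule shift_bound_nonneg[OF big])
  have bd: "(\<integral>\<^sup>+\<omega>. ennreal ((S d n \<omega> - riem i j n 0 0 s t \<omega>) ^ (2 * p)) \<partial>P) \<le> ennreal (2 ^ (2 * p) * shift_bound \<alpha> p \<delta> (t - s))"
    if d: "0 < d" "d \<le> \<delta>" and n: "0 < n" for d n
    unfolding S_def
  proof (rule mollified_moment[OF d(1)])
    fix x y assume "x \<in> {0..d}" "y \<in> {0..d}"
    then show "(\<integral>\<^sup>+\<omega>. ennreal (((\<Sum>k<n. (\<omega> (grid s t n k + x) $ i - \<omega> (s + x) $ i) *
        (\<omega> (grid s t n (Suc k) + y) $ j - \<omega> (grid s t n k + y) $ j)) - riem i j n 0 0 s t \<omega>) ^ (2 * p)) \<partial>P)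
        \<le> ennreal (2 ^ (2 * p) * shift_bound \<alpha> p \<delta> (t - s))"
      using riem_shift_moment[OF H \<alpha> big ij p st n, of \<delta> x y] d by (simp add: riem_def)
  qed measurable
  show ?thesis
  proof (rule nn_integral_fatou_le)
    show "(\<lambda>\<omega>. S \<delta>\<^sub>1 n \<omega> - S \<delta>\<^sub>2 n \<omega>) \<in> borel_measurable P" for n using \<delta> by measurable
    show "AE \<omega> in P. (\<lambda>n. S \<delta>\<^sub>1 n \<omega> - S \<delta>\<^sub>2 n \<omega>) \<longlonglongrightarrow>
        area \<delta>\<^sub>1 (\<lambda>r. \<omega> r $ i) (\<lambda>r. \<omega> r $ j) s t - area \<delta>\<^sub>2 (\<lambda>r. \<omega> r $ i) (\<lambda>r. \<omega> r $ j) s t"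
      unfolding S_def by (intro AE_I2 tendsto_diff area_limit coord_continuous st)
    show "\<forall>\<^sub>F n in sequentially. (\<integral>\<^sup>+\<omega>. ennreal ((S \<delta>\<^sub>1 n \<omega> - S \<delta>\<^sub>2 n \<omega>) ^ (2 * p)) \<partial>P) \<le>
        ennreal (2 ^ (4 * p) * shift_bound \<alpha> p \<delta> (t - s))"
      using eventually_gt_at_top[of 0]
    proof eventually_elim
      case (elim n)
      let ?R = "riem i j n 0 0 s t"
      have "(\<integral>\<^sup>+\<omega>. ennreal ((- (S \<delta>\<^sub>2 n \<omega> - ?R \<omega>)) ^ (2 * p)) \<partial>P) \<le> ennreal (2 ^ (2 * p) * shift_bound \<alpha> p \<delta> (t - s))"
      proof -
        have even: "(- x) ^ (2 * p) = x ^ (2 * p)" for x :: real by simp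
        show ?thesis unfolding even by (rule bd[OF \<delta>(3,4) elim])
      qed
      from moment_add_le[OF _ _ bd[OF \<delta>(1,2) elim] this] nonneg \<delta>
      have "(\<integral>\<^sup>+\<omega>. ennreal (((S \<delta>\<^sub>1 n \<omega> - ?R \<omega>) + - (S \<delta>\<^sub>2 n \<omega> - ?R \<omega>)) ^ (2 * p)) \<partial>P) \<le>
          ennreal (2 ^ (2 * p) * (2 ^ (2 * p) * shift_bound \<alpha> p \<delta> (t - s)))" by simp
      also have "2 ^ (2 * p) * (2 ^ (2 * p) * shift_bound \<alpha> p \<delta> (t - s)) = 2 ^ (4 * p) * shift_bound \<alpha> p \<delta> (t - s)"
        by (simp add: power_add[symmetric] mult.assoc[symmetric])
      finally show ?case by simp
    qed
  qed
qed

end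

section \<open>Covariances over the cells of a division\<close>

lemma division_cell:
  fixes s t :: real
  assumes D: "D division_of {s..t}" and K: "K \<in> D"
  shows "K = {Inf K..Sup K}" "Inf K \<le> Sup K" "s \<le> Inf K" "Sup K \<le> t"
proof -
  obtain u v where uv: "K = {u..v}" using division_ofD(4)[OF D K] by force
  have "u \<le> v" using division_ofD(3)[OF D K] uv by auto
  moreover have "{u..v} \<subseteq> {s..t}" using division_ofD(2)[OF D K] uv by simp
  ultimately show "K = {Inf K..Sup K}" "Inf K \<le> Sup K" "s \<le> Inf K" "Sup K \<le> t" using uv by auto
qed

text \<open>A division is an unordered set of cells; tagging each cell by its left endpoint reduces
  the telescoping to additivity over tagged divisions.\<close>

lemma sum_division_increments:
  fixes f :: "real \<Rightarrow> real"
  assumes D: "D division_of {s..t}" and st: "s \<le> t"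
  shows "(\<Sum>K\<in>D. f (Sup K) - f (Inf K)) = f t - f s"
proof -
  let ?p = "(\<lambda>K. (Inf K, K)) ` D"
  have fin: "finite D" using D by auto
  have "?p tagged_division_of {s..t}"
  proof (rule tagged_division_ofI)
    show "finite ?p" using fin by simp
    fix x K assume "(x, K) \<in> ?p"
    then have K: "K \<in> D" "x = Inf K" by auto
    note c = division_cell[OF D K(1)]
    show "x \<in> K" using c(1,2) K(2) by (metis atLeastAtMost_iff order_refl)
    show "K \<subseteq> {s..t}" using division_ofD(2)[OF D K(1)] .
    show "\<exists>a b. K = cbox a b" using c(1) by auto
    fix y L assume "(y, L) \<in> ?p" "(x, K) \<noteq> (y, L)"
    then show "interior K \<inter> interior L = {}" using K division_ofD(5)[OF D K(1), of L] by auto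
  next
    have "{K. \<exists>x. (x, K) \<in> ?p} = D" by auto
    then show "\<Union>{K. \<exists>x. (x, K) \<in> ?p} = {s..t}" using division_ofD(6)[OF D] by simp
  qed
  from additive_tagged_division_1[OF st this, of f] show ?thesis
    by (subst (asm) sum.reindex) (auto simp: inj_on_def)
qed

lemma sum_division_icov:
  assumes "D division_of {s..t}" "s \<le> t"
  shows "(\<Sum>K\<in>D. icov H u v (Inf K) (Sup K)) = icov H u v s t"
proof -
  \<comment> \<open>For fixed \<open>u\<close> and \<open>v\<close> the covariance is an increment
    of \<open>?G\<close>, hence additive over the cells.\<close>
  let ?G = "\<lambda>z. (\<bar>u - z\<bar> powr (2 * H) - \<bar>v - z\<bar> powr (2 * H)) / 2"
  have "icov H u v a b = ?G b - ?G a" for a b by (simp add: icov_def field_simps)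
  then show ?thesis using sum_division_increments[OF assms, of ?G] by simp
qed

lemma nondegenerate_cells_ordered:
  fixes s t :: real
  assumes D: "D division_of {s..t}" and K: "K \<in> D" "Inf K < Sup K" and L: "L \<in> D" "Inf L < Sup L" and "K \<noteq> L"
  shows "Sup K \<le> Inf L \<or> Sup L \<le> Inf K"
proof (rule ccontr)
  assume "\<not> ?thesis"
  then have *: "Inf L < Sup K" "Inf K < Sup L" by auto
  have "interior K \<inter> interior L = {}" using division_ofD(5)[OF D K(1) L(1)] \<open>K \<noteq> L\<close> by simp
  moreover have "interior K = {Inf K<..<Sup K}" "interior L = {Inf L<..<Sup L}"
    by (subst division_cell(1)[OF D K(1)], rule interior_atLeastAtMost_real)
      (subst division_cell(1)[OF D L(1)], rule interior_atLeastAtMost_real)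
  moreover obtain m where "max (Inf K) (Inf L) < m" "m < min (Sup K) (Sup L)"
    using dense[of "max (Inf K) (Inf L)" "min (Sup K) (Sup L)"] K L * by auto
  ultimately have "m \<in> interior K \<inter> interior L" "interior K \<inter> interior L = {}" by auto
  then show False by auto
qed

text \<open>A row of the covariance matrix sums to the covariance with the increment over the whole
  interval, which is nonnegative; so the off-diagonal part of row \<open>K\<close> is at most
  \<open>len K\<close> in absolute value. Degenerate cells are removed because they may lie inside
  other cells, which destroys the ordering of the cells.\<close>

lemma sum_division_cross_terms:
  assumes H: "0 < H" "H \<le> 1 / 2" and D: "D division_of {s..t}" and st: "s \<le> t"
  defines "D' \<equiv> {K \<in> D. Inf K < Sup K}"
  defines "len \<equiv> \<lambda>K. (Sup K - Inf K) powr (2 * H)"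
  shows "(\<Sum>K\<in>D'. \<Sum>L\<in>D' - {K}. (- icov H (Inf K) (Sup K) (Inf L) (Sup L)) * (len K + len L)) \<le>
    2 * (\<Sum>K\<in>D'. (len K)\<^sup>2)" (is ?A)
    and "K \<in> D' \<Longrightarrow> icov H (Inf K) (Sup K) s t \<le> len K" (is "_ \<Longrightarrow> ?B")
    and "(\<Sum>L\<in>D'. icov H u v (Inf L) (Sup L)) = icov H u v s t"
proof -
  let ?c = "\<lambda>K L. icov H (Inf K) (Sup K) (Inf L) (Sup L)"
  have fin: "finite D" "finite D'" using D by (auto simp: D'_def)
  have D'D: "(\<Sum>L\<in>D'. icov H u v (Inf L) (Sup L)) = (\<Sum>L\<in>D. icov H u v (Inf L) (Sup L))" for u v
  proof (rule sum.mono_neutral_left[OF fin(1)])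
    show "\<forall>L\<in>D - D'. icov H u v (Inf L) (Sup L) = 0"
    proof
      fix L assume L: "L \<in> D - D'"
      then have "Inf L = Sup L" using division_cell(2)[OF D, of L] by (auto simp: D'_def)
      then show "icov H u v (Inf L) (Sup L) = 0" by (simp add: icov_def)
    qed
  qed (auto simp: D'_def)
  then show 3: "(\<Sum>L\<in>D'. icov H u v (Inf L) (Sup L)) = icov H u v s t" for u v
    using sum_division_icov[OF D st] by simp
  have self: "?c K K = len K" if "K \<in> D'" for K using that H by (simp add: icov_self len_def D'_def)
  have rest: "(\<Sum>L\<in>D' - {K}. - ?c K L) = len K - icov H (Inf K) (Sup K) s t" if "K \<in> D'" for K
    using 3[of "Inf K" "Sup K"] sum.remove[OF fin(2) that, of "?c K"] self[OF that] by (simp add: sum_negf)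
  have off: "?c K L \<le> 0" if "K \<in> D'" "L \<in> D'" "K \<noteq> L" for K L
    using nondegenerate_cells_ordered[OF D, of K L] that H
    by (intro icov_disjoint_nonpos) (auto simp: D'_def)
  have nn: "0 \<le> icov H (Inf K) (Sup K) s t" if "K \<in> D'" for K
    using division_cell[OF D, of K] that H by (intro icov_subinterval_nonneg) (auto simp: D'_def)
  show ?B if "K \<in> D'"
  proof -
    have "0 \<le> (\<Sum>L\<in>D' - {K}. - ?c K L)" using off that by (intro sum_nonneg) auto
    then show ?thesis using rest[OF that] by simp
  qed
  have split: "(\<Sum>L\<in>D' - {K}. f L) = (\<Sum>L\<in>D'. if L = K then 0 else f L)" for f :: "real set \<Rightarrow> real" and K
    using fin by (intro sum.mono_neutral_cong_left) auto
  have swap: "(\<Sum>K\<in>D'. \<Sum>L\<in>D' - {K}. - ?c K L * len L) = (\<Sum>K\<in>D'. \<Sum>L\<in>D' - {K}. - ?c K L * len K)"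
    unfolding split by (subst sum.swap) (intro sum.cong refl, auto simp: icov_sym)
  have "(\<Sum>K\<in>D'. \<Sum>L\<in>D' - {K}. - ?c K L * (len K + len L)) = 2 * (\<Sum>K\<in>D'. \<Sum>L\<in>D' - {K}. - ?c K L * len K)"
    unfolding distrib_left sum.distrib using swap by simp
  also have "\<dots> = 2 * (\<Sum>K\<in>D'. (len K - icov H (Inf K) (Sup K) s t) * len K)"
    unfolding sum_distrib_right[symmetric] using rest by simp
  also have "\<dots> \<le> 2 * (\<Sum>K\<in>D'. (len K)\<^sup>2)"
    using nn by (intro mult_left_mono sum_mono) (auto simp: power2_eq_square len_def intro!: mult_right_mono)
  finally show ?A .
qed

section \<open>Second moments of sums over cells\<close>

context canonical_fbm
begin

text \<open>All cells enter a single bilinear form, indexed by a cell and a grid point in it. In the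
  constant, \<open>young_const H H\<close> comes from pairs within one cell, and \<open>3\<close>
  from the row sums (one) and the pairs in different cells (two).\<close>

lemma cell_sums_moment:
  assumes H: "0 < H" "H \<le> 1 / 2" and big: "1 < 4 * H" and ij: "i \<noteq> j" and n: "0 < n"
    and D: "D division_of {s..t}" and st: "s < t"
  shows "(\<integral>\<^sup>+\<omega>. ennreal ((\<Sum>K\<in>{K \<in> D. Inf K < Sup K}. riem i j n a b (Inf K) (Sup K) \<omega>)\<^sup>2) \<partial>P)
    \<le> ennreal ((3 + young_const H H) * (\<Sum>K\<in>D. (Sup K - Inf K) powr (4 * H)))"
proof -
  define D' where "D' = {K \<in> D. Inf K < Sup K}"
  define len where "len K = (Sup K - Inf K) powr (2 * H)" for K :: "real set"
  define g where "g K k = grid (Inf K) (Sup K) n k" for K k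
  define I where "I = D' \<times> {..<n}"
  define cc where "cc = (\<lambda>x y. icov H (g (fst x) (snd x)) (g (fst x) (Suc (snd x))) (g (fst y) (snd y)) (g (fst y) (Suc (snd y))))"
  \<comment> \<open>Within one cell the base point cancels in differences of \<open>f\<close>,
    leaving an increment; across cells the square of a difference is bounded by twice the sum of the
    squares.\<close>
  define B where "B x y = (if fst x = fst y then (if snd x = snd y then len (fst x) else \<bar>g (fst x) (snd x) - g (fst x) (snd y)\<bar> powr (2 * H))
    else 2 * (len (fst x) + len (fst y)))" for x y :: "real set \<times> nat"
  define f where "f x \<omega> = \<omega> (g (fst x) (snd x) + a) $ i - \<omega> (Inf (fst x) + a) $ i" for x and \<omega> :: "real \<Rightarrow> real ^ 'd"
  have fin: "finite D'" "finite I" using D by (auto simp: D'_def I_def)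
  have cell: "Inf K < Sup K" "s \<le> Inf K" "Sup K \<le> t" if "K \<in> D'" for K
    using that division_cell[OF D, of K] by (auto simp: D'_def)
  have g_mono: "g K k \<le> g K l" if "K \<in> D'" "k \<le> l" for K k l
    unfolding g_def using cell[OF that(1)] that by (intro grid_mono) auto
  have g_le: "g K k \<le> Sup K" if "K \<in> D'" "k \<le> n" for K k
    unfolding g_def using cell[OF that(1)] that n by (intro grid_le) auto
  have g_ge: "Inf K \<le> g K k" if "K \<in> D'" for K k
    unfolding g_def using cell[OF that] by (intro grid_ge) auto
  have g_neq: "g K k \<noteq> g K l" if "K \<in> D'" "k \<noteq> l" for K k l
    using grid_strict_mono[OF cell(1)[OF that(1)] _ n, of k l] grid_strict_mono[OF cell(1)[OF that(1)] _ n, of l k] that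
    by (cases "k < l") (auto simp: g_def)
  have ordered: "Sup K \<le> Inf L \<or> Sup L \<le> Inf K" if "K \<in> D'" "L \<in> D'" "K \<noteq> L" for K L
    using nondegenerate_cells_ordered[OF D, of K L] that by (auto simp: D'_def)
  have tele: "(\<Sum>l<n. icov H u v (g L l) (g L (Suc l))) = icov H u v (Inf L) (Sup L)" for u v L
    using icov_telescope[of H u v "g L" n] n by (simp add: g_def)
  have len0: "0 < len K" if "K \<in> D'" for K using cell[OF that] by (simp add: len_def)
  have row: "(\<Sum>y\<in>I. cc x y) = icov H (g (fst x) (snd x)) (g (fst x) (Suc (snd x))) s t" if "x \<in> I" for x
  proof -
    have "(\<Sum>y\<in>I. cc x y) = (\<Sum>L\<in>D'. \<Sum>l<n. icov H (g (fst x) (snd x)) (g (fst x) (Suc (snd x))) (g L l) (g L (Suc l)))"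
      unfolding I_def sum.cartesian_product by (simp add: cc_def split_def)
    then show ?thesis unfolding tele using sum_division_cross_terms(3)[OF H D less_imp_le[OF st]] by (simp add: D'_def)
  qed
  have row0: "0 \<le> icov H (g (fst x) (snd x)) (g (fst x) (Suc (snd x))) s t" if "x \<in> I" for x
  proof -
    have x: "fst x \<in> D'" "Suc (snd x) \<le> n" using that by (auto simp: I_def)
    show ?thesis
      using g_ge[OF x(1), of "snd x"] g_le[OF x] g_mono[OF x(1), of "snd x" "Suc (snd x)"] cell[OF x(1)] H
      by (intro icov_subinterval_nonneg) auto
  qed
  have off: "cc x y \<le> 0" if xy: "x \<in> I" "y \<in> I" "x \<noteq> y" for x y
  proof -
    have x: "fst x \<in> D'" "Suc (snd x) \<le> n" and y: "fst y \<in> D'" "Suc (snd y) \<le> n" using xy by (auto simp: I_def)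
    have "g (fst x) (Suc (snd x)) \<le> g (fst y) (snd y) \<or> g (fst y) (Suc (snd y)) \<le> g (fst x) (snd x)"
    proof (cases "fst x = fst y")
      case True
      then have "snd x \<noteq> snd y" using xy by (simp add: prod_eq_iff)
      then have "Suc (snd x) \<le> snd y \<or> Suc (snd y) \<le> snd x" by linarith
      then show ?thesis using True g_mono x by metis
    next
      case False
      then show ?thesis
        using ordered[OF x(1) y(1)] g_le[OF x] g_le[OF y] g_ge[OF x(1), of "snd x"] g_ge[OF y(1), of "snd y"] by linarith
    qed
    then show ?thesis unfolding cc_def using H x y by (intro icov_disjoint_nonpos g_mono) auto
  qed
  have fsq: "expectation (\<lambda>\<omega>. (f x \<omega>)\<^sup>2) \<le> len (fst x)" if "x \<in> I" for x
  proof -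
    have x: "fst x \<in> D'" "snd x \<le> n" using that by (auto simp: I_def)
    have "expectation (\<lambda>\<omega>. (f x \<omega>)\<^sup>2) = \<bar>g (fst x) (snd x) - Inf (fst x)\<bar> powr (2 * H)"
      unfolding f_def by (simp add: expectation_increment_square[OF H(1)])
    also have "\<dots> \<le> len (fst x)" unfolding len_def
      using g_ge[OF x(1)] g_le[OF x] H by (intro powr_mono2) auto
    finally show ?thesis .
  qed
  have lcf: "lincomb i (f x)" for x unfolding f_def by (rule lincomb_increment)
  have fsq2: "expectation (\<lambda>\<omega>. (f x \<omega> - f y \<omega>)\<^sup>2) \<le> B x y" if xy: "x \<in> I" "y \<in> I" "x \<noteq> y" for x y
  proof (cases "fst x = fst y")
    case True
    then have "snd x \<noteq> snd y" using xy by (simp add: prod_eq_iff)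
    moreover have "f x \<omega> - f y \<omega> = \<omega> (g (fst x) (snd x) + a) $ i - \<omega> (g (fst x) (snd y) + a) $ i" for \<omega>
      using True by (simp add: f_def)
    ultimately show ?thesis using True by (simp add: B_def expectation_increment_square[OF H(1)])
  next
    case False
    then show ?thesis
      using expectation_diff_square_le[OF lcf[of x] lcf[of y]] fsq[OF xy(1)] fsq[OF xy(2)] by (simp add: B_def)
  qed
  have Bpos: "0 < B x y" if "x \<in> I" "y \<in> I" for x y
    using that len0[of "fst x"] len0[of "fst y"] g_neq[of "fst x" "snd x" "snd y"]
    by (auto simp: B_def I_def intro!: add_pos_pos)
  have "(\<integral>\<^sup>+\<omega>. ennreal ((\<Sum>x\<in>I. f x \<omega> * (\<omega> (g (fst x) (Suc (snd x)) + b) $ j - \<omega> (g (fst x) (snd x) + b) $ j)) ^ (2 * 1)) \<partial>P) \<le>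
    ennreal ((gauss_const 1)\<^sup>2 * (\<Sum>x\<in>I. (\<Sum>y\<in>I. cc x y) * B x x + (\<Sum>y\<in>I - {x}. (- cc x y / 2) * B x y)) ^ 1)"
    unfolding cc_def
  proof (rule fbm_bilinear_moment[OF ij _ fin(2) lcf])
  qed (use row row0 off Bpos fsq fsq2 in \<open>auto simp: B_def cc_def\<close>)
  moreover have "(\<Sum>x\<in>I. f x \<omega> * (\<omega> (g (fst x) (Suc (snd x)) + b) $ j - \<omega> (g (fst x) (snd x) + b) $ j)) =
      (\<Sum>K\<in>D'. riem i j n a b (Inf K) (Sup K) \<omega>)" for \<omega>
    unfolding riem_def I_def sum.cartesian_product by (simp add: f_def g_def split_def)
  moreover have "(\<Sum>x\<in>I. (\<Sum>y\<in>I. cc x y) * B x x + (\<Sum>y\<in>I - {x}. (- cc x y / 2) * B x y)) \<le>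
      (3 + young_const H H) * (\<Sum>K\<in>D'. (len K)\<^sup>2)"
  proof -
    have cell_row: "(\<Sum>y\<in>I - {(K, k)}. (- cc (K, k) y / 2) * B (K, k) y) =
        (\<Sum>l\<in>{..<n} - {k}. (- cc (K, k) (K, l) / 2) * \<bar>g K k - g K l\<bar> powr (2 * H)) +
        (\<Sum>L\<in>D' - {K}. (- icov H (g K k) (g K (Suc k)) (Inf L) (Sup L)) * (len K + len L))"
      if Kk: "K \<in> D'" "k < n" for K k
    proof -
      have sp: "I - {(K, k)} = {K} \<times> ({..<n} - {k}) \<union> (D' - {K}) \<times> {..<n}" using Kk by (auto simp: I_def)
      have "(\<Sum>y\<in>I - {(K, k)}. (- cc (K, k) y / 2) * B (K, k) y) =
          (\<Sum>y\<in>{K} \<times> ({..<n} - {k}). (- cc (K, k) y / 2) * B (K, k) y) +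
          (\<Sum>y\<in>(D' - {K}) \<times> {..<n}. (- cc (K, k) y / 2) * B (K, k) y)"
        unfolding sp using fin by (intro sum.union_disjoint) auto
      also have "(\<Sum>y\<in>{K} \<times> ({..<n} - {k}). (- cc (K, k) y / 2) * B (K, k) y) =
          (\<Sum>l\<in>{..<n} - {k}. (- cc (K, k) (K, l) / 2) * \<bar>g K k - g K l\<bar> powr (2 * H))"
        unfolding sum.cartesian_product' by (simp add: B_def)
      also have "(\<Sum>y\<in>(D' - {K}) \<times> {..<n}. (- cc (K, k) y / 2) * B (K, k) y) =
          (\<Sum>L\<in>D' - {K}. \<Sum>l<n. (- cc (K, k) (L, l)) * (len K + len L))"
        unfolding sum.cartesian_product' by (intro sum.cong refl) (auto simp: B_def)
      also have "\<dots> = (\<Sum>L\<in>D' - {K}. (- icov H (g K k) (g K (Suc k)) (Inf L) (Sup L)) * (len K + len L))"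
        unfolding sum_distrib_right[symmetric] sum_negf cc_def fst_conv snd_conv tele ..
      finally show ?thesis .
    qed
    have "(\<Sum>x\<in>I. (\<Sum>y\<in>I. cc x y) * B x x + (\<Sum>y\<in>I - {x}. (- cc x y / 2) * B x y)) =
        (\<Sum>K\<in>D'. \<Sum>k<n. icov H (g K k) (g K (Suc k)) s t * len K +
          ((\<Sum>l\<in>{..<n} - {k}. (- cc (K, k) (K, l) / 2) * \<bar>g K k - g K l\<bar> powr (2 * H)) +
          (\<Sum>L\<in>D' - {K}. (- icov H (g K k) (g K (Suc k)) (Inf L) (Sup L)) * (len K + len L))))"
    proof -
      have flat: "(\<Sum>x\<in>I. F x) = (\<Sum>K\<in>D'. \<Sum>k<n. F (K, k))" for F :: "real set \<times> nat \<Rightarrow> real"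
        unfolding I_def by (rule sum.cartesian_product')
      have Bd: "B x x = len (fst x)" for x by (simp add: B_def)
      have "(\<Sum>y\<in>I. cc (K, k) y) * B (K, k) (K, k) + (\<Sum>y\<in>I - {(K, k)}. (- cc (K, k) y / 2) * B (K, k) y) =
          icov H (g K k) (g K (Suc k)) s t * len K +
          ((\<Sum>l\<in>{..<n} - {k}. (- cc (K, k) (K, l) / 2) * \<bar>g K k - g K l\<bar> powr (2 * H)) +
          (\<Sum>L\<in>D' - {K}. (- icov H (g K k) (g K (Suc k)) (Inf L) (Sup L)) * (len K + len L)))"
        if Kk: "K \<in> D'" "k < n" for K k
      proof -
        have "(K, k) \<in> I" using Kk by (simp add: I_def)
        then show ?thesis unfolding row[OF \<open>(K, k) \<in> I\<close>] cell_row[OF Kk] Bd by simp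
      qed
      then show ?thesis
        by (subst flat) (intro sum.cong refl, blast)
    qed
    also have "\<dots> = (\<Sum>K\<in>D'. icov H (Inf K) (Sup K) s t * len K) +
        ((\<Sum>K\<in>D'. \<Sum>k<n. \<Sum>l\<in>{..<n} - {k}. (- cc (K, k) (K, l) / 2) * \<bar>g K k - g K l\<bar> powr (2 * H)) +
        (\<Sum>K\<in>D'. \<Sum>L\<in>D' - {K}. (- icov H (Inf K) (Sup K) (Inf L) (Sup L)) * (len K + len L)))"
    proof -
      have t: "(\<Sum>k<n. icov H (g K k) (g K (Suc k)) u v) = icov H (Inf K) (Sup K) u v" for K u v
        unfolding icov_sym[of H _ _ u v] by (rule tele)
      have "(\<Sum>k<n. \<Sum>L\<in>D' - {K}. (- icov H (g K k) (g K (Suc k)) (Inf L) (Sup L)) * (len K + len L)) =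
        (\<Sum>L\<in>D' - {K}. (- icov H (Inf K) (Sup K) (Inf L) (Sup L)) * (len K + len L))" for K
        by (subst sum.swap) (simp only: sum_distrib_right[symmetric] sum_negf t)
      then show ?thesis by (simp only: sum.distrib sum_distrib_right[symmetric] t)
    qed
    also have "\<dots> \<le> (\<Sum>K\<in>D'. (len K)\<^sup>2) + (young_const H H * (\<Sum>K\<in>D'. (len K)\<^sup>2) + 2 * (\<Sum>K\<in>D'. (len K)\<^sup>2))"
    proof (intro add_mono)
      show "(\<Sum>K\<in>D'. icov H (Inf K) (Sup K) s t * len K) \<le> (\<Sum>K\<in>D'. (len K)\<^sup>2)"
        using sum_division_cross_terms(2)[OF H D less_imp_le[OF st]]
        by (intro sum_mono) (auto simp: power2_eq_square len_def D'_def intro!: mult_right_mono)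
      show "(\<Sum>K\<in>D'. \<Sum>L\<in>D' - {K}. (- icov H (Inf K) (Sup K) (Inf L) (Sup L)) * (len K + len L)) \<le> 2 * (\<Sum>K\<in>D'. (len K)\<^sup>2)"
        using sum_division_cross_terms(1)[OF H D less_imp_le[OF st]] by (simp add: len_def D'_def)
      show "(\<Sum>K\<in>D'. \<Sum>k<n. \<Sum>l\<in>{..<n} - {k}. (- cc (K, k) (K, l) / 2) * \<bar>g K k - g K l\<bar> powr (2 * H)) \<le>
          young_const H H * (\<Sum>K\<in>D'. (len K)\<^sup>2)"
        unfolding sum_distrib_left[of _ _ D']
      proof (rule sum_mono)
        fix K assume K: "K \<in> D'"
        have y0: "0 \<le> young_const H H" using big by (simp add: young_const_def)
        have "(\<Sum>k<n. \<Sum>l\<in>{..<n} - {k}. (- cc (K, k) (K, l) / 2) * \<bar>g K k - g K l\<bar> powr (2 * H)) =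
            1 / 2 * (\<Sum>k<n. \<Sum>l\<in>{..<n} - {k}. \<bar>g K k - g K l\<bar> powr (2 * H) * (- icov H (g K k) (g K (Suc k)) (g K l) (g K (Suc l))))"
          unfolding sum_distrib_left cc_def by (intro sum.cong refl) simp
        also have "\<dots> \<le> 1 / 2 * (young_const H H * (Sup K - Inf K) powr (2 * H + 2 * H))"
          unfolding g_def using H big cell[OF K] n by (intro mult_left_mono sum_grid_icov_le) auto
        also have "\<dots> \<le> young_const H H * (Sup K - Inf K) powr (2 * H + 2 * H)" using y0 by simp
        also have "\<dots> = young_const H H * (len K)\<^sup>2" by (simp add: len_def power2_eq_square powr_add[symmetric])
        finally show "(\<Sum>k<n. \<Sum>l\<in>{..<n} - {k}. (- cc (K, k) (K, l) / 2) * \<bar>g K k - g K l\<bar> powr (2 * H)) \<le> young_const H H * (len K)\<^sup>2" .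
      qed
    qed
    also have "\<dots> = (3 + young_const H H) * (\<Sum>K\<in>D'. (len K)\<^sup>2)" by (simp add: algebra_simps)
    finally show ?thesis .
  qed
  moreover have "(\<Sum>K\<in>D'. (len K)\<^sup>2) \<le> (\<Sum>K\<in>D. (Sup K - Inf K) powr (4 * H))"
  proof -
    have "(len K)\<^sup>2 = (Sup K - Inf K) powr (4 * H)" for K by (simp add: len_def power2_eq_square powr_add[symmetric])
    then show ?thesis using D by (auto simp: D'_def intro!: sum_mono2)
  qed
  then have "(3 + young_const H H) * (\<Sum>K\<in>D'. (len K)\<^sup>2) \<le> (3 + young_const H H) * (\<Sum>K\<in>D. (Sup K - Inf K) powr (4 * H))"
    using big by (intro mult_left_mono) (auto simp: young_const_def)
  ultimately show ?thesis by (simp add: D'_def order_trans[OF _ ennreal_leI])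
qed

text \<open>Convexity transfers the bound for shifted Riemann sums to mollified ones, with reference
  variable \<open>0\<close>; Fatou's lemma then refines the grids inside the cells while the
  division stays fixed.\<close>

lemma cell_areas_moment:
  assumes H: "0 < H" "H \<le> 1 / 2" and big: "1 < 4 * H" and ij: "i \<noteq> j" and \<delta>: "0 < \<delta>"
    and D: "D division_of {s..t}" and st: "s < t"
  shows "(\<integral>\<^sup>+\<omega>. ennreal ((\<Sum>K\<in>D. area \<delta> (\<lambda>r. \<omega> r $ i) (\<lambda>r. \<omega> r $ j) (Inf K) (Sup K))\<^sup>2) \<partial>P)
    \<le> ennreal ((3 + young_const H H) * (\<Sum>K\<in>D. (Sup K - Inf K) powr (4 * H)))" (is "_ \<le> ?C")
proof -
  define D' where "D' = {K \<in> D. Inf K < Sup K}"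
  define S where "S n \<omega> = (\<Sum>K\<in>D'. \<Sum>k<n. (avg \<delta> (\<lambda>r. \<omega> r $ i) (grid (Inf K) (Sup K) n k) - avg \<delta> (\<lambda>r. \<omega> r $ i) (Inf K)) *
      (avg \<delta> (\<lambda>r. \<omega> r $ j) (grid (Inf K) (Sup K) n (Suc k)) - avg \<delta> (\<lambda>r. \<omega> r $ j) (grid (Inf K) (Sup K) n k)))"
    for n and \<omega> :: "real \<Rightarrow> real ^ 'd"
  have fin: "finite D" using D by auto
  have red: "(\<Sum>K\<in>D. area \<delta> x y (Inf K) (Sup K)) = (\<Sum>K\<in>D'. area \<delta> x y (Inf K) (Sup K))" for x y
  proof (rule sum.mono_neutral_right[OF fin])
    show "\<forall>K\<in>D - D'. area \<delta> x y (Inf K) (Sup K) = 0"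
    proof
      fix K assume "K \<in> D - D'"
      then have "Inf K = Sup K" using division_cell(2)[OF D, of K] by (auto simp: D'_def)
      then show "area \<delta> x y (Inf K) (Sup K) = 0" by (simp add: area_refl)
    qed
  qed (auto simp: D'_def)
  show ?thesis unfolding red
  proof (rule nn_integral_fatou_le)
    note avg_measurable[OF \<delta>, measurable]
    show "S n \<in> borel_measurable P" for n unfolding S_def by measurable
    show "AE \<omega> in P. (\<lambda>n. S n \<omega>) \<longlonglongrightarrow> (\<Sum>K\<in>D'. area \<delta> (\<lambda>r. \<omega> r $ i) (\<lambda>r. \<omega> r $ j) (Inf K) (Sup K))"
      unfolding S_def by (intro AE_I2 tendsto_sum area_limit coord_continuous) (auto simp: D'_def)
    show "\<forall>\<^sub>F n in sequentially. (\<integral>\<^sup>+\<omega>. ennreal ((S n \<omega>)\<^sup>2) \<partial>P) \<le> ?C"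
      using eventually_gt_at_top[of 0]
    proof eventually_elim
      case (elim n)
      have flat: "(\<Sum>K\<in>D'. \<Sum>k<n. F K k) = (\<Sum>x\<in>D' \<times> {..<n}. F (fst x) (snd x))" for F :: "real set \<Rightarrow> nat \<Rightarrow> real"
        unfolding sum.cartesian_product by (simp add: split_def)
      have "(\<integral>\<^sup>+\<omega>. ennreal ((S n \<omega> - 0) ^ (2 * 1)) \<partial>P) \<le> ?C"
        unfolding S_def flat
      proof (rule mollified_moment[OF \<delta>])
        fix x y
        show "(\<integral>\<^sup>+\<omega>. ennreal (((\<Sum>z\<in>D' \<times> {..<n}. (\<omega> (grid (Inf (fst z)) (Sup (fst z)) n (snd z) + x) $ i - \<omega> (Inf (fst z) + x) $ i) *
            (\<omega> (grid (Inf (fst z)) (Sup (fst z)) n (Suc (snd z)) + y) $ j - \<omega> (grid (Inf (fst z)) (Sup (fst z)) n (snd z) + y) $ j)) - 0) ^ (2 * 1)) \<partial>P) \<le> ?C"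
          using cell_sums_moment[OF H big ij elim D st, of x y]
          unfolding flat[symmetric, of "\<lambda>K k. (_ K k :: real)"] by (simp add: D'_def[symmetric] riem_def flat)
      qed simp
      then show ?case by simp
    qed
  qed
qed

end

section \<open>Almost sure rate of convergence\<close>

text \<open>Indices of the start, the end and the scale in units of \<open>fine_mesh k\<close>; the
  scales fill the \<open>k\<close>-th dyadic block.\<close>

definition grid_triples :: "nat \<Rightarrow> nat \<Rightarrow> (int \<times> int \<times> int) set" where
  "grid_triples n k = {(a, b, c). a < b \<and> - real n \<le> real_of_int a * fine_mesh k \<and>
    real_of_int b * fine_mesh k \<le> real n \<and>
    (1 / 2) ^ Suc k \<le> real_of_int c * fine_mesh k \<and> real_of_int c * fine_mesh k \<le> (1 / 2) ^ k}"

lemma fine_mesh_pos: "0 < fine_mesh k"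
  by (simp add: fine_mesh_def)

lemma fine_mesh_eq: "fine_mesh k * 2 ^ (24 * Suc k) = 1"
  by (simp add: fine_mesh_def power_mult[symmetric] power_mult_distrib[symmetric] mult.commute
      flip: power_Suc)

text \<open>A unit interval has \<open>2 ^ (24 * Suc k)\<close> mesh steps; three indices give the
  exponent \<open>72\<close>.\<close>

lemma grid_triples_card:
  "finite (grid_triples n k)" "real (card (grid_triples n k)) \<le> 2 * (2 * real n + 1)\<^sup>2 * 2 ^ (72 * Suc k)"
proof -
  define N :: int where "N = 2 ^ (24 * Suc k)"
  have N: "1 \<le> N" by (simp add: N_def)
  have e: "real_of_int z * fine_mesh k \<le> real_of_int m \<longleftrightarrow> z \<le> m * N"
    "real_of_int m \<le> real_of_int z * fine_mesh k \<longleftrightarrow> m * N \<le> z" for z m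
  proof -
    have eN: "fine_mesh k * real_of_int N = 1" unfolding N_def using fine_mesh_eq[of k] by simp
    have "real_of_int m = real_of_int (m * N) * fine_mesh k" using eN by (simp add: mult.assoc mult.commute)
    then show "real_of_int z * fine_mesh k \<le> real_of_int m \<longleftrightarrow> z \<le> m * N"
      "real_of_int m \<le> real_of_int z * fine_mesh k \<longleftrightarrow> m * N \<le> z"
      using fine_mesh_pos[of k] by (simp_all only: mult_le_cancel_right_pos of_int_le_iff)
  qed
  let ?A = "{- int n * N..int n * N}"
  have sub: "grid_triples n k \<subseteq> ?A \<times> ?A \<times> {0..N}"
  proof
    fix z assume "z \<in> grid_triples n k"
    then obtain a b c where z: "z = (a, b, c)" and ab: "a < b" and a: "real_of_int (- int n) \<le> real_of_int a * fine_mesh k"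
      and b: "real_of_int b * fine_mesh k \<le> real_of_int (int n)"
      and c: "(1 / 2) ^ Suc k \<le> real_of_int c * fine_mesh k" "real_of_int c * fine_mesh k \<le> (1 / 2) ^ k"
      unfolding grid_triples_def by auto
    have "real_of_int c * fine_mesh k \<le> real_of_int 1" using c(2) power_le_one[of "1/2 :: real" k] by simp
    moreover have "real_of_int 0 \<le> real_of_int c * fine_mesh k" 
      using less_le_trans[OF zero_less_power c(1)] by simp
    ultimately have "c \<le> 1 * N" "0 * N \<le> c" unfolding e by auto
    moreover have "- int n * N \<le> a" "b \<le> int n * N" using a b unfolding e by auto
    ultimately show "z \<in> ?A \<times> ?A \<times> {0..N}" using z ab by auto
  qed
  show "finite (grid_triples n k)" using sub by (rule finite_subset) auto
  have "card (grid_triples n k) \<le> card (?A \<times> ?A \<times> {0..N})" by (rule card_mono[OF _ sub]) auto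
  then have "real (card (grid_triples n k)) \<le> real (card (?A \<times> ?A \<times> {0..N}))" by (simp only: of_nat_le_iff)
  also have "\<dots> = (2 * real n * real_of_int N + 1) * (2 * real n * real_of_int N + 1) * (real_of_int N + 1)"
    using N by (simp add: card_cartesian_product ac_simps)
  also have "\<dots> \<le> ((2 * real n + 1) * real_of_int N) * ((2 * real n + 1) * real_of_int N) * (2 * real_of_int N)"
    using N by (intro mult_mono) (auto simp: distrib_right)
  also have "\<dots> = 2 * (2 * real n + 1)\<^sup>2 * real_of_int N ^ 3" by (simp add: power2_eq_square power3_eq_cube)
  also have "real_of_int N ^ 3 = 2 ^ (72 * Suc k)" by (simp add: N_def power_mult[symmetric])
  finally show "real (card (grid_triples n k)) \<le> 2 * (2 * real n + 1)\<^sup>2 * 2 ^ (72 * Suc k)" .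
qed

text \<open>A scale is compared only with the upper end \<open>(1 / 2) ^ k\<close> of its dyadic
  block. The limit of the areas does not occur, so the property makes sense before convergence is
  known and involves only mollified areas, which are measurable in the path.\<close>

definition area_rate :: "real \<Rightarrow> real \<Rightarrow> nat \<Rightarrow> (real \<Rightarrow> real) \<Rightarrow> (real \<Rightarrow> real) \<Rightarrow> real \<Rightarrow> bool" where
  "area_rate \<beta> \<kappa> n x y C \<longleftrightarrow> (\<forall>k \<delta> s t. (1 / 2) ^ Suc k \<le> \<delta> \<longrightarrow> \<delta> \<le> (1 / 2) ^ k \<longrightarrow> - real n \<le> s \<longrightarrow> s < t \<longrightarrow> t \<le> real n \<longrightarrow>
    \<bar>area \<delta> x y s t - area ((1 / 2) ^ k) x y s t\<bar> \<le> C * 2 powr (- \<kappa> * k) * (t - s) powr (2 * \<beta>))"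

lemma holder_coord_bounds:
  assumes \<omega>: "\<omega> \<in> holder_paths H" and \<gamma>: "0 < \<gamma>" "\<gamma> < H" and T: "0 < T"
  obtains K where "0 \<le> K" "\<And>i r r'. r \<in> {-T..T} \<Longrightarrow> r' \<in> {-T..T} \<Longrightarrow> \<bar>\<omega> r' $ i - \<omega> r $ i\<bar> \<le> K * \<bar>r' - r\<bar> powr \<gamma>"
proof -
  obtain C where C: "\<And>r r'. r \<in> {-T..T} \<Longrightarrow> r' \<in> {-T..T} \<Longrightarrow> norm (\<omega> r' - \<omega> r) \<le> C * \<bar>r' - r\<bar> powr \<gamma>"
    using assms unfolding holder_paths_def by blast
  show thesis
  proof (rule that[of "\<bar>C\<bar>"])
    fix i r r' assume r: "r \<in> {-T..T}" "r' \<in> {-T..T}"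
    have "\<bar>\<omega> r' $ i - \<omega> r $ i\<bar> \<le> norm (\<omega> r' - \<omega> r)"
      using component_le_norm_cart[of "\<omega> r' - \<omega> r" i] by simp
    also have "\<dots> \<le> C * \<bar>r' - r\<bar> powr \<gamma>" by (rule C[OF r])
    also have "\<dots> \<le> \<bar>C\<bar> * \<bar>r' - r\<bar> powr \<gamma>" by (intro mult_right_mono) auto
    finally show "\<bar>\<omega> r' $ i - \<omega> r $ i\<bar> \<le> \<bar>C\<bar> * \<bar>r' - r\<bar> powr \<gamma>" .
  qed simp
qed

lemma holder_bounded_pair:
  assumes \<omega>: "\<omega> \<in> holder_paths H" and H: "1 / 3 < H" and T: "0 \<le> T"
  obtains M K where "bounded_pair (\<lambda>r. \<omega> r $ i) (\<lambda>r. \<omega> r $ j) T M K"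
proof -
  obtain K where K: "0 \<le> K" "\<And>i r r'. r \<in> {-(T+1)..T+1} \<Longrightarrow> r' \<in> {-(T+1)..T+1} \<Longrightarrow>
      \<bar>\<omega> r' $ i - \<omega> r $ i\<bar> \<le> K * \<bar>r' - r\<bar> powr (1 / 3)"
    using holder_coord_bounds[OF \<omega> _ H, of "T + 1"] T by (metis add_nonneg_pos zero_less_divide_1_iff zero_less_numeral zero_less_one)
  have c: "continuous_on UNIV (\<lambda>r. \<omega> r $ i)" for i
    using \<omega> by (intro continuous_on_component) (simp add: holder_paths_def)
  have w0: "\<omega> 0 = 0" using \<omega> by (simp add: holder_paths_def)
  have b: "\<bar>\<omega> r $ i\<bar> \<le> K * (T + 1) powr (1 / 3)" if r: "r \<in> {-(T+1)..T+1}" for i r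
  proof -
    have "\<bar>\<omega> r $ i\<bar> \<le> K * \<bar>r\<bar> powr (1 / 3)" using K(2)[of 0 r i] r T w0 by simp
    also have "\<dots> \<le> K * (T + 1) powr (1 / 3)" using K r by (intro mult_left_mono powr_mono2) auto
    finally show ?thesis .
  qed
  show thesis
    by (rule that[of "K * (T + 1) powr (1 / 3)" K], unfold_locales) (use c T K b in \<open>auto simp: minus_add_distrib\<close>)
qed

context canonical_fbm
begin

text \<open>\<open>area_diff_moment\<close> with \<open>\<alpha> = \<beta>\<close> gives the decay
  \<open>2 powr (- 2 * (H - \<beta>) * p * k)\<close>. Normalising with the rate
  \<open>(H - \<beta>) / 2\<close> uses up half of the exponent; the other half remains for the
  summation over the grids.\<close>

lemma normalized_difference_moment:
  assumes H: "0 < H" "H \<le> 1 / 2" and \<beta>: "1 / 3 < \<beta>" "\<beta> < H"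
    and ij: "i \<noteq> j" and p: "1 \<le> p" and st: "s < t" "t - s \<le> R" and \<delta>: "0 < \<delta>" "\<delta> \<le> (1 / 2) ^ k"
  shows "(\<integral>\<^sup>+\<omega>. ennreal (((area \<delta> (\<lambda>r. \<omega> r $ i) (\<lambda>r. \<omega> r $ j) s t - area ((1 / 2) ^ k) (\<lambda>r. \<omega> r $ i) (\<lambda>r. \<omega> r $ j) s t) /
      (2 powr (- ((H - \<beta>) / 2) * k) * (t - s) powr (2 * \<beta>))) ^ (2 * p)) \<partial>P)
    \<le> ennreal (2 ^ (4 * p) * (gauss_const p)\<^sup>2 * (4 * (1 + young_const \<beta> H) * R powr (2 * H - 2 * \<beta>)) ^ p *
        2 powr (- (H - \<beta>) * p * k))"
proof -
  let ?A = "\<lambda>\<omega>. area \<delta> (\<lambda>r. \<omega> r $ i) (\<lambda>r. \<omega> r $ j) s t - area ((1 / 2) ^ k) (\<lambda>r. \<omega> r $ i) (\<lambda>r. \<omega> r $ j) s t"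
  define d where "d = 2 powr (- ((H - \<beta>) / 2) * k) * (t - s) powr (2 * \<beta>)"
  have d: "0 < d" using st by (simp add: d_def)
  have [measurable]: "?A \<in> borel_measurable P"
    using \<delta> st by (intro borel_measurable_diff area_measurable) auto
  have big: "1 < 2 * \<beta> + 2 * H" using \<beta> by simp
  have "(\<integral>\<^sup>+\<omega>. ennreal ((?A \<omega> / d) ^ (2 * p)) \<partial>P) = (\<integral>\<^sup>+\<omega>. ennreal (1 / d ^ (2 * p)) * ennreal (?A \<omega> ^ (2 * p)) \<partial>P)"
    using d by (intro nn_integral_cong) (simp add: ennreal_mult'[symmetric] power_divide)
  also have "\<dots> = ennreal (1 / d ^ (2 * p)) * (\<integral>\<^sup>+\<omega>. ennreal (?A \<omega> ^ (2 * p)) \<partial>P)"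
    by (intro nn_integral_cmult) measurable
  also have "\<dots> \<le> ennreal (1 / d ^ (2 * p)) * ennreal (2 ^ (4 * p) * shift_bound \<beta> p ((1 / 2) ^ k) (t - s))"
    using \<beta> by (intro mult_left_mono area_diff_moment H ij p st big \<delta>) auto
  also have "\<dots> = ennreal (1 / d ^ (2 * p) * (2 ^ (4 * p) * shift_bound \<beta> p ((1 / 2) ^ k) (t - s)))"
    using d by (simp add: ennreal_mult'[symmetric])
  also have "\<dots> \<le> ennreal (2 ^ (4 * p) * (gauss_const p)\<^sup>2 * (4 * (1 + young_const \<beta> H) * R powr (2 * H - 2 * \<beta>)) ^ p *
        2 powr (- (H - \<beta>) * p * k))"
  proof (rule ennreal_leI)
    have d2: "d\<^sup>2 = 2 powr (- (H - \<beta>) * k) * (t - s) powr (4 * \<beta>)"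
    proof -
      have sq: "(c powr x)\<^sup>2 = c powr z" if "x + x = z" for c x z :: real
        using powr_add[of c x x] that by (simp add: power2_eq_square)
      show ?thesis unfolding d_def power_mult_distrib
        by (intro arg_cong2[where f="(*)"] sq) (auto simp: field_simps)
    qed
    have dk: "((1 / 2) ^ k) powr (2 * H - 2 * \<beta>) = 2 powr (- (2 * H - 2 * \<beta>) * k)"
    proof -
      have "(1 / 2 :: real) ^ k = 2 powr (- real k)"
        by (simp add: powr_minus powr_realpow power_one_over inverse_eq_divide)
      then show ?thesis by (simp only: powr_powr) (simp add: algebra_simps)
    qed
    have y0: "0 \<le> young_const \<beta> H" using big by (simp add: young_const_def)
    have ratio: "4 * ((1 / 2) ^ k) powr (2 * H - 2 * \<beta>) * (1 + young_const \<beta> H) * (t - s) powr (2 * \<beta> + 2 * H) / d\<^sup>2 =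
        4 * (1 + young_const \<beta> H) * (t - s) powr (2 * H - 2 * \<beta>) * 2 powr (- (H - \<beta>) * k)"
    proof -
      have 1: "2 powr (- (2 * H - 2 * \<beta>) * k) / 2 powr (- (H - \<beta>) * k) = 2 powr (- (H - \<beta>) * k)"
        by (simp add: powr_diff[symmetric] algebra_simps)
      have 2: "(t - s) powr (2 * \<beta> + 2 * H) / (t - s) powr (4 * \<beta>) = (t - s) powr (2 * H - 2 * \<beta>)"
        by (simp add: powr_diff[symmetric] algebra_simps)
      have "4 * ((1 / 2) ^ k) powr (2 * H - 2 * \<beta>) * (1 + young_const \<beta> H) * (t - s) powr (2 * \<beta> + 2 * H) / d\<^sup>2 =
        4 * (1 + young_const \<beta> H) * ((t - s) powr (2 * \<beta> + 2 * H) / (t - s) powr (4 * \<beta>)) *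
        (2 powr (- (2 * H - 2 * \<beta>) * k) / 2 powr (- (H - \<beta>) * k))"
        unfolding d2 dk by (simp add: ac_simps)
      then show ?thesis unfolding 1 2 .
    qed
    have "1 / d ^ (2 * p) * (2 ^ (4 * p) * shift_bound \<beta> p ((1 / 2) ^ k) (t - s)) =
        2 ^ (4 * p) * (gauss_const p)\<^sup>2 * (4 * ((1 / 2) ^ k) powr (2 * H - 2 * \<beta>) * (1 + young_const \<beta> H) * (t - s) powr (2 * \<beta> + 2 * H) / d\<^sup>2) ^ p"
      unfolding shift_bound_def power_divide[of _ "d\<^sup>2"] power_mult[symmetric] by simp
    also have "\<dots> = 2 ^ (4 * p) * (gauss_const p)\<^sup>2 * ((4 * (1 + young_const \<beta> H) * (t - s) powr (2 * H - 2 * \<beta>)) ^ p * 2 powr (- (H - \<beta>) * p * k))"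
      unfolding ratio power_mult_distrib[of _ "2 powr _"] by (simp add: powr_power ac_simps)
    also have "\<dots> \<le> 2 ^ (4 * p) * (gauss_const p)\<^sup>2 * ((4 * (1 + young_const \<beta> H) * R powr (2 * H - 2 * \<beta>)) ^ p * 2 powr (- (H - \<beta>) * p * k))"
      using y0 st \<beta> by (intro mult_left_mono mult_right_mono power_mono powr_mono2) auto
    finally show "1 / d ^ (2 * p) * (2 ^ (4 * p) * shift_bound \<beta> p ((1 / 2) ^ k) (t - s)) \<le>
        2 ^ (4 * p) * (gauss_const p)\<^sup>2 * (4 * (1 + young_const \<beta> H) * R powr (2 * H - 2 * \<beta>)) ^ p * 2 powr (- (H - \<beta>) * p * k)"
      by (simp add: mult.assoc)
  qed
  finally show ?thesis by (simp add: d_def)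
qed

text \<open>Summing the normalized moments over all scales and all grid points gives an integrable
  random variable; this replaces Borel--Cantelli and a chaining argument.\<close>

lemma AE_area_rate:
  assumes H: "1 / 3 < H" "H \<le> 1 / 2" and \<beta>: "1 / 3 < \<beta>" "\<beta> < H" and ij: "i \<noteq> j"
  shows "AE \<omega> in P. \<exists>C\<ge>0. area_rate \<beta> ((H - \<beta>) / 2) n (\<lambda>r. \<omega> r $ i) (\<lambda>r. \<omega> r $ j) C"
proof -
  define \<kappa> where "\<kappa> = (H - \<beta>) / 2"
  \<comment> \<open>Up to a constant there are \<open>2 ^ (72 * k)\<close> grid triples at level
    \<open>k\<close>; the value \<open>73\<close> leaves a factor \<open>(1 / 2) ^ k\<close> for
    summability.\<close>
  obtain p :: nat where p: "73 / (H - \<beta>) < real p" using reals_Archimedean2 by blast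
  have p': "73 \<le> (H - \<beta>) * real p" using p \<beta> by (simp add: divide_less_eq mult.commute)
  have p1: "1 \<le> p" using p' by (cases p) auto
  have H0: "0 < H" using H by simp
  define D where "D k z \<omega> = (case z of (a, b, c) \<Rightarrow>
      (area (real_of_int c * fine_mesh k) (\<lambda>r. \<omega> r $ i) (\<lambda>r. \<omega> r $ j) (real_of_int a * fine_mesh k) (real_of_int b * fine_mesh k) -
        area ((1 / 2) ^ k) (\<lambda>r. \<omega> r $ i) (\<lambda>r. \<omega> r $ j) (real_of_int a * fine_mesh k) (real_of_int b * fine_mesh k)) /
      (2 powr (- \<kappa> * k) * (real_of_int b * fine_mesh k - real_of_int a * fine_mesh k) powr (2 * \<beta>)))"
    for k z and \<omega> :: "real \<Rightarrow> real ^ 'd"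
  have triple: "a < b" "real_of_int a * fine_mesh k < real_of_int b * fine_mesh k"
    "real_of_int b * fine_mesh k - real_of_int a * fine_mesh k \<le> 2 * real n"
    "0 < real_of_int c * fine_mesh k" "real_of_int c * fine_mesh k \<le> (1 / 2) ^ k"
    if "(a, b, c) \<in> grid_triples n k" for a b c k
    using that fine_mesh_pos[of k] less_le_trans[OF zero_less_power[of "1 / 2" "Suc k"], of "real_of_int c * fine_mesh k"]
    by (auto simp: grid_triples_def simp del: power_Suc)
  have D_meas: "D k z \<in> borel_measurable P" if "z \<in> grid_triples n k" for k z
  proof -
    obtain a b c where z: "z = (a, b, c)" by (cases z)
    show ?thesis unfolding D_def z prod.case using triple[of a b c k] that z
      by (intro borel_measurable_divide borel_measurable_diff area_measurable borel_measurable_const) auto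
  qed
  define C1 where "C1 = 2 ^ (4 * p) * (gauss_const p)\<^sup>2 * (4 * (1 + young_const \<beta> H) * (2 * real n) powr (2 * H - 2 * \<beta>)) ^ p"
  have C1: "0 \<le> C1" unfolding C1_def using \<beta> H by (auto simp: young_const_def intro!: mult_nonneg_nonneg)
  have D_mom: "(\<integral>\<^sup>+\<omega>. ennreal (D k z \<omega> ^ (2 * p)) \<partial>P) \<le> ennreal (C1 * 2 powr (- (H - \<beta>) * p * k))"
    if "z \<in> grid_triples n k" for k z
  proof -
    obtain a b c where z: "z = (a, b, c)" by (cases z)
    note t = triple[of a b c k, OF that[unfolded z]]
    show ?thesis unfolding D_def z prod.case \<kappa>_def C1_def
      by (rule normalized_difference_moment[OF H0 H(2) \<beta> ij p1 t(2,3,4,5)])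
  qed
  define C2 where "C2 = 2 * (2 * real n + 1)\<^sup>2 * 2 ^ 72 * C1"
  define Z where "Z \<omega> = (\<Sum>k. \<Sum>z\<in>grid_triples n k. ennreal (D k z \<omega> ^ (2 * p)))" for \<omega>
  have Z_meas: "Z \<in> borel_measurable P"
    unfolding Z_def
    by (intro borel_measurable_suminf_order borel_measurable_sum measurable_compose[OF _ measurable_ennreal] borel_measurable_power D_meas)
  have term_le: "(\<integral>\<^sup>+\<omega>. (\<Sum>z\<in>grid_triples n k. ennreal (D k z \<omega> ^ (2 * p))) \<partial>P) \<le> ennreal (C2 * (1 / 2) ^ k)" for k
  proof -
    have "(\<integral>\<^sup>+\<omega>. (\<Sum>z\<in>grid_triples n k. ennreal (D k z \<omega> ^ (2 * p))) \<partial>P) = (\<Sum>z\<in>grid_triples n k. \<integral>\<^sup>+\<omega>. ennreal (D k z \<omega> ^ (2 * p)) \<partial>P)"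
      by (intro nn_integral_sum measurable_compose[OF _ measurable_ennreal] borel_measurable_power D_meas)
    also have "\<dots> \<le> (\<Sum>z\<in>grid_triples n k. ennreal (C1 * 2 powr (- (H - \<beta>) * p * k)))" by (intro sum_mono D_mom)
    also have "\<dots> = ennreal (real (card (grid_triples n k)) * (C1 * 2 powr (- (H - \<beta>) * p * k)))"
      using C1 by (simp add: ennreal_mult' ennreal_of_nat_eq_real_of_nat)
    also have "\<dots> \<le> ennreal (C2 * (1 / 2) ^ k)"
    proof (rule ennreal_leI)
      have "2 powr (- (H - \<beta>) * p * k) \<le> 2 powr (- 73 * real k)"
        using mult_right_mono[OF p', of "real k"] by (intro powr_mono) (simp_all add: algebra_simps)
      also have "\<dots> = 1 / 2 ^ (73 * k)" by (simp add: powr_minus_divide powr_realpow[symmetric])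
      finally have le: "2 powr (- (H - \<beta>) * p * k) \<le> 1 / 2 ^ (73 * k)" .
      have "real (card (grid_triples n k)) * (C1 * 2 powr (- (H - \<beta>) * p * k)) \<le>
          (2 * (2 * real n + 1)\<^sup>2 * 2 ^ (72 * Suc k)) * (C1 * (1 / 2 ^ (73 * k)))"
        using C1 le by (intro mult_mono grid_triples_card mult_nonneg_nonneg) auto
      also have "\<dots> = C2 * (2 ^ (72 * k) / 2 ^ (73 * k))" by (simp add: C2_def power_add)
      also have "(2 :: real) ^ (72 * k) / 2 ^ (73 * k) = (1 / 2) ^ k"
        by (simp add: field_simps power_add[symmetric])
      finally show "real (card (grid_triples n k)) * (C1 * 2 powr (- (H - \<beta>) * p * k)) \<le> C2 * (1 / 2) ^ k" .
    qed
    finally show ?thesis .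
  qed
  have "(\<integral>\<^sup>+\<omega>. Z \<omega> \<partial>P) = (\<Sum>k. \<integral>\<^sup>+\<omega>. (\<Sum>z\<in>grid_triples n k. ennreal (D k z \<omega> ^ (2 * p))) \<partial>P)"
    unfolding Z_def
    by (intro nn_integral_suminf borel_measurable_sum measurable_compose[OF _ measurable_ennreal] borel_measurable_power D_meas)
  also have "\<dots> \<le> (\<Sum>k. ennreal (C2 * (1 / 2) ^ k))" by (intro suminf_le term_le) auto
  also have "\<dots> = ennreal (\<Sum>k. C2 * (1 / 2) ^ k)"
    using C1 by (intro suminf_ennreal2 summable_mult summable_geometric) (auto simp: C2_def)
  finally have "(\<integral>\<^sup>+\<omega>. Z \<omega> \<partial>P) \<noteq> \<infinity>" by (auto simp: top_unique)
  from nn_integral_PInf_AE[OF Z_meas this] have "AE \<omega> in P. Z \<omega> \<noteq> \<infinity>" .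
  then have "AE \<omega> in P. Z \<omega> \<noteq> \<infinity> \<and> \<omega> \<in> space P" by simp
  then show ?thesis
  proof eventually_elim
    case (elim \<omega>)
    \<comment> \<open>A normalised difference is either at most \<open>1\<close> in absolute value
      or at most its even power, which is a summand of \<open>Z \<omega>\<close>; hence the
      \<open>1\<close>.\<close>
    define W where "W = 1 + enn2real (Z \<omega>)"
    have W: "1 \<le> W" by (simp add: W_def)
    have ZW: "Z \<omega> = ennreal (enn2real (Z \<omega>))" using elim by (simp add: less_top)
    have D_le: "\<bar>D k z \<omega>\<bar> \<le> W" if z: "z \<in> grid_triples n k" for k z
    proof (cases "\<bar>D k z \<omega>\<bar> \<le> 1")
      case True
      then show ?thesis using W by simp
    next
      case False
      have "ennreal (D k z \<omega> ^ (2 * p)) \<le> (\<Sum>z\<in>grid_triples n k. ennreal (D k z \<omega> ^ (2 * p)))"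
        using z by (intro member_le_sum grid_triples_card) auto
      also have "\<dots> \<le> Z \<omega>" unfolding Z_def
        using sum_le_suminf[of "\<lambda>k. \<Sum>z\<in>grid_triples n k. ennreal (D k z \<omega> ^ (2 * p))" "{k}"] by simp
      finally have "D k z \<omega> ^ (2 * p) \<le> enn2real (Z \<omega>)" using ZW by (metis enn2real_nonneg ennreal_le_iff)
      moreover have "\<bar>D k z \<omega>\<bar> ^ 1 \<le> \<bar>D k z \<omega>\<bar> ^ (2 * p)" using False p1 by (intro power_increasing) auto
      ultimately show ?thesis by (simp add: W_def power_even_abs)
    qed
    have hp: "\<omega> \<in> holder_paths H" using elim space_P by simp
    obtain M K where "bounded_pair (\<lambda>r. \<omega> r $ i) (\<lambda>r. \<omega> r $ j) (real n) M K"
      using holder_bounded_pair[OF hp H(1), of "real n" i j] by auto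
    then interpret bounded_pair "\<lambda>r. \<omega> r $ i" "\<lambda>r. \<omega> r $ j" "real n" M K .
    show ?case unfolding area_rate_def \<kappa>_def[symmetric]
    proof (rule grid_interpolation[of n \<beta> \<kappa> W])
      fix k and a b c :: int
      let ?e = "fine_mesh k"
      assume *: "a < b" "- real n \<le> real_of_int a * ?e" "real_of_int b * ?e \<le> real n"
        "(1 / 2) ^ Suc k \<le> real_of_int c * ?e" "real_of_int c * ?e \<le> (1 / 2) ^ k"
      then have z: "(a, b, c) \<in> grid_triples n k" by (simp add: grid_triples_def)
      have pos: "0 < 2 powr (- \<kappa> * k) * (real_of_int b * ?e - real_of_int a * ?e) powr (2 * \<beta>)"
      proof -
        have "real_of_int b * ?e - real_of_int a * ?e \<noteq> 0" using triple(2)[OF z] by linarith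
        then show ?thesis by (intro mult_pos_pos powr_gt_zero[THEN iffD2]) auto
      qed
      show "\<bar>area (real_of_int c * ?e) (\<lambda>r. \<omega> r $ i) (\<lambda>r. \<omega> r $ j) (real_of_int a * ?e) (real_of_int b * ?e) -
          area ((1 / 2) ^ k) (\<lambda>r. \<omega> r $ i) (\<lambda>r. \<omega> r $ j) (real_of_int a * ?e) (real_of_int b * ?e)\<bar>
        \<le> W * 2 powr (- \<kappa> * k) * (real_of_int b * ?e - real_of_int a * ?e) powr (2 * \<beta>)"
        using D_le[OF z] pos unfolding D_def prod.case abs_divide abs_of_pos[OF pos]
        by (simp add: pos_divide_le_eq mult.assoc)
    qed (use \<beta> H W in \<open>auto simp: \<kappa>_def\<close>)
  qed
qed

end

section \<open>The invariant set\<close>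

text \<open>For \<open>H > 1 / 3\<close>, countably many exponents that increase to
  \<open>H\<close>; the summand \<open>2\<close> keeps even the first one strictly above
  \<open>1 / 3\<close>.\<close>

definition rate_exp :: "real \<Rightarrow> nat \<Rightarrow> real" where
  "rate_exp H m = H - (H - 1 / 3) / (real m + 2)"

text \<open>Exponents, windows and constants range over countable sets, which keeps the set
  measurable. All windows are required because a shift carries each window into a larger
  one.\<close>

definition good_paths :: "real \<Rightarrow> (real \<Rightarrow> real ^ 'd) set" where
  "good_paths H = {\<omega> \<in> holder_paths H. \<forall>i j n m. i \<noteq> j \<longrightarrow>
    (\<exists>C::nat. area_rate (rate_exp H m) ((H - rate_exp H m) / 2) n (\<lambda>r. \<omega> r $ i) (\<lambda>r. \<omega> r $ j) C)}"

lemma rate_exp_bounds: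
  assumes "1 / 3 < H"
  shows "1 / 3 < rate_exp H m" "rate_exp H m < H"
proof -
  define q where "q = (H - 1 / 3) / (real m + 2)"
  have "(H - 1 / 3) * 1 < (H - 1 / 3) * (real m + 2)"
    using assms by (intro mult_strict_left_mono) auto
  then have "0 < q" "q < H - 1 / 3"
    using assms by (simp_all only: q_def divide_less_eq) auto
  then show "1 / 3 < rate_exp H m" "rate_exp H m < H" by (simp_all add: rate_exp_def q_def[symmetric])
qed

lemma rate_exp_above:
  assumes H: "1 / 3 < H" and \<beta>: "\<beta> < H"
  obtains m where "\<beta> < rate_exp H m"
proof -
  obtain m :: nat where m: "(H - 1 / 3) / (H - \<beta>) < real m" using reals_Archimedean2 by blast
  then have "(H - 1 / 3) < (H - \<beta>) * (real m + 2)"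
    using \<beta> by (simp add: divide_less_eq algebra_simps)
  then have "(H - 1 / 3) / (real m + 2) < H - \<beta>" by (simp add: divide_less_eq)
  then show thesis by (intro that[of m]) (simp add: rate_exp_def)
qed

lemma area_rate_mono:
  assumes "area_rate \<beta> \<kappa> n x y C" "C \<le> C'"
  shows "area_rate \<beta> \<kappa> n x y C'"
  unfolding area_rate_def
proof (intro allI impI)
  fix k and \<delta> s t :: real
  assume *: "(1 / 2) ^ Suc k \<le> \<delta>" "\<delta> \<le> (1 / 2) ^ k" "- real n \<le> s" "s < t" "t \<le> real n"
  have "\<bar>area \<delta> x y s t - area ((1 / 2) ^ k) x y s t\<bar> \<le> C * 2 powr (- \<kappa> * k) * (t - s) powr (2 * \<beta>)"
    using assms(1) * unfolding area_rate_def by blast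
  also have "\<dots> \<le> C' * 2 powr (- \<kappa> * k) * (t - s) powr (2 * \<beta>)"
    using assms(2) by (intro mult_right_mono) auto
  finally show "\<bar>area \<delta> x y s t - area ((1 / 2) ^ k) x y s t\<bar> \<le> C' * 2 powr (- \<kappa> * k) * (t - s) powr (2 * \<beta>)" .
qed

lemma area_rate_nat: "area_rate \<beta> \<kappa> n x y C \<Longrightarrow> \<exists>C::nat. area_rate \<beta> \<kappa> n x y (real C)"
proof -
  assume "area_rate \<beta> \<kappa> n x y C"
  moreover obtain m :: nat where "C \<le> real m" using real_arch_simple by blast
  ultimately show ?thesis using area_rate_mono by blast
qed

lemma wiener_shift_holder:
  assumes \<omega>: "\<omega> \<in> holder_paths H"
  shows "wiener_shift u \<omega> \<in> holder_paths H"
  unfolding holder_paths_def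
proof (intro CollectI conjI allI impI)
  have c: "continuous_on UNIV \<omega>" using \<omega> by (simp add: holder_paths_def)
  show "continuous_on UNIV (wiener_shift u \<omega>)"
    unfolding wiener_shift_def by (intro continuous_intros continuous_on_shift c)
  show "wiener_shift u \<omega> 0 = 0" by (simp add: wiener_shift_def)
  fix \<gamma> T :: real assume *: "0 < \<gamma> \<and> \<gamma> < H \<and> 0 < T"
  with abs_ge_zero[of u] obtain C where C: "\<forall>s\<in>{-(T + \<bar>u\<bar>)..T + \<bar>u\<bar>}. \<forall>t\<in>{-(T + \<bar>u\<bar>)..T + \<bar>u\<bar>}. norm (\<omega> t - \<omega> s) \<le> C * \<bar>t - s\<bar> powr \<gamma>"
    using \<omega> add_pos_nonneg[of T "\<bar>u\<bar>"] unfolding holder_paths_def by blast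
  have "norm (wiener_shift u \<omega> t - wiener_shift u \<omega> s) \<le> C * \<bar>t - s\<bar> powr \<gamma>" if "s \<in> {-T..T}" "t \<in> {-T..T}" for s t
  proof -
    have "s + u \<in> {-(T + \<bar>u\<bar>)..T + \<bar>u\<bar>}" "t + u \<in> {-(T + \<bar>u\<bar>)..T + \<bar>u\<bar>}" using that by auto
    then have "norm (\<omega> (t + u) - \<omega> (s + u)) \<le> C * \<bar>(t + u) - (s + u)\<bar> powr \<gamma>" using C by blast
    then show ?thesis by (simp add: wiener_shift_def)
  qed
  then show "\<exists>C. \<forall>s\<in>{-T..T}. \<forall>t\<in>{-T..T}. norm (wiener_shift u \<omega> t - wiener_shift u \<omega> s) \<le> C * \<bar>t - s\<bar> powr \<gamma>" by blast
qed

lemma wiener_shift_good: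
  assumes \<omega>: "\<omega> \<in> good_paths H"
  shows "wiener_shift u \<omega> \<in> good_paths H"
proof -
  have h: "\<omega> \<in> holder_paths H" using \<omega> by (simp add: good_paths_def)
  then have "continuous_on UNIV \<omega>" by (simp add: holder_paths_def)
  then have c: "continuous_on UNIV (\<lambda>r. \<omega> r $ i)" for i by (rule continuous_on_component)
  have "\<exists>C::nat. area_rate (rate_exp H m) ((H - rate_exp H m) / 2) n (\<lambda>r. wiener_shift u \<omega> r $ i) (\<lambda>r. wiener_shift u \<omega> r $ j) C"
    if ij: "i \<noteq> j" for i j n m
  proof -
    define n' where "n' = n + nat \<lceil>\<bar>u\<bar>\<rceil>"
    have n': "real n + \<bar>u\<bar> \<le> real n'" by (simp add: n'_def of_nat_ceiling)
    obtain C :: nat where C: "area_rate (rate_exp H m) ((H - rate_exp H m) / 2) n' (\<lambda>r. \<omega> r $ i) (\<lambda>r. \<omega> r $ j) C"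
      using \<omega> ij unfolding good_paths_def by blast
    have "area_rate (rate_exp H m) ((H - rate_exp H m) / 2) n (\<lambda>r. wiener_shift u \<omega> r $ i) (\<lambda>r. wiener_shift u \<omega> r $ j) C"
      unfolding area_rate_def
    proof (intro allI impI)
      fix k and \<delta> s t :: real
      assume *: "(1 / 2) ^ Suc k \<le> \<delta>" "\<delta> \<le> (1 / 2) ^ k" "- real n \<le> s" "s < t" "t \<le> real n"
      have \<delta>: "0 < \<delta>" using less_le_trans[OF zero_less_power *(1)] by simp
      have "- real n' \<le> s + u" "s + u < t + u" "t + u \<le> real n'" using * n' by auto
      then have "\<bar>area \<delta> (\<lambda>r. \<omega> r $ i) (\<lambda>r. \<omega> r $ j) (s + u) (t + u) - area ((1 / 2) ^ k) (\<lambda>r. \<omega> r $ i) (\<lambda>r. \<omega> r $ j) (s + u) (t + u)\<bar>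
          \<le> C * 2 powr (- ((H - rate_exp H m) / 2) * k) * ((t + u) - (s + u)) powr (2 * rate_exp H m)"
        using C * unfolding area_rate_def by blast
      then show "\<bar>area \<delta> (\<lambda>r. wiener_shift u \<omega> r $ i) (\<lambda>r. wiener_shift u \<omega> r $ j) s t -
          area ((1 / 2) ^ k) (\<lambda>r. wiener_shift u \<omega> r $ i) (\<lambda>r. wiener_shift u \<omega> r $ j) s t\<bar>
          \<le> C * 2 powr (- ((H - rate_exp H m) / 2) * k) * (t - s) powr (2 * rate_exp H m)"
        unfolding wiener_shift_def vector_minus_component
        using area_shift[OF c c less_imp_le[OF *(4)] \<delta>] area_shift[OF c c less_imp_le[OF *(4)], of "(1 / 2) ^ k"] by simp
    qed
    then show ?thesis by blast
  qed
  then show ?thesis using wiener_shift_holder[OF h] by (simp add: good_paths_def)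
qed

lemma wiener_shift_inverse: "\<omega> 0 = 0 \<Longrightarrow> wiener_shift (- u) (wiener_shift u \<omega>) = \<omega>"
  by (simp add: wiener_shift_def)

text \<open>Stability under every shift gives both inclusions, since shifts are invertible on paths
  that vanish at \<open>0\<close>.\<close>

lemma good_paths_shift_invariant: "shift_invariant H (good_paths H)"
  unfolding shift_invariant_def
proof (intro allI equalityI subsetI)
  fix u \<omega> assume "\<omega> \<in> wiener_shift u -` good_paths H \<inter> holder_paths H"
  then have "wiener_shift (- u) (wiener_shift u \<omega>) \<in> good_paths H" "\<omega> 0 = 0"
    by (auto intro: wiener_shift_good simp: holder_paths_def)
  then show "\<omega> \<in> good_paths H" by (simp add: wiener_shift_inverse)
next
  fix u \<omega> assume "\<omega> \<in> good_paths H"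
  then show "\<omega> \<in> wiener_shift u -` good_paths H \<inter> holder_paths H"
    using wiener_shift_good[of \<omega> H u] by (auto simp: good_paths_def)
qed

text \<open>Rounding down to a dyadic level preserves lower bounds that are multiples of the step of
  that level, hence the closed constraints in \<open>area_rate\<close>.\<close>

lemma dyadic_floor:
  fixes r :: real
  defines "f \<equiv> \<lambda>l. real_of_int \<lfloor>r * 2 ^ l\<rfloor> / 2 ^ l"
  shows "f l \<le> r" "r - f l \<le> (1 / 2) ^ l" "f \<longlonglongrightarrow> r" "z \<le> r \<Longrightarrow> real_of_int c = z * 2 ^ l \<Longrightarrow> z \<le> f l"
    "f l = of_rat (of_int \<lfloor>r * 2 ^ l\<rfloor> / 2 ^ l)"
proof -
  have "real_of_int \<lfloor>r * 2 ^ l\<rfloor> \<le> r * 2 ^ l" for l by simp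
  then show le: "f l \<le> r" for l by (simp add: f_def pos_divide_le_eq)
  have "r * 2 ^ l \<le> real_of_int \<lfloor>r * 2 ^ l\<rfloor> + 1" for l by linarith
  then have "r \<le> (real_of_int \<lfloor>r * 2 ^ l\<rfloor> + 1) / 2 ^ l" for l by (simp add: pos_le_divide_eq)
  then show diff: "r - f l \<le> (1 / 2) ^ l" for l
    by (simp add: f_def add_divide_distrib power_one_over algebra_simps)
  have "(\<lambda>l. r - f l) \<longlonglongrightarrow> 0"
  proof (rule tendsto_sandwich)
    show "(\<lambda>l. 0 :: real) \<longlonglongrightarrow> 0" by simp
    show "(\<lambda>l. (1 / 2 :: real) ^ l) \<longlonglongrightarrow> 0" by (rule LIMSEQ_power_zero) simp
  qed (use le diff in auto)
  then show "f \<longlonglongrightarrow> r" using tendsto_diff[OF tendsto_const[of r], of "\<lambda>l. r - f l" 0] by simp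
  show "z \<le> f l" if "z \<le> r" "real_of_int c = z * 2 ^ l"
  proof -
    have "real_of_int c \<le> r * 2 ^ l" using that by simp
    then have "c \<le> \<lfloor>r * 2 ^ l\<rfloor>" by (simp add: le_floor_iff)
    then have "z * 2 ^ l \<le> real_of_int \<lfloor>r * 2 ^ l\<rfloor>" using that(2) by (metis of_int_le_iff)
    then show ?thesis by (simp add: f_def pos_le_divide_eq)
  qed
  show "f l = of_rat (of_int \<lfloor>r * 2 ^ l\<rfloor> / 2 ^ l)" by (simp add: f_def of_rat_divide of_rat_power)
qed

text \<open>By the crude bounds the area is continuous in the scale and the endpoints, so countably
  many conditions imply all the others.\<close>

lemma area_rate_rational:
  fixes \<kappa> :: real
  assumes \<omega>: "\<omega> \<in> holder_paths H" and H: "1 / 3 < H"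
    and rat: "\<And>(k::nat) \<delta> s t. (1 / 2) ^ Suc k \<le> real_of_rat \<delta> \<Longrightarrow> real_of_rat \<delta> \<le> (1 / 2) ^ k \<Longrightarrow>
      - real n \<le> real_of_rat s \<Longrightarrow> real_of_rat s < real_of_rat t \<Longrightarrow> real_of_rat t \<le> real n \<Longrightarrow>
      \<bar>area (real_of_rat \<delta>) (\<lambda>r. \<omega> r $ i) (\<lambda>r. \<omega> r $ j) (real_of_rat s) (real_of_rat t) -
        area ((1 / 2) ^ k) (\<lambda>r. \<omega> r $ i) (\<lambda>r. \<omega> r $ j) (real_of_rat s) (real_of_rat t)\<bar>
      \<le> C * 2 powr (- \<kappa> * k) * (real_of_rat t - real_of_rat s) powr (2 * \<beta>)"
  shows "area_rate \<beta> \<kappa> n (\<lambda>r. \<omega> r $ i) (\<lambda>r. \<omega> r $ j) C"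
  unfolding area_rate_def
proof (intro allI impI)
  fix k and \<delta> s t :: real
  assume *: "(1 / 2) ^ Suc k \<le> \<delta>" "\<delta> \<le> (1 / 2) ^ k" "- real n \<le> s" "s < t" "t \<le> real n"
  obtain M K where "bounded_pair (\<lambda>r. \<omega> r $ i) (\<lambda>r. \<omega> r $ j) (real n) M K"
    using holder_bounded_pair[OF \<omega> H, of "real n" i j] by auto
  then interpret bounded_pair "\<lambda>r. \<omega> r $ i" "\<lambda>r. \<omega> r $ j" "real n" M K .
  let ?A = "\<lambda>\<delta> s t. area \<delta> (\<lambda>r. \<omega> r $ i) (\<lambda>r. \<omega> r $ j) s t"
  define h where "h = (1 / 2 :: real) ^ Suc k"
  have h: "0 < h" "h \<le> \<delta>" "h \<le> (1 / 2) ^ k" "(1 / 2 :: real) ^ k \<le> 1"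
    using * by (auto simp: h_def power_le_one)
  obtain A where A: "0 \<le> A"
    and crude: "\<And>\<eta> \<delta> \<delta>' s s' t t'. 0 < \<eta> \<Longrightarrow> \<eta> \<le> \<delta> \<Longrightarrow> \<delta> \<le> 1 \<Longrightarrow> \<eta> \<le> \<delta>' \<Longrightarrow> \<delta>' \<le> 1 \<Longrightarrow>
      -real n \<le> s' \<Longrightarrow> s' \<le> s \<Longrightarrow> s \<le> t \<Longrightarrow> s' \<le> t' \<Longrightarrow> t' \<le> t \<Longrightarrow> t \<le> real n \<Longrightarrow>
      \<bar>?A \<delta> s t - ?A \<delta>' s' t'\<bar> \<le> A / \<eta>\<^sup>2 * (\<bar>\<delta> - \<delta>'\<bar> powr (1 / 3) + (s - s') + (t - t'))"
    by (rule area_crude_bounds) blast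
  define f where "f r l = real_of_int \<lfloor>r * 2 ^ l\<rfloor> / 2 ^ l" for r :: real and l :: nat
  note f = dyadic_floor[where r=r for r, folded f_def]
  have flim: "f r \<longlonglongrightarrow> r" for r using f(3)[of r] by (simp add: f_def[abs_def])
  have ev: "\<forall>\<^sub>F l in sequentially. Suc k \<le> l \<and> f s l < f t l"
  proof (intro eventually_conj eventually_ge_at_top)
    have "\<forall>\<^sub>F l in sequentially. 0 < f t l - f s l"
      by (rule order_tendstoD(1)[OF tendsto_diff[OF flim flim]]) (use * in simp)
    then show "\<forall>\<^sub>F l in sequentially. f s l < f t l" by simp
  qed
  \<comment> \<open>From level \<open>Suc k\<close> on, the lower end \<open>h\<close> of the dyadic
    block is a multiple of the dyadic step.\<close>
  have side: "h \<le> f \<delta> l" "f \<delta> l \<le> (1 / 2) ^ k" "- real n \<le> f s l" "f t l \<le> real n" if "Suc k \<le> l" for l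
  proof -
    have "(2 :: real) ^ l = 2 ^ (l - Suc k) * 2 ^ Suc k"
      using that by (simp only: power_add[symmetric]) simp
    then have "real_of_int (2 ^ (l - Suc k)) = h * 2 ^ l"
      by (simp add: h_def power_one_over del: power_Suc)
    then show "h \<le> f \<delta> l" by (rule f(4)[OF h(2)])
    show "f \<delta> l \<le> (1 / 2) ^ k" using f(1)[of \<delta> l] * by simp
    show "- real n \<le> f s l" by (rule f(4)[OF *(3), of "- int n * 2 ^ l"]) simp
    show "f t l \<le> real n" using f(1)[of t l] * by simp
  qed
  have conv: "(\<lambda>l. ?A (g l) (f s l) (f t l)) \<longlonglongrightarrow> ?A d s t"
    if g: "g \<longlonglongrightarrow> d" "\<And>l. Suc k \<le> l \<Longrightarrow> h \<le> g l \<and> g l \<le> 1" and d: "h \<le> d" "d \<le> 1" for g d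
  proof -
    have "(\<lambda>l. ?A d s t - ?A (g l) (f s l) (f t l)) \<longlonglongrightarrow> 0"
    proof (rule Lim_null_comparison)
      show "\<forall>\<^sub>F l in sequentially. norm (?A d s t - ?A (g l) (f s l) (f t l)) \<le>
          A / h\<^sup>2 * (\<bar>d - g l\<bar> powr (1 / 3) + (s - f s l) + (t - f t l))"
        using ev
      proof eventually_elim
        case (elim l)
        then show ?case unfolding real_norm_def
          using h g(2)[of l] d side[of l] f(1) * by (intro crude) auto
      qed
      have "(\<lambda>l. \<bar>d - g l\<bar> powr (1 / 3)) \<longlonglongrightarrow> \<bar>d - d\<bar> powr (1 / 3)"
        by (intro tendsto_powr' tendsto_intros g) auto
      then have "(\<lambda>l. A / h\<^sup>2 * (\<bar>d - g l\<bar> powr (1 / 3) + (s - f s l) + (t - f t l))) \<longlonglongrightarrow>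
          A / h\<^sup>2 * (\<bar>d - d\<bar> powr (1 / 3) + (s - s) + (t - t))"
        by (intro tendsto_mult tendsto_add tendsto_diff tendsto_const flim)
      then show "(\<lambda>l. A / h\<^sup>2 * (\<bar>d - g l\<bar> powr (1 / 3) + (s - f s l) + (t - f t l))) \<longlonglongrightarrow> 0" by simp
    qed
    then show ?thesis using tendsto_diff[OF tendsto_const[of "?A d s t"], of "\<lambda>l. ?A d s t - ?A (g l) (f s l) (f t l)" 0] by simp
  qed
  have c1: "(\<lambda>l. ?A (f \<delta> l) (f s l) (f t l)) \<longlonglongrightarrow> ?A \<delta> s t"
    using h side * by (intro conv flim) fastforce+
  have c2: "(\<lambda>l. ?A ((1 / 2) ^ k) (f s l) (f t l)) \<longlonglongrightarrow> ?A ((1 / 2) ^ k) s t"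
    using h by (intro conv) auto
  show "\<bar>?A \<delta> s t - ?A ((1 / 2) ^ k) s t\<bar> \<le> C * 2 powr (- \<kappa> * k) * (t - s) powr (2 * \<beta>)"
  proof (rule tendsto_le[OF sequentially_bot])
    show "(\<lambda>l. \<bar>?A (f \<delta> l) (f s l) (f t l) - ?A ((1 / 2) ^ k) (f s l) (f t l)\<bar>) \<longlonglongrightarrow> \<bar>?A \<delta> s t - ?A ((1 / 2) ^ k) s t\<bar>"
      by (intro tendsto_intros c1 c2)
    show "(\<lambda>l. C * 2 powr (- \<kappa> * k) * (f t l - f s l) powr (2 * \<beta>)) \<longlonglongrightarrow> C * 2 powr (- \<kappa> * k) * (t - s) powr (2 * \<beta>)"
      using * by (intro tendsto_mult tendsto_const tendsto_powr tendsto_diff flim) auto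
    show "\<forall>\<^sub>F l in sequentially. \<bar>?A (f \<delta> l) (f s l) (f t l) - ?A ((1 / 2) ^ k) (f s l) (f t l)\<bar>
        \<le> C * 2 powr (- \<kappa> * k) * (f t l - f s l) powr (2 * \<beta>)"
      using ev
    proof eventually_elim
      case (elim l)
      then show ?case
        using rat[of k "of_int \<lfloor>\<delta> * 2 ^ l\<rfloor> / 2 ^ l" "of_int \<lfloor>s * 2 ^ l\<rfloor> / 2 ^ l" "of_int \<lfloor>t * 2 ^ l\<rfloor> / 2 ^ l"]
          side[of l] unfolding f(5)[symmetric] h_def by auto
    qed
  qed
qed

section \<open>Measurability and full measure of the invariant set\<close>

context canonical_fbm
begin

lemma good_paths_measurable:
  assumes H: "1 / 3 < H"
  shows "good_paths H \<in> sets P"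
proof -
  define Q where "Q i j n m (C::nat) k \<delta> s t \<omega> \<longleftrightarrow> ((1 / 2) ^ Suc k \<le> real_of_rat \<delta> \<longrightarrow> real_of_rat \<delta> \<le> (1 / 2) ^ k \<longrightarrow>
      - real n \<le> real_of_rat s \<longrightarrow> real_of_rat s < real_of_rat t \<longrightarrow> real_of_rat t \<le> real n \<longrightarrow>
      \<bar>area (real_of_rat \<delta>) (\<lambda>r. \<omega> r $ i) (\<lambda>r. \<omega> r $ j) (real_of_rat s) (real_of_rat t) -
        area ((1 / 2) ^ k) (\<lambda>r. \<omega> r $ i) (\<lambda>r. \<omega> r $ j) (real_of_rat s) (real_of_rat t)\<bar>
      \<le> C * 2 powr (- ((H - rate_exp H m) / 2) * k) * (real_of_rat t - real_of_rat s) powr (2 * rate_exp H m))"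
    for i j :: 'd and n m C k :: nat and \<delta> s t :: rat and \<omega> :: "real \<Rightarrow> real ^ 'd"
  have Q: "{\<omega> \<in> space P. Q i j n m C k \<delta> s t \<omega>} \<in> sets P" for i j n m C k \<delta> s t
  \<comment> \<open>In this case the scale is positive and the endpoints are ordered, as
    \<open>area_measurable\<close> demands; otherwise \<open>Q\<close> holds vacuously for every
    path.\<close>
  proof (cases "(1 / 2) ^ Suc k \<le> real_of_rat \<delta> \<and> real_of_rat s < real_of_rat t")
    case True
    then have "0 < real_of_rat \<delta>" 
      using less_le_trans[OF zero_less_power[of "1 / 2 :: real" "Suc k"], of "real_of_rat \<delta>"] by (simp del: power_Suc)
    then have [measurable]: "(\<lambda>\<omega>. area (real_of_rat \<delta>) (\<lambda>r. \<omega> r $ i) (\<lambda>r. \<omega> r $ j) (real_of_rat s) (real_of_rat t)) \<in> borel_measurable P"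
      "(\<lambda>\<omega>. area ((1 / 2) ^ k) (\<lambda>r. \<omega> r $ i) (\<lambda>r. \<omega> r $ j) (real_of_rat s) (real_of_rat t)) \<in> borel_measurable P"
      using True by (auto intro!: area_measurable)
    show ?thesis unfolding Q_def by measurable
  next
    case False
    then have "{\<omega> \<in> space P. Q i j n m C k \<delta> s t \<omega>} = space P" by (auto simp: Q_def)
    then show ?thesis by simp
  qed
  have "good_paths H = {\<omega> \<in> space P. \<forall>i j n m. i \<noteq> j \<longrightarrow> (\<exists>C. \<forall>k \<delta> s t. Q i j n m C k \<delta> s t \<omega>)}"
  proof (intro equalityI subsetI)
    fix \<omega> :: "real \<Rightarrow> real ^ 'd" assume \<omega>: "\<omega> \<in> good_paths H"
    have "\<exists>C. \<forall>k \<delta> s t. Q i j n m C k \<delta> s t \<omega>" if ij: "i \<noteq> j" for i j n m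
    proof -
      obtain C :: nat where "area_rate (rate_exp H m) ((H - rate_exp H m) / 2) n (\<lambda>r. \<omega> r $ i) (\<lambda>r. \<omega> r $ j) C"
        using \<omega> ij unfolding good_paths_def by blast
      then show ?thesis unfolding Q_def area_rate_def by blast
    qed
    then show "\<omega> \<in> {\<omega> \<in> space P. \<forall>i j n m. i \<noteq> j \<longrightarrow> (\<exists>C. \<forall>k \<delta> s t. Q i j n m C k \<delta> s t \<omega>)}"
      using \<omega> by (simp add: good_paths_def space_P)
  next
    fix \<omega> :: "real \<Rightarrow> real ^ 'd" assume \<omega>: "\<omega> \<in> {\<omega> \<in> space P. \<forall>i j n m. i \<noteq> j \<longrightarrow> (\<exists>C. \<forall>k \<delta> s t. Q i j n m C k \<delta> s t \<omega>)}"
    then have h: "\<omega> \<in> holder_paths H" by (simp add: space_P)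
    have "\<exists>C::nat. area_rate (rate_exp H m) ((H - rate_exp H m) / 2) n (\<lambda>r. \<omega> r $ i) (\<lambda>r. \<omega> r $ j) C" if ij: "i \<noteq> j" for i j n m
    proof -
      obtain C where C: "\<And>k \<delta> s t. Q i j n m C k \<delta> s t \<omega>" using \<omega> ij by blast
      have "area_rate (rate_exp H m) ((H - rate_exp H m) / 2) n (\<lambda>r. \<omega> r $ i) (\<lambda>r. \<omega> r $ j) C"
        by (rule area_rate_rational[OF h H]) (use C in \<open>unfold Q_def, blast\<close>)
      then show ?thesis by blast
    qed
    then show "\<omega> \<in> good_paths H" using h by (simp add: good_paths_def)
  qed
  also have "\<dots> \<in> sets P"
    by (intro sets.sets_Collect_countable_All sets.sets_Collect_countable_Ex sets.sets_Collect_imp sets.sets_Collect_const Q)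
  finally show ?thesis .
qed

lemma AE_good_paths:
  assumes H: "1 / 3 < H" "H \<le> 1 / 2"
  shows "AE \<omega> in P. \<omega> \<in> good_paths H"
proof -
  have "AE \<omega> in P. \<forall>i j. \<forall>n m. i \<noteq> j \<longrightarrow>
      (\<exists>C::nat. area_rate (rate_exp H m) ((H - rate_exp H m) / 2) n (\<lambda>r. \<omega> r $ i) (\<lambda>r. \<omega> r $ j) C)"
  proof (subst AE_all_countable, intro allI, subst AE_all_countable, intro allI, subst AE_all_countable, intro allI,
      subst AE_all_countable, intro allI)
    fix i j :: 'd and n m
    show "AE \<omega> in P. i \<noteq> j \<longrightarrow> (\<exists>C::nat. area_rate (rate_exp H m) ((H - rate_exp H m) / 2) n (\<lambda>r. \<omega> r $ i) (\<lambda>r. \<omega> r $ j) C)"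
    proof (cases "i = j")
      case False
      from AE_area_rate[OF H rate_exp_bounds[OF H(1)] False, where n=n] show ?thesis
        by eventually_elim (use area_rate_nat in blast)
    qed simp
  qed
  then show ?thesis
    using AE_space by eventually_elim (simp add: good_paths_def space_P)
qed

end

section \<open>The lift\<close>

definition area_lim :: "(real \<Rightarrow> real) \<Rightarrow> (real \<Rightarrow> real) \<Rightarrow> real \<Rightarrow> real \<Rightarrow> real" where
  "area_lim x y s t = lim (\<lambda>k. area ((1 / 2) ^ k) x y s t)"

text \<open>The induction runs on the telescoping bound
  \<open>c / (1 - \<rho>) * (\<rho> ^ k - \<rho> ^ (k + j))\<close>, which closes exactly; letting
  \<open>j\<close> grow gives the tail estimate.\<close>

lemma geometric_differences_converge:
  fixes a :: "nat \<Rightarrow> real"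
  assumes d: "\<And>k. \<bar>a (Suc k) - a k\<bar> \<le> c * \<rho> ^ k" and \<rho>: "0 < \<rho>" "\<rho> < 1" and c: "0 \<le> c"
  shows "a \<longlonglongrightarrow> lim a" "\<bar>a k - lim a\<bar> \<le> c / (1 - \<rho>) * \<rho> ^ k"
proof -
  have "summable (\<lambda>k. a (Suc k) - a k)"
    by (rule summable_comparison_test[of _ "\<lambda>k. c * \<rho> ^ k"]) (use d \<rho> in \<open>auto intro!: summable_mult summable_geometric exI\<close>)
  then have "(\<lambda>n. \<Sum>k<n. a (Suc k) - a k) \<longlonglongrightarrow> (\<Sum>k. a (Suc k) - a k)" by (rule summable_LIMSEQ)
  then have "(\<lambda>n. (a n - a 0) + a 0) \<longlonglongrightarrow> (\<Sum>k. a (Suc k) - a k) + a 0"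
    unfolding sum_lessThan_telescope by (intro tendsto_add tendsto_const)
  then have "convergent a" by (auto simp: convergent_def)
  then show lim: "a \<longlonglongrightarrow> lim a" by (simp add: convergent_LIMSEQ_iff)
  have "\<bar>a (k + j) - a k\<bar> \<le> c / (1 - \<rho>) * (\<rho> ^ k - \<rho> ^ (k + j))" for j
  proof (induction j)
    case (Suc j)
    have "\<bar>a (k + Suc j) - a k\<bar> \<le> c * \<rho> ^ (k + j) + c / (1 - \<rho>) * (\<rho> ^ k - \<rho> ^ (k + j))"
      using d[of "k + j"] Suc by simp
    also have "c * \<rho> ^ (k + j) = c / (1 - \<rho>) * (\<rho> ^ (k + j) - \<rho> ^ (k + Suc j))"
    proof -
      have "\<rho> ^ (k + j) - \<rho> ^ (k + Suc j) = (1 - \<rho>) * \<rho> ^ (k + j)" by (simp add: left_diff_distrib)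
      then show ?thesis using \<rho> by simp
    qed
    finally show ?case by (simp add: right_diff_distrib)
  qed simp
  moreover have "c / (1 - \<rho>) * (\<rho> ^ k - \<rho> ^ (k + j)) \<le> c / (1 - \<rho>) * \<rho> ^ k" for j
    using c \<rho> by (intro mult_left_mono) auto
  ultimately have le: "\<bar>a (j + k) - a k\<bar> \<le> c / (1 - \<rho>) * \<rho> ^ k" for j
    unfolding add.commute[of j] by (rule order_trans)
  have "(\<lambda>j. \<bar>a (j + k) - a k\<bar>) \<longlonglongrightarrow> \<bar>lim a - a k\<bar>"
    by (intro tendsto_intros LIMSEQ_ignore_initial_segment lim)
  then have "\<bar>lim a - a k\<bar> \<le> c / (1 - \<rho>) * \<rho> ^ k"
    by (rule LIMSEQ_le_const2) (use le in auto)
  then show "\<bar>a k - lim a\<bar> \<le> c / (1 - \<rho>) * \<rho> ^ k" by (simp add: abs_minus_commute)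
qed

text \<open>A scale costs \<open>C\<close> within its dyadic block, and the finer blocks cost a
  geometric series with ratio \<open>2 powr - \<kappa>\<close>.\<close>

lemma area_rate_limit:
  assumes rate: "area_rate \<beta> \<kappa> n x y C" and C: "0 \<le> C" and \<kappa>: "0 < \<kappa>"
    and st: "- real n \<le> s" "s < t" "t \<le> real n"
  shows "(\<lambda>k. area ((1 / 2) ^ k) x y s t) \<longlonglongrightarrow> area_lim x y s t"
    and "(1 / 2) ^ Suc k \<le> \<delta> \<Longrightarrow> \<delta> \<le> (1 / 2) ^ k \<Longrightarrow>
      \<bar>area \<delta> x y s t - area_lim x y s t\<bar> \<le> (C + C / (1 - 2 powr - \<kappa>)) * 2 powr (- \<kappa> * k) * (t - s) powr (2 * \<beta>)"
proof -
  define \<rho> where "\<rho> = 2 powr (- \<kappa>)"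
  have \<rho>: "0 < \<rho>" "\<rho> < 1" using \<kappa> by (auto simp: \<rho>_def powr_less_one)
  have \<rho>k: "2 powr (- \<kappa> * k) = \<rho> ^ k" for k by (simp add: \<rho>_def powr_power mult.commute)
  let ?w = "(t - s) powr (2 * \<beta>)"
  have d: "\<bar>area \<delta> x y s t - area ((1 / 2) ^ k) x y s t\<bar> \<le> C * ?w * \<rho> ^ k" if "(1 / 2) ^ Suc k \<le> \<delta>" "\<delta> \<le> (1 / 2) ^ k" for k \<delta>
  proof -
    have "\<bar>area \<delta> x y s t - area ((1 / 2) ^ k) x y s t\<bar> \<le> C * 2 powr (- \<kappa> * k) * ?w"
      using rate that st unfolding area_rate_def by blast
    then show ?thesis by (simp only: \<rho>k ac_simps)
  qed
  have d': "\<bar>area ((1 / 2) ^ Suc k) x y s t - area ((1 / 2) ^ k) x y s t\<bar> \<le> C * ?w * \<rho> ^ k" for k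
    by (rule d) auto
  have cw: "0 \<le> C * ?w" using C by simp
  show "(\<lambda>k. area ((1 / 2) ^ k) x y s t) \<longlonglongrightarrow> area_lim x y s t"
    unfolding area_lim_def by (rule geometric_differences_converge[OF d' \<rho> cw])
  assume \<delta>: "(1 / 2) ^ Suc k \<le> \<delta>" "\<delta> \<le> (1 / 2) ^ k"
  have "\<bar>area ((1 / 2) ^ k) x y s t - area_lim x y s t\<bar> \<le> C * ?w / (1 - \<rho>) * \<rho> ^ k"
    unfolding area_lim_def by (rule geometric_differences_converge[OF d' \<rho> cw])
  then have "\<bar>area \<delta> x y s t - area_lim x y s t\<bar> \<le> C * ?w * \<rho> ^ k + C * ?w / (1 - \<rho>) * \<rho> ^ k"
    using d[OF \<delta>] by linarith
  also have "\<dots> = (C + C / (1 - \<rho>)) * \<rho> ^ k * ?w" by (simp add: algebra_simps)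
  finally show "\<bar>area \<delta> x y s t - area_lim x y s t\<bar> \<le> (C + C / (1 - 2 powr - \<kappa>)) * 2 powr (- \<kappa> * k) * ?w"
    unfolding \<rho>k by (simp add: \<rho>_def)
qed

lemma tendsto_powr_at_right_0:
  fixes c :: real
  assumes "0 < c"
  shows "((\<lambda>\<delta>. \<delta> powr c) \<longlongrightarrow> 0) (at_right 0)"
proof (rule tendsto_zero_powrI[OF tendsto_ident_at tendsto_const _ assms])
  show "\<forall>\<^sub>F \<delta> in at_right (0 :: real). 0 \<le> \<delta>"
    unfolding eventually_at_right_field by (intro exI[of _ 1]) auto
qed

lemma area_lim_refl: "area_lim x y s s = 0"
  unfolding area_lim_def area_refl by (rule limI) simp

text \<open>Differentiability of a primitive at \<open>t\<close>, read along the steps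
  \<open>(1 / 2) ^ k\<close>.\<close>

lemma avg_tendsto:
  assumes "continuous_on UNIV x"
  shows "(\<lambda>k. avg ((1 / 2) ^ k) x t) \<longlonglongrightarrow> x t"
proof -
  have "((\<lambda>h. (prim x (t + h) - prim x t) / h) \<longlongrightarrow> x t) (at 0)"
    using prim_has_derivative[OF assms, of t] by (simp add: DERIV_def)
  moreover have "filterlim (\<lambda>k. (1 / 2 :: real) ^ k) (at 0) sequentially"
    unfolding filterlim_at by (auto intro: LIMSEQ_power_zero)
  ultimately show ?thesis unfolding avg_def by (rule filterlim_compose)
qed

section \<open>Limit areas of a path in the invariant set\<close>

context
  fixes H :: real and \<omega> :: "real \<Rightarrow> real ^ 'd"
  assumes H: "1 / 3 < H" and good: "\<omega> \<in> good_paths H"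
begin

lemma good_continuous: "continuous_on UNIV (\<lambda>r. \<omega> r $ i)"
  using good by (intro continuous_on_component) (simp add: good_paths_def holder_paths_def)

lemma good_rate:
  assumes "i \<noteq> j"
  obtains C where "0 \<le> C"
    "\<And>k \<delta> s t. (1 / 2) ^ Suc k \<le> \<delta> \<Longrightarrow> \<delta> \<le> (1 / 2) ^ k \<Longrightarrow> - real n \<le> s \<Longrightarrow> s < t \<Longrightarrow> t \<le> real n \<Longrightarrow>
      \<bar>area \<delta> (\<lambda>r. \<omega> r $ i) (\<lambda>r. \<omega> r $ j) s t - area_lim (\<lambda>r. \<omega> r $ i) (\<lambda>r. \<omega> r $ j) s t\<bar>
      \<le> C * 2 powr (- ((H - rate_exp H m) / 2) * k) * (t - s) powr (2 * rate_exp H m)"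
proof -
  obtain C :: nat where C: "area_rate (rate_exp H m) ((H - rate_exp H m) / 2) n (\<lambda>r. \<omega> r $ i) (\<lambda>r. \<omega> r $ j) C"
    using good assms unfolding good_paths_def by blast
  let ?\<kappa> = "(H - rate_exp H m) / 2"
  have \<kappa>: "0 < ?\<kappa>" using rate_exp_bounds[OF H, of m] by simp
  show thesis
  proof (rule that[of "C + C / (1 - 2 powr - ?\<kappa>)"])
    have "2 powr - ?\<kappa> < 1" using \<kappa> by (auto simp: powr_less_one)
    then show "0 \<le> C + C / (1 - 2 powr - ?\<kappa>)" by (intro add_nonneg_nonneg divide_nonneg_nonneg) auto
  qed (rule area_rate_limit(2)[OF C _ \<kappa>], auto)
qed

lemma good_area_tendsto:
  assumes "i \<noteq> j" "s \<le> t"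
  shows "(\<lambda>k. area ((1 / 2) ^ k) (\<lambda>r. \<omega> r $ i) (\<lambda>r. \<omega> r $ j) s t) \<longlonglongrightarrow> area_lim (\<lambda>r. \<omega> r $ i) (\<lambda>r. \<omega> r $ j) s t"
proof (cases "s = t")
  case True
  then show ?thesis by (simp add: area_refl area_lim_refl)
next
  case False
  obtain n :: nat where n: "max \<bar>s\<bar> \<bar>t\<bar> \<le> real n" using real_arch_simple by blast
  obtain C :: nat where C: "area_rate (rate_exp H 0) ((H - rate_exp H 0) / 2) n (\<lambda>r. \<omega> r $ i) (\<lambda>r. \<omega> r $ j) C"
    using good assms(1) unfolding good_paths_def by blast
  show ?thesis
    by (rule area_rate_limit(1)[OF C]) (use False assms n rate_exp_bounds[OF H, of 0] in auto)
qed

lemma good_area_lim_by_parts: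
  assumes ij: "i \<noteq> j" and st: "s \<le> t"
  shows "area_lim (\<lambda>r. \<omega> r $ i) (\<lambda>r. \<omega> r $ j) s t + area_lim (\<lambda>r. \<omega> r $ j) (\<lambda>r. \<omega> r $ i) s t =
    (\<omega> t $ i - \<omega> s $ i) * (\<omega> t $ j - \<omega> s $ j)"
proof (rule LIMSEQ_unique)
  let ?a = "\<lambda>i k t. avg ((1 / 2) ^ k) (\<lambda>r. \<omega> r $ i) t"
  show "(\<lambda>k. (?a i k t - ?a i k s) * (?a j k t - ?a j k s)) \<longlonglongrightarrow> (\<omega> t $ i - \<omega> s $ i) * (\<omega> t $ j - \<omega> s $ j)"
    by (intro tendsto_intros avg_tendsto good_continuous)
  show "(\<lambda>k. (?a i k t - ?a i k s) * (?a j k t - ?a j k s)) \<longlonglongrightarrow>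
      area_lim (\<lambda>r. \<omega> r $ i) (\<lambda>r. \<omega> r $ j) s t + area_lim (\<lambda>r. \<omega> r $ j) (\<lambda>r. \<omega> r $ i) s t"
    unfolding area_by_parts[OF good_continuous good_continuous st, symmetric]
    by (intro tendsto_add good_area_tendsto ij ij[symmetric] st)
qed

text \<open>The areas at dyadic scales are continuous in the endpoints and converge uniformly on
  bounded windows. Continuity on the unbounded domain is then a local matter, with the point in the
  interior of a large window.\<close>

lemma good_area_lim_continuous:
  assumes ij: "i \<noteq> j"
  shows "continuous_on {z. fst z \<le> snd z} (\<lambda>z. area_lim (\<lambda>r. \<omega> r $ i) (\<lambda>r. \<omega> r $ j) (fst z) (snd z))"
proof -
  let ?A = "\<lambda>k z. area ((1 / 2) ^ k) (\<lambda>r. \<omega> r $ i) (\<lambda>r. \<omega> r $ j) (fst z) (snd z)"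
  let ?L = "\<lambda>z. area_lim (\<lambda>r. \<omega> r $ i) (\<lambda>r. \<omega> r $ j) (fst z) (snd z)"
  have cA: "continuous_on {z. fst z \<le> snd z} (?A k)" for k
  proof -
    let ?d = "(1 / 2 :: real) ^ k" and ?x = "\<lambda>r. \<omega> r $ i" and ?y = "\<lambda>r. \<omega> r $ j"
    let ?h = "\<lambda>r. avg ?d ?x r * ((?y (r + ?d) - ?y r) / ?d)"
    have h: "continuous_on UNIV ?h"
      by (intro continuous_intros continuous_on_avg continuous_on_diff_quotient good_continuous)
    have "continuous_on {z. fst z \<le> snd z} (\<lambda>z. prim ?h (snd z) - prim ?h (fst z) -
        avg ?d ?x (fst z) * (avg ?d ?y (snd z) - avg ?d ?y (fst z)))"
      by (intro continuous_intros continuous_on_compose2[OF continuous_on_prim[OF h, of UNIV]]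
          continuous_on_compose2[OF continuous_on_avg[OF good_continuous, of UNIV]]) auto
    then show ?thesis
      by (rule continuous_on_eq) (simp add: area_eq_prim[OF good_continuous good_continuous])
  qed
  have loc: "continuous_on ({z. fst z \<le> snd z} \<inter> ({- real n..real n} \<times> {- real n..real n})) ?L" (is "continuous_on ?S _") for n
  proof (rule uniform_limit_theorem)
    show "\<forall>\<^sub>F k in sequentially. continuous_on ?S (?A k)"
      by (intro always_eventually allI continuous_on_subset[OF cA]) auto
    obtain C where C: "0 \<le> C" "\<And>k \<delta> s t. (1 / 2) ^ Suc k \<le> \<delta> \<Longrightarrow> \<delta> \<le> (1 / 2) ^ k \<Longrightarrow> - real n \<le> s \<Longrightarrow> s < t \<Longrightarrow> t \<le> real n \<Longrightarrow>
      \<bar>area \<delta> (\<lambda>r. \<omega> r $ i) (\<lambda>r. \<omega> r $ j) s t - area_lim (\<lambda>r. \<omega> r $ i) (\<lambda>r. \<omega> r $ j) s t\<bar>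
      \<le> C * 2 powr (- ((H - rate_exp H 0) / 2) * k) * (t - s) powr (2 * rate_exp H 0)"
      by (rule good_rate[OF ij]) blast
    define \<rho> where "\<rho> = 2 powr (- ((H - rate_exp H 0) / 2))"
    have b: "1 / 3 < rate_exp H 0" "rate_exp H 0 < H" by (rule rate_exp_bounds[OF H])+
    have \<rho>: "0 < \<rho>" "\<rho> < 1" using b by (auto simp: \<rho>_def powr_less_one)
    have \<rho>k: "2 powr (- ((H - rate_exp H 0) / 2) * k) = \<rho> ^ k" for k by (simp add: \<rho>_def powr_power mult.commute)
    have bound: "\<bar>?A k z - ?L z\<bar> \<le> C * (2 * real n) powr (2 * rate_exp H 0) * \<rho> ^ k" if z: "z \<in> ?S" for k z
    proof (cases "fst z = snd z")
      case True
      then show ?thesis using C \<rho> by (simp add: area_refl area_lim_refl)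
    next
      case False
      then have "\<bar>?A k z - ?L z\<bar> \<le> C * \<rho> ^ k * (snd z - fst z) powr (2 * rate_exp H 0)"
        using C(2)[of k "(1 / 2) ^ k" "fst z" "snd z"] z unfolding \<rho>k by (auto simp: mem_Times_iff)
      also have "\<dots> \<le> C * \<rho> ^ k * (2 * real n) powr (2 * rate_exp H 0)"
        using C \<rho> z b by (intro mult_left_mono powr_mono2) (auto simp: mem_Times_iff)
      finally show ?thesis by (simp add: ac_simps)
    qed
    have "(\<lambda>k. C * (2 * real n) powr (2 * rate_exp H 0) * \<rho> ^ k) \<longlonglongrightarrow> C * (2 * real n) powr (2 * rate_exp H 0) * 0"
      using \<rho> by (intro tendsto_mult tendsto_const LIMSEQ_power_zero) auto
    then have lim0: "(\<lambda>k. C * (2 * real n) powr (2 * rate_exp H 0) * \<rho> ^ k) \<longlonglongrightarrow> 0" by simp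
    show "uniform_limit ?S ?A ?L sequentially"
    proof (rule uniform_limitI)
      fix e :: real assume "0 < e"
      from order_tendstoD(2)[OF lim0 this]
      show "\<forall>\<^sub>F k in sequentially. \<forall>z\<in>?S. dist (?A k z) (?L z) < e"
      proof eventually_elim
        case (elim k)
        then show ?case using bound[of _ k] by (auto simp: dist_real_def intro: le_less_trans)
      qed
    qed
  qed simp
  show ?thesis unfolding continuous_on_eq_continuous_within
  proof
    fix z :: "real \<times> real" assume z: "z \<in> {z. fst z \<le> snd z}"
    obtain n :: nat where n: "max \<bar>fst z\<bar> \<bar>snd z\<bar> < real n" using reals_Archimedean2 by blast
    let ?S = "{z. fst z \<le> snd z} \<inter> ({- real n..real n} \<times> {- real n..real n})"
    have "at z within {z. fst z \<le> snd z} = at z within ?S"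
      by (rule at_within_nhd[of z "{- real n<..<real n} \<times> {- real n<..<real n}"])
        (use n in \<open>auto simp: mem_Times_iff intro!: open_Times\<close>)
    moreover have "z \<in> ?S" using z n by (auto simp: mem_Times_iff)
    then have "continuous (at z within ?S) ?L"
      using loc[of n] unfolding continuous_on_eq_continuous_within by blast
    ultimately show "continuous (at z within {z. fst z \<le> snd z}) ?L" by simp
  qed
qed

end

text \<open>On exceptional paths any continuous values satisfying the symmetry relation would do.\<close>

definition lift2 :: "real \<Rightarrow> (real \<Rightarrow> real ^ ('d :: {finite, linorder})) \<Rightarrow> real \<Rightarrow> real \<Rightarrow>
    real ^ ('d :: {finite, linorder}) ^ ('d :: {finite, linorder})" where
  "lift2 H \<omega> s t = (\<chi> i j. if i = j then (\<omega> t $ i - \<omega> s $ i)\<^sup>2 / 2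
     else if \<omega> \<in> good_paths H then area_lim (\<lambda>r. \<omega> r $ i) (\<lambda>r. \<omega> r $ j) s t
     else if i < j then 0 else (\<omega> t $ i - \<omega> s $ i) * (\<omega> t $ j - \<omega> s $ j))"

lemma lift2_continuous:
  assumes H: "1 / 3 < H" and \<omega>: "\<omega> \<in> holder_paths H"
  shows "continuous_on {(s, t). s \<le> t} (\<lambda>(s, t). lift2 H \<omega> s t)"
proof -
  have c: "continuous_on UNIV (\<lambda>r. \<omega> r $ i)" for i
    using \<omega> by (intro continuous_on_component) (simp add: holder_paths_def)
  have inc: "continuous_on {z. fst z \<le> snd z} (\<lambda>z. \<omega> (snd z) $ i - \<omega> (fst z) $ i)" for i
    by (intro continuous_intros continuous_on_compose2[OF c]) auto
  have "continuous_on {z. fst z \<le> snd z} (\<lambda>z. if i = j then (\<omega> (snd z) $ i - \<omega> (fst z) $ i)\<^sup>2 / 2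
     else if \<omega> \<in> good_paths H then area_lim (\<lambda>r. \<omega> r $ i) (\<lambda>r. \<omega> r $ j) (fst z) (snd z)
     else if i < j then 0 else (\<omega> (snd z) $ i - \<omega> (fst z) $ i) * (\<omega> (snd z) $ j - \<omega> (fst z) $ j))" for i j
    by (cases "i = j"; cases "\<omega> \<in> good_paths H"; cases "i < j")
      (auto intro!: continuous_intros inc good_area_lim_continuous[OF H])
  then have "continuous_on {z. fst z \<le> snd z} (\<lambda>z. lift2 H \<omega> (fst z) (snd z))"
    unfolding lift2_def by (intro continuous_on_vec_lambda)
  then show ?thesis by (simp add: split_def)
qed

section \<open>Mean-square convergence of left-point sums to the limit areas\<close>

context canonical_fbm
begin

text \<open>Convergence of the areas is known on \<open>good_paths H\<close>; the value
  \<open>0\<close> elsewhere makes the sequence converge for every path.\<close>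

lemma area_lim_measurable:
  assumes H: "1 / 3 < H" and ij: "i \<noteq> j" and st: "s \<le> t"
  shows "(\<lambda>\<omega>. if \<omega> \<in> good_paths H then area_lim (\<lambda>r. \<omega> r $ i) (\<lambda>r. \<omega> r $ j) s t else 0) \<in> borel_measurable P"
proof (rule borel_measurable_LIMSEQ_real)
  note good_paths_measurable[OF H, measurable]
  have [measurable]: "(\<lambda>\<omega>. area ((1 / 2) ^ k) (\<lambda>r. \<omega> r $ i) (\<lambda>r. \<omega> r $ j) s t) \<in> borel_measurable P" for k
    using st by (intro area_measurable) auto
  show "(\<lambda>\<omega>. if \<omega> \<in> good_paths H then area ((1 / 2) ^ k) (\<lambda>r. \<omega> r $ i) (\<lambda>r. \<omega> r $ j) s t else 0) \<in> borel_measurable P" for k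
    by measurable
  show "(\<lambda>k. if \<omega> \<in> good_paths H then area ((1 / 2) ^ k) (\<lambda>r. \<omega> r $ i) (\<lambda>r. \<omega> r $ j) s t else 0) \<longlonglongrightarrow>
      (if \<omega> \<in> good_paths H then area_lim (\<lambda>r. \<omega> r $ i) (\<lambda>r. \<omega> r $ j) s t else 0)" for \<omega>
    using good_area_tendsto[OF H _ ij st] by auto
qed

lemma riemann_sum_area_lim_moment:
  assumes H: "1 / 3 < H" "H \<le> 1 / 2" and ij: "i \<noteq> j" and st: "s < t" and D: "D division_of {s..t}"
  shows "(\<integral>\<^sup>+\<omega>. ennreal ((left_riemann_sum (\<lambda>r. \<omega> r $ i - \<omega> s $ i) (\<lambda>r. \<omega> r $ j) D -
      (if \<omega> \<in> good_paths H then area_lim (\<lambda>r. \<omega> r $ i) (\<lambda>r. \<omega> r $ j) s t else 0))\<^sup>2) \<partial>P)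
    \<le> ennreal ((3 + young_const H H) * (\<Sum>K\<in>D. (Sup K - Inf K) powr (4 * H)))"
proof (rule nn_integral_fatou_le)
  \<comment> \<open>By Chen's relation this equals the left-point sum of the mollified path minus
    its area, which tends to the difference in question as the scale shrinks.\<close>
  define f where "f k \<omega> = - (\<Sum>K\<in>D. area ((1 / 2) ^ k) (\<lambda>r. \<omega> r $ i) (\<lambda>r. \<omega> r $ j) (Inf K) (Sup K))" for k \<omega>
  show "f k \<in> borel_measurable P" for k
    unfolding f_def using division_cell[OF D]
    by (intro borel_measurable_uminus borel_measurable_sum area_measurable) auto
  have "(\<integral>\<^sup>+\<omega>. ennreal ((f k \<omega>)\<^sup>2) \<partial>P) \<le> ennreal ((3 + young_const H H) * (\<Sum>K\<in>D. (Sup K - Inf K) powr (4 * H)))" for k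
    unfolding f_def power2_minus by (rule cell_areas_moment[OF _ _ _ ij _ D st]) (use H in auto)
  then show "\<forall>\<^sub>F k in sequentially. (\<integral>\<^sup>+\<omega>. ennreal ((f k \<omega>)\<^sup>2) \<partial>P) \<le> ennreal ((3 + young_const H H) * (\<Sum>K\<in>D. (Sup K - Inf K) powr (4 * H)))"
    by simp
  show "AE \<omega> in P. (\<lambda>k. f k \<omega>) \<longlonglongrightarrow> left_riemann_sum (\<lambda>r. \<omega> r $ i - \<omega> s $ i) (\<lambda>r. \<omega> r $ j) D -
      (if \<omega> \<in> good_paths H then area_lim (\<lambda>r. \<omega> r $ i) (\<lambda>r. \<omega> r $ j) s t else 0)"
    using AE_good_paths[OF H]
  proof eventually_elim
    case (elim \<omega>)
    note c = good_continuous[OF H(1) elim]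
    let ?a = "\<lambda>i k t. avg ((1 / 2) ^ k) (\<lambda>r. \<omega> r $ i) t"
    have "f k \<omega> = (\<Sum>K\<in>D. (?a i k (Inf K) - ?a i k s) * (?a j k (Sup K) - ?a j k (Inf K))) -
        area ((1 / 2) ^ k) (\<lambda>r. \<omega> r $ i) (\<lambda>r. \<omega> r $ j) s t" for k
      using area_chen_division[OF c c D, of "(1 / 2) ^ k"] by (simp add: f_def)
    moreover have "(\<lambda>k. (\<Sum>K\<in>D. (?a i k (Inf K) - ?a i k s) * (?a j k (Sup K) - ?a j k (Inf K))) -
        area ((1 / 2) ^ k) (\<lambda>r. \<omega> r $ i) (\<lambda>r. \<omega> r $ j) s t) \<longlonglongrightarrow>
        left_riemann_sum (\<lambda>r. \<omega> r $ i - \<omega> s $ i) (\<lambda>r. \<omega> r $ j) D - area_lim (\<lambda>r. \<omega> r $ i) (\<lambda>r. \<omega> r $ j) s t"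
      unfolding left_riemann_sum_def using st
      by (intro tendsto_intros avg_tendsto c good_area_tendsto[OF H(1) elim ij]) auto
    ultimately show ?case using elim by simp
  qed
qed

text \<open>Since \<open>4 * H > 1\<close>, the sum of the cell lengths to the power
  \<open>4 * H\<close> is at most \<open>\<eta> powr (4 * H - 1)\<close> times the length of the
  interval when the mesh is below \<open>\<eta>\<close>.\<close>

lemma riemann_sums_converge:
  assumes H: "1 / 3 < H" "H \<le> 1 / 2" and ij: "i \<noteq> j" and st: "s < t"
  shows "((\<lambda>D. \<integral>\<^sup>+\<omega>. ennreal ((left_riemann_sum (\<lambda>r. \<omega> r $ i - \<omega> s $ i) (\<lambda>r. \<omega> r $ j) D -
      (if \<omega> \<in> good_paths H then area_lim (\<lambda>r. \<omega> r $ i) (\<lambda>r. \<omega> r $ j) s t else 0))\<^sup>2) \<partial>P) \<longlongrightarrow> 0) (mesh_filter s t)"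
    (is "(?F \<longlongrightarrow> 0) _")
proof (rule order_tendstoI)
  fix e :: ennreal assume e: "0 < e"
  define A where "A = (3 + young_const H H) * (t - s)"
  have y0: "0 \<le> young_const H H" using H by (simp add: young_const_def)
  have "((\<lambda>\<eta>. ennreal (A * \<eta> powr (4 * H - 1))) \<longlongrightarrow> ennreal (A * 0)) (at_right 0)"
    using H by (intro tendsto_ennrealI tendsto_mult tendsto_const tendsto_powr_at_right_0) auto
  then have "\<forall>\<^sub>F \<eta> in at_right 0. ennreal (A * \<eta> powr (4 * H - 1)) < e"
    using e by (intro order_tendstoD(2)) auto
  then obtain b where b: "0 < b" "\<And>\<eta>. 0 < \<eta> \<Longrightarrow> \<eta> < b \<Longrightarrow> ennreal (A * \<eta> powr (4 * H - 1)) < e"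
    unfolding eventually_at_right_field by blast
  define \<eta> where "\<eta> = b / 2"
  have \<eta>: "0 < \<eta>" "ennreal (A * \<eta> powr (4 * H - 1)) < e" using b by (auto simp: \<eta>_def)
  have "?F D < e" if D: "D division_of {s..t}" and mesh: "\<forall>K\<in>D. Sup K - Inf K < \<eta>" for D
  proof -
    have "?F D \<le> ennreal ((3 + young_const H H) * (\<Sum>K\<in>D. (Sup K - Inf K) powr (4 * H)))"
      by (rule riemann_sum_area_lim_moment[OF H ij st D])
    also have "\<dots> \<le> ennreal (A * \<eta> powr (4 * H - 1))"
    proof (rule ennreal_leI)
      have "(\<Sum>K\<in>D. (Sup K - Inf K) powr (4 * H)) \<le> (\<Sum>K\<in>D. \<eta> powr (4 * H - 1) * (Sup K - Inf K))"
      proof (rule sum_mono)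
        fix K assume K: "K \<in> D"
        have le: "0 \<le> Sup K - Inf K" using division_cell(2)[OF D K] by simp
        have "(Sup K - Inf K) powr (4 * H) = (Sup K - Inf K) powr (4 * H - 1) * (Sup K - Inf K) powr 1"
          by (simp only: powr_add[symmetric]) simp
        also have "\<dots> \<le> \<eta> powr (4 * H - 1) * (Sup K - Inf K)"
          using mesh[rule_format, OF K] le H powr_one[OF le]
          by (simp only:) (intro mult_right_mono powr_mono2, auto)
        finally show "(Sup K - Inf K) powr (4 * H) \<le> \<eta> powr (4 * H - 1) * (Sup K - Inf K)" .
      qed
      also have "\<dots> = \<eta> powr (4 * H - 1) * (t - s)"
        using sum_division_increments[OF D, of "\<lambda>x. x"] st by (simp add: sum_distrib_left[symmetric])
      finally have "(3 + young_const H H) * (\<Sum>K\<in>D. (Sup K - Inf K) powr (4 * H)) \<le>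
          (3 + young_const H H) * (\<eta> powr (4 * H - 1) * (t - s))" using y0 by (intro mult_left_mono) auto
      then show "(3 + young_const H H) * (\<Sum>K\<in>D. (Sup K - Inf K) powr (4 * H)) \<le> A * \<eta> powr (4 * H - 1)"
        by (simp add: A_def ac_simps)
    qed
    finally show ?thesis using \<eta>(2) by simp
  qed
  then show "\<forall>\<^sub>F D in mesh_filter s t. ?F D < e"
    unfolding eventually_mesh_filter using \<eta>(1) by blast
qed simp

end

lemma continuous_lift_lift2:
  fixes P :: "(real \<Rightarrow> real ^ ('d :: {finite, linorder})) measure"
  assumes H: "1 / 3 < H" "H \<le> 1 / 2" and P: "canonical_fbm H P"
  shows "continuous_lift P (lift2 H)"
proof -
  interpret canonical_fbm H P by (rule P)
  have off: "lift2 H \<omega> s t $ i $ j = (if \<omega> \<in> good_paths H then area_lim (\<lambda>r. \<omega> r $ i) (\<lambda>r. \<omega> r $ j) s t else 0)"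
    if "i < j" for \<omega> :: "real \<Rightarrow> (real, 'd) vec" and s t i j
    using that by (auto simp: lift2_def)
  show ?thesis unfolding continuous_lift_def
  proof (intro conjI ballI allI impI)
    show "continuous_on {(s, t). s \<le> t} (\<lambda>(s, t). lift2 H \<omega> s t)" if "\<omega> \<in> space P" for \<omega>
      using that lift2_continuous[OF H(1)] by (simp add: space_P)
    fix s t :: real and i j :: 'd assume *: "s < t \<and> i < j"
    then have ij: "i < j" "i \<noteq> j" by auto
    show "(\<lambda>\<omega>. lift2 H \<omega> s t $ i $ j) \<in> borel_measurable P"
      unfolding off[OF ij(1)] using * ij by (intro area_lim_measurable H) auto
    show "((\<lambda>D. \<integral>\<^sup>+ \<omega>. ennreal ((left_riemann_sum (\<lambda>r. \<omega> r $ i - \<omega> s $ i) (\<lambda>r. \<omega> r $ j) D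
        - lift2 H \<omega> s t $ i $ j)\<^sup>2) \<partial>P) \<longlongrightarrow> 0) (mesh_filter s t)"
      unfolding off[OF ij(1)] using * ij by (intro riemann_sums_converge H) auto
  next
    fix \<omega> :: "real \<Rightarrow> (real, 'd) vec" and s t :: real and i
    show "lift2 H \<omega> s t $ i $ i = (\<omega> t $ i - \<omega> s $ i)\<^sup>2 / 2" by (simp add: lift2_def)
  next
    fix \<omega> :: "real \<Rightarrow> (real, 'd) vec" and s t :: real and i j :: 'd assume *: "s < t \<and> i < j"
    show "lift2 H \<omega> s t $ j $ i = - lift2 H \<omega> s t $ i $ j + (\<omega> t $ i - \<omega> s $ i) * (\<omega> t $ j - \<omega> s $ j)"
    proof (cases "\<omega> \<in> good_paths H")
      case True
      then show ?thesis using good_area_lim_by_parts[OF H(1) True, of i j s t] * by (auto simp: lift2_def)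
    next
      case False
      then show ?thesis using * by (auto simp: lift2_def)
    qed
  qed
qed

section \<open>Rates of convergence in the rough path metric\<close>

lemma dyadic_scale:
  fixes \<delta> :: real
  assumes "0 < \<delta>" "\<delta> \<le> 1"
  obtains k where "(1 / 2) ^ Suc k \<le> \<delta>" "\<delta> \<le> (1 / 2) ^ k"
proof -
  obtain n where "(1 / 2 :: real) ^ n < \<delta>" using real_arch_pow_inv[OF assms(1), of "1 / 2"] by auto
  then have ex: "\<exists>n. (1 / 2 :: real) ^ Suc n \<le> \<delta>"
    by (intro exI[of _ n] order_trans[OF power_decreasing[of n "Suc n"] less_imp_le]) auto
  define k where "k = (LEAST n. (1 / 2 :: real) ^ Suc n \<le> \<delta>)"
  have k: "(1 / 2) ^ Suc k \<le> \<delta>" unfolding k_def by (rule LeastI_ex[OF ex])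
  moreover have "\<delta> \<le> (1 / 2) ^ k"
  proof (cases k)
    case (Suc l)
    then have "\<not> (1 / 2) ^ Suc l \<le> \<delta>" using not_less_Least[of l "\<lambda>n. (1 / 2 :: real) ^ Suc n \<le> \<delta>"] by (simp add: k_def)
    then show ?thesis using Suc by simp
  qed (use assms in simp)
  ultimately show thesis by (rule that)
qed

lemma norm_vec_le_sum: "norm (x :: 'a :: real_normed_vector ^ 'n) \<le> (\<Sum>i\<in>UNIV. norm (x $ i))"
  unfolding norm_vec_def by (rule L2_set_le_sum) simp

text \<open>The gap between \<open>\<beta>\<close> and \<open>\<gamma>\<close> leaves a power of
  \<open>\<delta>\<close>. For the diagonal entries a difference of squares is factored: the
  difference carries the rate, and the sum is Hoelder of exponent \<open>\<gamma>\<close>, weakened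
  to \<open>\<beta>\<close> on the bounded window.\<close>

lemma good_first_level_rate:
  fixes \<omega> :: "real \<Rightarrow> real ^ 'd"
  assumes good: "\<omega> \<in> holder_paths H" and \<beta>: "0 < \<beta>" "\<beta> < \<gamma>" "\<gamma> < H" and T: "0 < T"
  obtains K where "0 \<le> K"
    "\<And>\<delta> s t i. 0 < \<delta> \<Longrightarrow> \<delta> \<le> 1 \<Longrightarrow> - T \<le> s \<Longrightarrow> s < t \<Longrightarrow> t \<le> T \<Longrightarrow>
      \<bar>(\<omega> t $ i - \<omega> s $ i) - (avg \<delta> (\<lambda>r. \<omega> r $ i) t - avg \<delta> (\<lambda>r. \<omega> r $ i) s)\<bar> \<le> K * \<delta> powr (\<gamma> - \<beta>) * (t - s) powr \<beta>"
    "\<And>\<delta> s t i. 0 < \<delta> \<Longrightarrow> \<delta> \<le> 1 \<Longrightarrow> - T \<le> s \<Longrightarrow> s < t \<Longrightarrow> t \<le> T \<Longrightarrow>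
      \<bar>(\<omega> t $ i - \<omega> s $ i)\<^sup>2 / 2 - (avg \<delta> (\<lambda>r. \<omega> r $ i) t - avg \<delta> (\<lambda>r. \<omega> r $ i) s)\<^sup>2 / 2\<bar> \<le> K * \<delta> powr (\<gamma> - \<beta>) * (t - s) powr (2 * \<beta>)"
proof -
  obtain K where K: "0 \<le> K" "\<And>i r r'. r \<in> {-(T+1)..T+1} \<Longrightarrow> r' \<in> {-(T+1)..T+1} \<Longrightarrow> \<bar>\<omega> r' $ i - \<omega> r $ i\<bar> \<le> K * \<bar>r' - r\<bar> powr \<gamma>"
    using holder_coord_bounds[OF good, of \<gamma> "T + 1"] \<beta> T by auto
  have c: "continuous_on UNIV (\<lambda>r. \<omega> r $ i)" for i
    using good by (intro continuous_on_component) (simp add: holder_paths_def)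
  let ?R = "(2 * T) powr (\<gamma> - \<beta>)"
  define K' where "K' = 2 * K + 2 * K * (K * ?R)"
  have K': "0 \<le> K'" "2 * K \<le> K'" "2 * K * (K * ?R) \<le> K'" using K by (auto simp: K'_def)
  have first: "\<bar>(\<omega> t $ i - \<omega> s $ i) - (avg \<delta> (\<lambda>r. \<omega> r $ i) t - avg \<delta> (\<lambda>r. \<omega> r $ i) s)\<bar> \<le> 2 * K * \<delta> powr (\<gamma> - \<beta>) * (t - s) powr \<beta>"
    if "0 < \<delta>" "\<delta> \<le> 1" "- T \<le> s" "s < t" "t \<le> T" for \<delta> s t i
  proof -
    have "\<bar>(\<omega> t $ i - \<omega> s $ i) - (avg \<delta> (\<lambda>r. \<omega> r $ i) t - avg \<delta> (\<lambda>r. \<omega> r $ i) s)\<bar> \<le> 2 * K * \<delta> powr (\<gamma> - \<beta>) * \<bar>t - s\<bar> powr \<beta>"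
      by (rule avg_rate[OF c K(1), where T=T]) (use K(2) that \<beta> in \<open>auto simp: minus_add_distrib\<close>)
    then show ?thesis using that by simp
  qed
  show thesis
  proof (rule that[OF K'(1)])
    fix \<delta> s t :: real and i assume *: "0 < \<delta>" "\<delta> \<le> 1" "- T \<le> s" "s < t" "t \<le> T"
    let ?x = "\<omega> t $ i - \<omega> s $ i" and ?y = "avg \<delta> (\<lambda>r. \<omega> r $ i) t - avg \<delta> (\<lambda>r. \<omega> r $ i) s"
    have "2 * K * \<delta> powr (\<gamma> - \<beta>) * (t - s) powr \<beta> \<le> K' * \<delta> powr (\<gamma> - \<beta>) * (t - s) powr \<beta>"
      using K' by (intro mult_right_mono) auto
    then show "\<bar>?x - ?y\<bar> \<le> K' * \<delta> powr (\<gamma> - \<beta>) * (t - s) powr \<beta>" using first[OF *, of i] by linarith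
    have w: "K * \<bar>t - s\<bar> powr \<gamma> \<le> K * ?R * (t - s) powr \<beta>"
    proof -
      have "\<bar>t - s\<bar> powr \<gamma> = (t - s) powr (\<gamma> - \<beta>) * (t - s) powr \<beta>" using * by (simp add: powr_add[symmetric])
      also have "\<dots> \<le> ?R * (t - s) powr \<beta>" using * \<beta> by (intro mult_right_mono powr_mono2) auto
      finally show ?thesis using K by (simp add: mult_left_mono mult.assoc)
    qed
    obtain r where r: "0 < r" "r < \<delta>" "?y = \<omega> (t + r) $ i - \<omega> (s + r) $ i"
      using avg_diff_mean_value[OF c *(1), of i t s] by blast
    have "\<bar>?x\<bar> \<le> K * \<bar>t - s\<bar> powr \<gamma>" using K(2)[of s t i] * by auto
    moreover have "\<bar>?y\<bar> \<le> K * \<bar>t - s\<bar> powr \<gamma>" using K(2)[of "s + r" "t + r" i] * r by auto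
    ultimately have "\<bar>?x + ?y\<bar> \<le> K * \<bar>t - s\<bar> powr \<gamma> + K * \<bar>t - s\<bar> powr \<gamma>"
      by (rule order_trans[OF abs_triangle_ineq add_mono])
    moreover have "a / 2 \<le> c" if "a \<le> b + b" "b \<le> c" for a b c :: real using that by simp
    ultimately have sum: "\<bar>?x + ?y\<bar> / 2 \<le> K * ?R * (t - s) powr \<beta>" using w by blast
    have "?x\<^sup>2 / 2 - ?y\<^sup>2 / 2 = (?x - ?y) * ((?x + ?y) / 2)" by (simp add: power2_eq_square field_simps)
    then have "\<bar>?x\<^sup>2 / 2 - ?y\<^sup>2 / 2\<bar> = \<bar>?x - ?y\<bar> * (\<bar>?x + ?y\<bar> / 2)" by (simp only: abs_mult abs_divide abs_numeral)
    also have "\<dots> \<le> (2 * K * \<delta> powr (\<gamma> - \<beta>) * (t - s) powr \<beta>) * (K * ?R * (t - s) powr \<beta>)"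
      using K by (intro mult_mono first * sum) auto
    also have "\<dots> = 2 * K * (K * ?R) * (\<delta> powr (\<gamma> - \<beta>) * (t - s) powr (2 * \<beta>))"
    proof -
      have "(t - s) powr (2 * \<beta>) = (t - s) powr \<beta> * (t - s) powr \<beta>" by (simp add: powr_add[symmetric])
      then show ?thesis by (simp only: ac_simps)
    qed
    also have "\<dots> \<le> K' * (\<delta> powr (\<gamma> - \<beta>) * (t - s) powr (2 * \<beta>))" using K' by (intro mult_right_mono) auto
    finally show "\<bar>?x\<^sup>2 / 2 - ?y\<^sup>2 / 2\<bar> \<le> K' * \<delta> powr (\<gamma> - \<beta>) * (t - s) powr (2 * \<beta>)" by (simp only: mult.assoc)
  qed
qed

text \<open>A scale in the \<open>k\<close>-th block satisfies
  \<open>(1 / 2) ^ k \<le> 2 * \<delta>\<close>, which converts the dyadic rate into a power of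
  \<open>\<delta>\<close>. The constants of all index pairs are summed into one, and the exponent of
  the length is lowered to \<open>2 * \<beta>\<close> at the cost of a power of
  \<open>2 * T\<close>.\<close>

lemma good_second_level_rate:
  fixes \<omega> :: "real \<Rightarrow> real ^ 'd"
  assumes H: "1 / 3 < H" and good: "\<omega> \<in> good_paths H" and \<beta>: "\<beta> < rate_exp H m" and T: "0 < T"
  obtains C where "0 \<le> C"
    "\<And>\<delta> s t i j. i \<noteq> j \<Longrightarrow> 0 < \<delta> \<Longrightarrow> \<delta> \<le> 1 \<Longrightarrow> - T \<le> s \<Longrightarrow> s < t \<Longrightarrow> t \<le> T \<Longrightarrow>
      \<bar>area_lim (\<lambda>r. \<omega> r $ i) (\<lambda>r. \<omega> r $ j) s t - area \<delta> (\<lambda>r. \<omega> r $ i) (\<lambda>r. \<omega> r $ j) s t\<bar>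
      \<le> C * \<delta> powr ((H - rate_exp H m) / 2) * (t - s) powr (2 * \<beta>)"
proof -
  let ?\<gamma> = "rate_exp H m" and ?\<kappa> = "(H - rate_exp H m) / 2"
  have \<kappa>: "0 < ?\<kappa>" using rate_exp_bounds[OF H, of m] by simp
  obtain n :: nat where n: "T \<le> real n" using real_arch_simple by blast
  have "\<exists>C\<ge>0. \<forall>k \<delta> s t. (1 / 2) ^ Suc k \<le> \<delta> \<longrightarrow> \<delta> \<le> (1 / 2) ^ k \<longrightarrow> - real n \<le> s \<longrightarrow> s < t \<longrightarrow> t \<le> real n \<longrightarrow>
      \<bar>area \<delta> (\<lambda>r. \<omega> r $ i) (\<lambda>r. \<omega> r $ j) s t - area_lim (\<lambda>r. \<omega> r $ i) (\<lambda>r. \<omega> r $ j) s t\<bar>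
      \<le> C * 2 powr (- ?\<kappa> * k) * (t - s) powr (2 * ?\<gamma>)" if "i \<noteq> j" for i j
    by (rule good_rate[OF H good that, of n m]) blast
  then obtain C where C: "\<And>i j. i \<noteq> j \<Longrightarrow> 0 \<le> C i j"
    "\<And>i j k \<delta> s t. i \<noteq> j \<Longrightarrow> (1 / 2) ^ Suc k \<le> \<delta> \<Longrightarrow> \<delta> \<le> (1 / 2) ^ k \<Longrightarrow> - real n \<le> s \<Longrightarrow> s < t \<Longrightarrow> t \<le> real n \<Longrightarrow>
      \<bar>area \<delta> (\<lambda>r. \<omega> r $ i) (\<lambda>r. \<omega> r $ j) s t - area_lim (\<lambda>r. \<omega> r $ i) (\<lambda>r. \<omega> r $ j) s t\<bar>
      \<le> C i j * 2 powr (- ?\<kappa> * k) * (t - s) powr (2 * ?\<gamma>)" by metis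
  define C1 where "C1 = (\<Sum>i\<in>UNIV. \<Sum>j\<in>UNIV. \<bar>C i j\<bar>)"
  have C1: "C i j \<le> C1" for i j
  proof -
    have "C i j \<le> \<bar>C i j\<bar>" by simp
    also have "\<dots> \<le> (\<Sum>j\<in>UNIV. \<bar>C i j\<bar>)" by (rule member_le_sum) auto
    also have "\<dots> \<le> C1" unfolding C1_def
      by (rule member_le_sum[where f="\<lambda>i. \<Sum>j\<in>UNIV. \<bar>C i j\<bar>"]) (auto intro: sum_nonneg)
    finally show ?thesis .
  qed
  have C10: "0 \<le> C1" unfolding C1_def by (intro sum_nonneg) auto
  let ?R = "(2 * T) powr (2 * ?\<gamma> - 2 * \<beta>)"
  show thesis
  proof (rule that[of "C1 * 2 powr ?\<kappa> * ?R"])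
    show "0 \<le> C1 * 2 powr ?\<kappa> * ?R" using C10 by simp
    fix \<delta> s t :: real and i j :: 'd assume *: "i \<noteq> j" "0 < \<delta>" "\<delta> \<le> 1" "- T \<le> s" "s < t" "t \<le> T"
    obtain k where k: "(1 / 2) ^ Suc k \<le> \<delta>" "\<delta> \<le> (1 / 2) ^ k" by (rule dyadic_scale[OF *(2,3)])
    have "2 powr (- ?\<kappa> * k) = (2 powr (- real k)) powr ?\<kappa>" by (simp only: powr_powr) (simp add: mult.commute)
    also have "2 powr (- real k) = (1 / 2) ^ k"
      by (simp add: powr_minus powr_realpow power_one_over inverse_eq_divide)
    also have "((1 / 2 :: real) ^ k) powr ?\<kappa> \<le> (2 * \<delta>) powr ?\<kappa>" using k \<kappa> by (intro powr_mono2) auto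
    also have "\<dots> = 2 powr ?\<kappa> * \<delta> powr ?\<kappa>" by (rule powr_mult)
    finally have scale: "2 powr (- ?\<kappa> * k) \<le> 2 powr ?\<kappa> * \<delta> powr ?\<kappa>" .
    have len: "(t - s) powr (2 * ?\<gamma>) \<le> ?R * (t - s) powr (2 * \<beta>)"
    proof -
      have "(t - s) powr (2 * ?\<gamma>) = (t - s) powr (2 * ?\<gamma> - 2 * \<beta>) * (t - s) powr (2 * \<beta>)" by (simp add: powr_add[symmetric])
      also have "\<dots> \<le> ?R * (t - s) powr (2 * \<beta>)" using * \<beta> by (intro mult_right_mono powr_mono2) auto
      finally show ?thesis .
    qed
    have "\<bar>area_lim (\<lambda>r. \<omega> r $ i) (\<lambda>r. \<omega> r $ j) s t - area \<delta> (\<lambda>r. \<omega> r $ i) (\<lambda>r. \<omega> r $ j) s t\<bar>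
        \<le> C i j * 2 powr (- ?\<kappa> * k) * (t - s) powr (2 * ?\<gamma>)"
      using C(2)[OF *(1) k, of s t] * n by (simp add: abs_minus_commute)
    also have "\<dots> \<le> C1 * (2 powr ?\<kappa> * \<delta> powr ?\<kappa>) * (?R * (t - s) powr (2 * \<beta>))"
      using C(1)[OF *(1)] C10 by (intro mult_mono C1 scale len) auto
    finally show "\<bar>area_lim (\<lambda>r. \<omega> r $ i) (\<lambda>r. \<omega> r $ j) s t - area \<delta> (\<lambda>r. \<omega> r $ i) (\<lambda>r. \<omega> r $ j) s t\<bar>
        \<le> C1 * 2 powr ?\<kappa> * ?R * \<delta> powr ?\<kappa> * (t - s) powr (2 * \<beta>)" by (simp only: ac_simps)
  qed
qed

text \<open>A single exponent \<open>rate_exp H m\<close> strictly between \<open>\<beta>\<close>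
  and \<open>H\<close> leaves a positive power of \<open>\<delta>\<close> at both levels: its
  distance to \<open>\<beta>\<close> drives the path and the diagonal, its distance to
  \<open>H\<close> the off-diagonal areas.\<close>

lemma rough_dist_good:
  fixes \<omega> :: "real \<Rightarrow> real ^ ('d :: {finite, linorder})"
  assumes H: "1 / 3 < H" and good: "\<omega> \<in> good_paths H" and \<beta>: "0 < \<beta>" "\<beta> < H" and T: "0 < T"
  shows "((\<lambda>\<delta>. rough_dist \<beta> {-T..T} (\<omega>, lift2 H \<omega>) (smooth_path \<delta> \<omega>, smooth_area \<delta> \<omega>)) \<longlongrightarrow> 0) (at_right 0)"
proof -
  obtain m where m: "\<beta> < rate_exp H m" by (rule rate_exp_above[OF H \<beta>(2)])
  let ?\<gamma> = "rate_exp H m"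
  have \<gamma>: "?\<gamma> < H" by (rule rate_exp_bounds[OF H])
  have hp: "\<omega> \<in> holder_paths H" using good by (simp add: good_paths_def)
  have cont: "continuous_on UNIV \<omega>" using hp by (simp add: holder_paths_def)
  obtain K where K: "0 \<le> K"
    "\<And>\<delta> s t i. 0 < \<delta> \<Longrightarrow> \<delta> \<le> 1 \<Longrightarrow> - T \<le> s \<Longrightarrow> s < t \<Longrightarrow> t \<le> T \<Longrightarrow>
      \<bar>(\<omega> t $ i - \<omega> s $ i) - (avg \<delta> (\<lambda>r. \<omega> r $ i) t - avg \<delta> (\<lambda>r. \<omega> r $ i) s)\<bar> \<le> K * \<delta> powr (?\<gamma> - \<beta>) * (t - s) powr \<beta>"
    "\<And>\<delta> s t i. 0 < \<delta> \<Longrightarrow> \<delta> \<le> 1 \<Longrightarrow> - T \<le> s \<Longrightarrow> s < t \<Longrightarrow> t \<le> T \<Longrightarrow>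
      \<bar>(\<omega> t $ i - \<omega> s $ i)\<^sup>2 / 2 - (avg \<delta> (\<lambda>r. \<omega> r $ i) t - avg \<delta> (\<lambda>r. \<omega> r $ i) s)\<^sup>2 / 2\<bar> \<le> K * \<delta> powr (?\<gamma> - \<beta>) * (t - s) powr (2 * \<beta>)"
    by (rule good_first_level_rate[OF hp \<beta>(1) m \<gamma> T]) blast
  obtain C where C: "0 \<le> C"
    "\<And>\<delta> s t i j. i \<noteq> j \<Longrightarrow> 0 < \<delta> \<Longrightarrow> \<delta> \<le> 1 \<Longrightarrow> - T \<le> s \<Longrightarrow> s < t \<Longrightarrow> t \<le> T \<Longrightarrow>
      \<bar>area_lim (\<lambda>r. \<omega> r $ i) (\<lambda>r. \<omega> r $ j) s t - area \<delta> (\<lambda>r. \<omega> r $ i) (\<lambda>r. \<omega> r $ j) s t\<bar>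
      \<le> C * \<delta> powr ((H - ?\<gamma>) / 2) * (t - s) powr (2 * \<beta>)"
    by (rule good_second_level_rate[OF H good m T]) blast
  \<comment> \<open>Norms are bounded by sums of entries, which costs \<open>N\<close> for vectors
    and \<open>N * N\<close> for matrices.\<close>
  define N where "N = real CARD('d)"
  define g where "g \<delta> = K * \<delta> powr (?\<gamma> - \<beta>) + C * \<delta> powr ((H - ?\<gamma>) / 2)" for \<delta>
  have g: "K * \<delta> powr (?\<gamma> - \<beta>) \<le> g \<delta>" "C * \<delta> powr ((H - ?\<gamma>) / 2) \<le> g \<delta>" "0 \<le> g \<delta>" for \<delta>
    using K C by (auto simp: g_def)
  have bound: "rough_dist \<beta> {-T..T} (\<omega>, lift2 H \<omega>) (smooth_path \<delta> \<omega>, smooth_area \<delta> \<omega>) \<le> ennreal (N * g \<delta>) + ennreal (N * (N * g \<delta>))"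
    if \<delta>: "0 < \<delta>" "\<delta> \<le> 1" for \<delta>
    unfolding rough_dist_def prod.case
  proof (intro add_mono SUP_least)
    fix z assume z: "z \<in> {(s, t). s \<in> {-T..T} \<and> t \<in> {-T..T} \<and> s < t}"
    then obtain s t where st: "z = (s, t)" "- T \<le> s" "s < t" "t \<le> T" by auto
    have "norm ((\<omega> t - \<omega> s) - (smooth_path \<delta> \<omega> t - smooth_path \<delta> \<omega> s)) \<le>
        (\<Sum>i\<in>UNIV. norm (((\<omega> t - \<omega> s) - (smooth_path \<delta> \<omega> t - smooth_path \<delta> \<omega> s)) $ i))" by (rule norm_vec_le_sum)
    also have "\<dots> \<le> (\<Sum>i\<in>(UNIV :: 'd set). g \<delta> * (t - s) powr \<beta>)"
    proof (rule sum_mono)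
      fix i
      have "norm (((\<omega> t - \<omega> s) - (smooth_path \<delta> \<omega> t - smooth_path \<delta> \<omega> s)) $ i) \<le> K * \<delta> powr (?\<gamma> - \<beta>) * (t - s) powr \<beta>"
        using K(2)[OF \<delta> st(2,3,4), of i] by (simp add: smooth_path_nth[OF cont])
      also have "\<dots> \<le> g \<delta> * (t - s) powr \<beta>" by (intro mult_right_mono g) auto
      finally show "norm (((\<omega> t - \<omega> s) - (smooth_path \<delta> \<omega> t - smooth_path \<delta> \<omega> s)) $ i) \<le> g \<delta> * (t - s) powr \<beta>" .
    qed
    also have "\<dots> = N * g \<delta> * \<bar>t - s\<bar> powr \<beta>" using st by (simp add: N_def)
    finally show "(case z of (s, t) \<Rightarrow> ennreal (norm (\<omega> t - \<omega> s - (smooth_path \<delta> \<omega> t - smooth_path \<delta> \<omega> s)) / \<bar>t - s\<bar> powr \<beta>)) \<le> ennreal (N * g \<delta>)"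
      using st by (auto simp: pos_divide_le_eq intro!: ennreal_leI)
    have "norm (lift2 H \<omega> s t - smooth_area \<delta> \<omega> s t) \<le> (\<Sum>i\<in>UNIV. norm ((lift2 H \<omega> s t - smooth_area \<delta> \<omega> s t) $ i))"
      by (rule norm_vec_le_sum)
    also have "\<dots> \<le> (\<Sum>i\<in>(UNIV :: 'd set). \<Sum>j\<in>(UNIV :: 'd set). g \<delta> * (t - s) powr (2 * \<beta>))"
    proof (rule sum_mono)
      fix i
      have "norm ((lift2 H \<omega> s t - smooth_area \<delta> \<omega> s t) $ i) \<le> (\<Sum>j\<in>UNIV. norm ((lift2 H \<omega> s t - smooth_area \<delta> \<omega> s t) $ i $ j))"
        by (rule norm_vec_le_sum)
      also have "\<dots> \<le> (\<Sum>j\<in>(UNIV :: 'd set). g \<delta> * (t - s) powr (2 * \<beta>))"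
      proof (rule sum_mono)
        fix j
        have sa: "smooth_area \<delta> \<omega> s t $ i $ j = area \<delta> (\<lambda>r. \<omega> r $ i) (\<lambda>r. \<omega> r $ j) s t"
          using st by (intro smooth_area_nth cont) auto
        show "norm ((lift2 H \<omega> s t - smooth_area \<delta> \<omega> s t) $ i $ j) \<le> g \<delta> * (t - s) powr (2 * \<beta>)"
        proof (cases "i = j")
          case True
          have "norm ((lift2 H \<omega> s t - smooth_area \<delta> \<omega> s t) $ i $ j) \<le> K * \<delta> powr (?\<gamma> - \<beta>) * (t - s) powr (2 * \<beta>)"
            using K(3)[OF \<delta> st(2,3,4), of i] True area_self[OF good_continuous[OF H good], of s t \<delta> i] st sa
            by (simp add: lift2_def)
          also have "\<dots> \<le> g \<delta> * (t - s) powr (2 * \<beta>)" by (intro mult_right_mono g) auto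
          finally show ?thesis .
        next
          case False
          have "norm ((lift2 H \<omega> s t - smooth_area \<delta> \<omega> s t) $ i $ j) \<le> C * \<delta> powr ((H - ?\<gamma>) / 2) * (t - s) powr (2 * \<beta>)"
            using C(2)[OF False \<delta> st(2,3,4)] False good by (simp add: sa lift2_def)
          also have "\<dots> \<le> g \<delta> * (t - s) powr (2 * \<beta>)" by (intro mult_right_mono g) auto
          finally show ?thesis .
        qed
      qed
      finally show "norm ((lift2 H \<omega> s t - smooth_area \<delta> \<omega> s t) $ i) \<le> (\<Sum>j\<in>(UNIV :: 'd set). g \<delta> * (t - s) powr (2 * \<beta>))" .
    qed
    also have "\<dots> = N * (N * g \<delta>) * \<bar>t - s\<bar> powr (2 * \<beta>)" using st by (simp add: N_def)
    finally show "(case z of (s, t) \<Rightarrow> ennreal (norm (lift2 H \<omega> s t - smooth_area \<delta> \<omega> s t) / \<bar>t - s\<bar> powr (2 * \<beta>))) \<le> ennreal (N * (N * g \<delta>))"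
      using st by (auto simp: pos_divide_le_eq intro!: ennreal_leI)
  qed
  have "(g \<longlongrightarrow> K * 0 + C * 0) (at_right 0)"
    unfolding g_def[abs_def] using m \<gamma>
    by (intro tendsto_add tendsto_mult tendsto_const tendsto_powr_at_right_0) auto
  then have "((\<lambda>\<delta>. ennreal (N * g \<delta>) + ennreal (N * (N * g \<delta>))) \<longlongrightarrow> ennreal (N * 0) + ennreal (N * (N * 0))) (at_right 0)"
    by (intro tendsto_add tendsto_ennrealI tendsto_mult tendsto_const) simp_all
  then have upper: "((\<lambda>\<delta>. ennreal (N * g \<delta>) + ennreal (N * (N * g \<delta>))) \<longlongrightarrow> 0) (at_right 0)" by simp
  have ev: "\<forall>\<^sub>F \<delta> in at_right 0. 0 < \<delta> \<and> \<delta> \<le> (1 :: real)"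
    unfolding eventually_at_right_field by (intro exI[of _ 1]) auto
  show ?thesis
  proof (rule tendsto_sandwich[OF _ _ tendsto_const upper])
    show "\<forall>\<^sub>F \<delta> in at_right 0. rough_dist \<beta> {-T..T} (\<omega>, lift2 H \<omega>) (smooth_path \<delta> \<omega>, smooth_area \<delta> \<omega>) \<le>
        ennreal (N * g \<delta>) + ennreal (N * (N * g \<delta>))"
      using ev by eventually_elim (use bound in auto)
  qed simp
qed

theorem theorem3p2:
  fixes H :: real and P :: "(real \<Rightarrow> real ^ ('d :: {finite, linorder})) measure"
  assumes "1 / 3 < H" and "H \<le> 1 / 2"
    and "canonical_fbm H P"
  shows "\<exists>om2. continuous_lift P om2 \<and>
    (\<exists>\<Omega>'. \<Omega>' \<subseteq> holder_paths H \<and> \<Omega>' \<in> sets P \<and> measure P \<Omega>' = 1 \<and> shift_invariant H \<Omega>' \<and>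
      (\<forall>\<omega>\<in>\<Omega>'. \<forall>T > 0. \<forall>\<beta>. 1 / 3 < \<beta> \<and> \<beta> < H \<longrightarrow>
        ((\<lambda>\<delta>. rough_dist \<beta> {-T..T} (\<omega>, om2 \<omega>) (smooth_path \<delta> \<omega>, smooth_area \<delta> \<omega>))
          \<longlongrightarrow> 0) (at_right 0)))"
proof (intro exI conjI)
  interpret canonical_fbm H P by (rule assms(3))
  show "continuous_lift P (lift2 H)" by (rule continuous_lift_lift2[OF assms])
  show "good_paths H \<subseteq> holder_paths H" by (auto simp: good_paths_def)
  show sets: "good_paths H \<in> sets P" by (rule good_paths_measurable[OF assms(1)])
  show "measure P (good_paths H) = 1"
    using prob_eq_1[OF sets] AE_good_paths[OF assms(1,2)] by simp
  show "shift_invariant H (good_paths H)" by (rule good_paths_shift_invariant)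
  show "\<forall>\<omega>\<in>good_paths H. \<forall>T > 0. \<forall>\<beta>. 1 / 3 < \<beta> \<and> \<beta> < H \<longrightarrow>
        ((\<lambda>\<delta>. rough_dist \<beta> {-T..T} (\<omega>, lift2 H \<omega>) (smooth_path \<delta> \<omega>, smooth_area \<delta> \<omega>))
          \<longlongrightarrow> 0) (at_right 0)"
    by (intro ballI allI impI rough_dist_good[OF assms(1)]) auto
qed

end
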